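(* There is an absolute constant $c>0$ such that for every $n\ge 1$ and all convex bodies $K, B\subset\mathbb{R}^n$ with $B$ isotropic, $$L_K \le c\,\bigl(1+\sqrt{\log v}\bigr)\,v\,\tau^{-1/2},$$ where $\tau=\tau_1(B)$ is the $L_1$ transportation cost constant of the uniform probability measure on $B$, $v=\mathrm{vr}(B,K)$ is the volume ratio of $K$ in $B$, and $L_K$ is the isotropic constant of $K$.
   Context: $\mathbb{R}^n$ carries its standard inner product $\langle\cdot,\cdot\rangle$ and Euclidean norm $|\cdot|$; $|A|$ also denotes the Lebesgue measure of a measurable set $A$. A convex body is a compact convex set with nonempty interior. For measurable $A$ with $0<|A|<\infty$, $m_A$ is the uniform probability measure on $A$: $m_A(C)=|A\cap C|/|A|$. Isotropic bodies. A convex body $K\subset\mathbb{R}^n$ is isotropic if (1) its centroid is $0$; (2) $|K|=1$; (3) there is a constant $L_K>0$ such that $\int_K\langle x,y\rangle^2\,dx=L_K^2|y|^2$ for all $y\in\mathbb{R}^n$. Every convex body $K$ has an image $T(K)$ under an invertible affine map $T$, unique up to orthogonal transformations, which is isotropic; the isotropic constant of $K$ is defined as $L_K=L_{T(K)}$. Volume ratio. For convex bodies $K,B\subset\mathbb{R}^n$, $$\mathrm{vr}(B,K)=\min_T\left(\frac{|B|}{|T(K)|}\right)^{1/n},$$ where $T$ runs over (invertible) affine transformations of $\mathbb{R}^n$ with $T(K)\subset B$. Transportation cost constant. For Borel probability measures $\mu,\nu$ on $\mathbb{R}^n$, the $L_1$ Wasserstein distance is $W_1(\mu,\nu)=\inf_\pi\int|x-y|\,d\pi(x,y)$,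 where $\pi$ runs over probability measures on $\mathbb{R}^n\times\mathbb{R}^n$ with marginals $\mu$ and $\nu$. If $\nu\ll\mu$, the relative entropy is $H(\nu|\mu)=\int\log\left(\frac{d\nu}{d\mu}\right)d\nu$. The $L_1$ transportation cost constant $\tau_1(\mu)$ is the largest constant $\tau$ such that $W_1(\mu,\nu)\le\sqrt{\frac{2}{\tau}H(\nu|\mu)}$ for every $\nu\ll\mu$. For a convex body $B$, $\tau_1(B)$ means $\tau_1(m_B)$. "Absolute constant" means independent of $n$, $K$ and $B$. *)

theory Defs
  imports "HOL-Probability.Probability"
begin

text \<open>
  The dimension \<open>n\<close> must be an object-level variable, because the constant in the statement is
  chosen before \<open>n\<close>. Hence points of Euclidean \<open>n\<close>-space are the extensional functions in
  \<open>{..<n} \<rightarrow>\<^sub>E UNIV\<close>. This is the space of the product measure \<open>lborel_n n\<close>, whose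
  \<open>\<sigma>\<close>-algebra is the Borel one, and the underlying set of the topology \<open>powertop_real {..<n}\<close>.
\<close>

abbreviation Rn :: "nat \<Rightarrow> (nat \<Rightarrow> real) set" where
  "Rn n \<equiv> {..<n} \<rightarrow>\<^sub>E UNIV"

definition lborel_n :: "nat \<Rightarrow> (nat \<Rightarrow> real) measure" where
  "lborel_n n = Pi\<^sub>M {..<n} (\<lambda>_. lborel)"

abbreviation vol :: "nat \<Rightarrow> (nat \<Rightarrow> real) set \<Rightarrow> real" where
  "vol n A \<equiv> measure (lborel_n n) A"

definition inner_n :: "nat \<Rightarrow> (nat \<Rightarrow> real) \<Rightarrow> (nat \<Rightarrow> real) \<Rightarrow> real" where
  "inner_n n x y = (\<Sum>i<n. x i * y i)"

definition norm_n :: "nat \<Rightarrow> (nat \<Rightarrow> real) \<Rightarrow> real" where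
  "norm_n n x = sqrt (inner_n n x x)"

definition dist_n :: "nat \<Rightarrow> (nat \<Rightarrow> real) \<Rightarrow> (nat \<Rightarrow> real) \<Rightarrow> real" where
  "dist_n n x y = norm_n n (\<lambda>i. x i - y i)"

definition convex_n :: "nat \<Rightarrow> (nat \<Rightarrow> real) set \<Rightarrow> bool" where
  "convex_n n K \<longleftrightarrow>
     (\<forall>x\<in>K. \<forall>y\<in>K. \<forall>u\<ge>0. \<forall>v\<ge>0. u + v = 1 \<longrightarrow> (\<lambda>i\<in>{..<n}. u * x i + v * y i) \<in> K)"

definition convex_body :: "nat \<Rightarrow> (nat \<Rightarrow> real) set \<Rightarrow> bool" where
  "convex_body n K \<longleftrightarrow>
     compactin (powertop_real {..<n}) K \<and> convex_n n K \<and> powertop_real {..<n} interior_of K \<noteq> {}"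

definition invertible_affine :: "nat \<Rightarrow> ((nat \<Rightarrow> real) \<Rightarrow> (nat \<Rightarrow> real)) \<Rightarrow> bool" where
  "invertible_affine n T \<longleftrightarrow>
     bij_betw T (Rn n) (Rn n) \<and>
     (\<exists>(A :: nat \<Rightarrow> nat \<Rightarrow> real) b. \<forall>x\<in>Rn n. T x = (\<lambda>i\<in>{..<n}. (\<Sum>j<n. A i j * x j) + b i))"

definition centroid :: "nat \<Rightarrow> (nat \<Rightarrow> real) set \<Rightarrow> nat \<Rightarrow> real" where
  "centroid n K = (\<lambda>i\<in>{..<n}. (LINT x:K|lborel_n n. x i) / vol n K)"

definition isotropic_with :: "nat \<Rightarrow> (nat \<Rightarrow> real) set \<Rightarrow> real \<Rightarrow> bool" where
  "isotropic_with n K L \<longleftrightarrow>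
     convex_body n K \<and> centroid n K = (\<lambda>i\<in>{..<n}. 0) \<and> vol n K = 1 \<and> L > 0 \<and>
     (\<forall>y\<in>Rn n. (LINT x:K|lborel_n n. (inner_n n x y)\<^sup>2) = L\<^sup>2 * (norm_n n y)\<^sup>2)"

definition isotropic :: "nat \<Rightarrow> (nat \<Rightarrow> real) set \<Rightarrow> bool" where
  "isotropic n K \<longleftrightarrow> (\<exists>L. isotropic_with n K L)"

text \<open>
  For \<open>n \<ge> 1\<close> every convex body has an isotropic affine image, unique up to orthogonal maps, so
  the description below is proper.
\<close>

definition isotropic_constant :: "nat \<Rightarrow> (nat \<Rightarrow> real) set \<Rightarrow> real" where
  "isotropic_constant n K = (THE L. \<exists>T. invertible_affine n T \<and> isotropic_with n (T ` K) L)"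

text \<open>
  For convex bodies the infimum is attained, and the set is nonempty and bounded below by \<open>1\<close>.
\<close>

definition volume_ratio :: "nat \<Rightarrow> (nat \<Rightarrow> real) set \<Rightarrow> (nat \<Rightarrow> real) set \<Rightarrow> real" where
  "volume_ratio n B K =
     Inf {root n (vol n B / vol n (T ` K)) |T. invertible_affine n T \<and> T ` K \<subseteq> B}"

definition couplings :: "'a measure \<Rightarrow> 'a measure \<Rightarrow> ('a \<times> 'a) measure set" where
  "couplings \<mu> \<nu> = {\<pi>. prob_space \<pi> \<and> sets \<pi> = sets (\<mu> \<Otimes>\<^sub>M \<nu>) \<and>
                         distr \<pi> \<mu> fst = \<mu> \<and> distr \<pi> \<nu> snd = \<nu>}"

definition wasserstein1 ::
  "nat \<Rightarrow> (nat \<Rightarrow> real) measure \<Rightarrow> (nat \<Rightarrow> real) measure \<Rightarrow> ennreal" where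
  "wasserstein1 n \<mu> \<nu> =
     (INF \<pi>\<in>couplings \<mu> \<nu>. \<integral>\<^sup>+z. ennreal (dist_n n (fst z) (snd z)) \<partial>\<pi>)"

text \<open>
  For probability measures \<open>\<nu> \<lless> \<mu>\<close>, the negative part of \<open>log (d\<nu>/d\<mu>)\<close> is always
  \<open>\<nu>\<close>-integrable, so nonintegrability means that the entropy is infinite. The library's
  \<open>KL_divergence\<close> is a Bochner integral and would be \<open>0\<close> in that case. Its argument order is
  reversed with respect to \<open>H(\<nu>|\<mu>)\<close>.
\<close>

definition rel_entropy :: "'a measure \<Rightarrow> 'a measure \<Rightarrow> ereal" where
  "rel_entropy \<nu> \<mu> =
     (if integrable \<nu> (entropy_density (exp 1) \<mu> \<nu>)
      then ereal (KL_divergence (exp 1) \<mu> \<nu>) else \<infinity>)"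

text \<open>If the entropy is infinite, the transport inequality holds trivially.\<close>

definition transport_ineq :: "nat \<Rightarrow> (nat \<Rightarrow> real) measure \<Rightarrow> real \<Rightarrow> bool" where
  "transport_ineq n \<mu> \<tau> \<longleftrightarrow>
     (\<forall>\<nu>. prob_space \<nu> \<and> sets \<nu> = sets \<mu> \<and> absolutely_continuous \<mu> \<nu> \<and> rel_entropy \<nu> \<mu> \<noteq> \<infinity> \<longrightarrow>
        wasserstein1 n \<mu> \<nu> \<le> ennreal (sqrt (2 / \<tau> * real_of_ereal (rel_entropy \<nu> \<mu>))))"

text \<open>
  For the uniform measure on a convex body in dimension \<open>n \<ge> 1\<close>, the set of admissible
  constants is nonempty and bounded and contains its supremum.
\<close>

definition tau1 :: "nat \<Rightarrow> (nat \<Rightarrow> real) measure \<Rightarrow> real" where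
  "tau1 n \<mu> = Sup {\<tau>. \<tau> > 0 \<and> transport_ineq n \<mu> \<tau>}"

definition tau1_body :: "nat \<Rightarrow> (nat \<Rightarrow> real) set \<Rightarrow> real" where
  "tau1_body n B = tau1 n (uniform_measure (lborel_n n) B)"

end

theory Submission
  imports Defs
begin

text \<open>
  Let \<open>K \<subseteq> B\<close> after an affine change, with \<open>|K| = s\<^bsup>-n\<^esup>\<close>. Bringing \<open>K\<close> into isotropic position and
  AM-GM give \<open>L\<^sub>K \<le> s * sqrt (M / n)\<close>, where \<open>M\<close> is the mean of \<open>|x|\<^sup>2\<close> over \<open>K\<close>. Test the transport
  inequality on the measure with density \<open>f = W / E W\<close> with respect to \<open>m\<^sub>B\<close>. Its relative entropy is
  at most \<open>ln (E f\<^sup>2)\<close>. The weights \<open>W = max 0 (\<plusminus>x\<^sub>0)\<close> yield \<open>L\<^sub>B\<^sup>2 \<le> 4 / \<tau>\<close>, which bounds the mean of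
  \<open>|x|\<close> over \<open>B\<close>, and then \<open>W = |x| 1\<^sub>K\<close> yields the bound on \<open>M\<close>.

  Isotropic positions come from Gram--Schmidt, and their constant is unique because a linear map
  between two of them preserves volume and multiplies norms by a constant. That \<open>\<tau>\<^sub>1\<close> is a
  supremum over a nonempty set follows from \<open>W\<^sub>1 \<le> diam * TV\<close> and a bound of the total variation
  by the square root of the entropy via the Hellinger distance.
\<close>

subsection \<open>Lebesgue measure and translations\<close>

text \<open>The weight copies the test function \<open>g\<close>, up to an additive constant, on the
  region of interest, so that \<open>E (g W)\<close> is again governed by the second moment of
  \<open>W\<close>. The ratio \<open>E W^2 / (E W)^2\<close> then enters the squared inequality
  linearly on the left and only through a logarithm on the right, where \<open>ln t \<le> t\<close>
  absorbs it. The factor \<open>1 + sqrt (ln v)\<close> comes from the entropy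
  \<open>ln (1 / |K|) = n * ln s\<close> that concentration on \<open>K\<close> costs; the division
  by \<open>n\<close> removes the dimension.

  The other obstacle is that \<open>volume_ratio\<close> is an infimum and \<open>tau1\<close> a
  supremum. The estimate is therefore proved for each admissible map and each admissible constant,
  in a form whose right-hand side is free of \<tau>, and both limits are taken at the very end. That
  the admissible constants are bounded above is a consequence of the estimate itself.

  The dimension is a variable, so the volume factor of an affine map is obtained from translation
  invariance and evaluated for maps that change a single coordinate and for homotheties. This is why
  the Gram--Schmidt process advances one row at a time.\<close>

lemma space_lborel_n [simp]: "space (lborel_n n) = Rn n"
  by (simp add: lborel_n_def space_PiM)

interpretation lborel_prod: product_sigma_finite "\<lambda>_::nat. lborel :: real measure"
  by standard

lemma sigma_finite_lborel_n: "sigma_finite_measure (lborel_n n)"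
  unfolding lborel_n_def by (rule lborel_prod.sigma_finite) simp

lemma coord_measurable [measurable]:
  "i < n \<Longrightarrow> (\<lambda>x. x i) \<in> borel_measurable (lborel_n n)"
  unfolding lborel_n_def
  using measurable_component_singleton[of i "{..<n}" "\<lambda>_. lborel :: real measure"] by simp

lemma measurable_into_lborel_n:
  assumes "\<And>i. i < n \<Longrightarrow> (\<lambda>x. f x i) \<in> borel_measurable M"
  shows "(\<lambda>x. \<lambda>i\<in>{..<n}. f x i) \<in> measurable M (lborel_n n)"
  unfolding lborel_n_def using assms by (intro measurable_restrict) simp

lemma restrict_in_Rn [simp]: "(\<lambda>i\<in>{..<n}. f i) \<in> Rn n"
  by auto

lemma Rn_eqI:
  assumes "x \<in> Rn n" "y \<in> Rn n" "\<And>i. i < n \<Longrightarrow> x i = y i" shows "x = y"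
  using assms by (intro PiE_ext[of x "{..<n}"]) auto

lemma emeasure_box:
  "(\<And>i. i < n \<Longrightarrow> A i \<in> sets borel) \<Longrightarrow>
     emeasure (lborel_n n) (PiE {..<n} A) = (\<Prod>i<n. emeasure lborel (A i))"
  unfolding lborel_n_def by (rule lborel_prod.emeasure_PiM) auto

lemma sets_box: "(\<And>i. i < n \<Longrightarrow> A i \<in> sets borel) \<Longrightarrow> PiE {..<n} A \<in> sets (lborel_n n)"
  unfolding lborel_n_def by (rule sets_PiM_I_finite) auto

definition shift :: "nat \<Rightarrow> (nat \<Rightarrow> real) \<Rightarrow> (nat \<Rightarrow> real) \<Rightarrow> nat \<Rightarrow> real" where
  "shift n h x = (\<lambda>i\<in>{..<n}. x i + h i)"

lemma shift_measurable [measurable]: "shift n h \<in> measurable (lborel_n n) (lborel_n n)"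
  unfolding shift_def by (intro measurable_into_lborel_n) measurable

text \<open>A finite product of sigma-finite measures is determined by its values on boxes. The
  preimage of a box is the box of translated sides, so invariance in one dimension suffices.\<close>

lemma distr_shift_lborel_n: "distr (lborel_n n) (lborel_n n) (shift n h) = lborel_n n"
  unfolding lborel_n_def
proof (rule lborel_prod.PiM_eqI)
  let ?L = "Pi\<^sub>M {..<n} (\<lambda>_. lborel :: real measure)"
  fix A :: "nat \<Rightarrow> real set" assume A: "\<And>i. i \<in> {..<n} \<Longrightarrow> A i \<in> sets lborel"
  have eq: "shift n h -` PiE {..<n} A \<inter> space ?L = PiE {..<n} (\<lambda>i. (+) (h i) -` A i)"
    by (auto simp: shift_def space_PiM PiE_iff add.commute)
  have "emeasure (distr ?L ?L (shift n h)) (PiE {..<n} A)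
      = emeasure ?L (PiE {..<n} (\<lambda>i. (+) (h i) -` A i))"
    using A shift_measurable[of n h] unfolding lborel_n_def
    by (subst emeasure_distr) (auto simp: eq intro!: sets_PiM_I_finite)
  also have "\<dots> = (\<Prod>i<n. emeasure lborel ((+) (h i) -` A i))"
    using A by (intro lborel_prod.emeasure_PiM) (auto intro!: measurable_sets_borel[of _ borel])
  also have "\<dots> = (\<Prod>i<n. emeasure lborel (A i))"
  proof (intro prod.cong refl)
    fix i assume "i \<in> {..<n}"
    then have "emeasure (distr lborel borel ((+) (h i))) (A i) = emeasure lborel ((+) (h i) -` A i)"
      using A by (subst emeasure_distr) auto
    then show "emeasure lborel ((+) (h i) -` A i) = emeasure lborel (A i)"
      by (simp add: lborel_distr_plus)
  qed
  finally show "emeasure (distr ?L ?L (shift n h)) (PiE {..<n} A) = (\<Prod>i<n. emeasure lborel (A i))" .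
qed simp_all

definition reflect :: "nat \<Rightarrow> (nat \<Rightarrow> real) \<Rightarrow> nat \<Rightarrow> real" where
  "reflect n x = (\<lambda>i\<in>{..<n}. - x i)"

lemma nn_integral_shift_invariant:
  assumes "sets M = sets (lborel_n n)" "distr M (lborel_n n) (shift n h) = M"
    and [measurable]: "f \<in> borel_measurable (lborel_n n)"
  shows "(\<integral>\<^sup>+x. f (shift n h x) \<partial>M) = (\<integral>\<^sup>+x. f x \<partial>M)"
proof -
  have [measurable_cong]: "sets M = sets (lborel_n n)" by fact
  have "(\<integral>\<^sup>+x. f x \<partial>distr M (lborel_n n) (shift n h)) = (\<integral>\<^sup>+x. f (shift n h x) \<partial>M)"
    by (rule nn_integral_distr) measurable
  then show ?thesis using assms(2) by simp
qed

text \<open>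
  Uniqueness of a translation-invariant measure up to a factor: substitute \<open>y \<mapsto> y + x\<close> and then
  \<open>x \<mapsto> x - y\<close> in \<open>\<integral>\<integral> 1\<^sub>E(x) 1\<^sub>S(y)\<close>.
\<close>

lemma shift_invariant_measure_proportional:
  assumes sets_M [measurable_cong]: "sets M = sets (lborel_n n)" and sf: "sigma_finite_measure M"
    and inv: "\<And>h. distr M (lborel_n n) (shift n h) = M"
    and [measurable]: "E \<in> sets (lborel_n n)" "S \<in> sets (lborel_n n)"
  shows "emeasure (lborel_n n) E * emeasure M S
       = emeasure (lborel_n n) S * emeasure M (reflect n -` E \<inter> Rn n)"
proof -
  interpret L: sigma_finite_measure "lborel_n n" by (rule sigma_finite_lborel_n)
  interpret M: sigma_finite_measure M by fact
  interpret P: pair_sigma_finite "lborel_n n" M by standard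
  have sp: "space M = Rn n" using sets_eq_imp_space_eq[OF sets_M] by simp
  have cM [measurable]: "i < n \<Longrightarrow> (\<lambda>x. x i) \<in> borel_measurable M" for i
    using coord_measurable by measurable
  define add :: "(nat \<Rightarrow> real) \<Rightarrow> (nat \<Rightarrow> real) \<Rightarrow> nat \<Rightarrow> real" where "add x y = (\<lambda>i\<in>{..<n}. x i + y i)" for x y
  define sub :: "(nat \<Rightarrow> real) \<Rightarrow> (nat \<Rightarrow> real) \<Rightarrow> nat \<Rightarrow> real" where "sub x y = (\<lambda>i\<in>{..<n}. x i - y i)" for x y
  have add_m [measurable]: "(\<lambda>z. add (fst z) (snd z)) \<in> measurable (lborel_n n \<Otimes>\<^sub>M M) (lborel_n n)"
    and sub_m [measurable]: "(\<lambda>z. sub (fst z) (snd z)) \<in> measurable (lborel_n n \<Otimes>\<^sub>M M) (lborel_n n)"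
    unfolding add_def sub_def by (intro measurable_into_lborel_n; measurable)+
  have [measurable]: "reflect n \<in> measurable (lborel_n n) (lborel_n n)"
    unfolding reflect_def by (intro measurable_into_lborel_n) measurable
  have sub_m1 [measurable]: "sub x \<in> measurable (lborel_n n) (lborel_n n)"
    and sub_m2 [measurable]: "(\<lambda>x. sub x y) \<in> measurable (lborel_n n) (lborel_n n)" for x y
    unfolding sub_def by (intro measurable_into_lborel_n; measurable)+
  have "emeasure (lborel_n n) E * emeasure M S
      = (\<integral>\<^sup>+x. (\<integral>\<^sup>+y. indicator E x * indicator S y \<partial>M) \<partial>lborel_n n)"
    by (simp add: nn_integral_cmult nn_integral_multc sets_M)
  also have "\<dots> = (\<integral>\<^sup>+x. (\<integral>\<^sup>+y. indicator E x * indicator S (add x y) \<partial>M) \<partial>lborel_n n)"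
  proof (rule nn_integral_cong)
    fix x :: "nat \<Rightarrow> real"
    have "(\<integral>\<^sup>+y. indicator E x * indicator S (shift n x y) \<partial>M)
        = (\<integral>\<^sup>+y. indicator E x * indicator S y \<partial>M)"
      by (intro nn_integral_shift_invariant[where f = "\<lambda>y. indicator E x * indicator S y"] sets_M inv) measurable
    then show "(\<integral>\<^sup>+y. indicator E x * indicator S y \<partial>M)
        = (\<integral>\<^sup>+y. indicator E x * indicator S (add x y) \<partial>M)"
      by (simp add: shift_def add_def add.commute)
  qed
  also have "\<dots> = (\<integral>\<^sup>+y. (\<integral>\<^sup>+x. indicator E x * indicator S (add x y) \<partial>lborel_n n) \<partial>M)"
    by (intro P.Fubini'[symmetric, where f = "\<lambda>x y. indicator E x * indicator S (add x y)"])
      (simp add: split_beta')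
  also have "\<dots> = (\<integral>\<^sup>+y. (\<integral>\<^sup>+x. indicator E (sub x y) * indicator S x \<partial>lborel_n n) \<partial>M)"
  proof (rule nn_integral_cong)
    fix y assume y: "y \<in> space M"
    have "(\<integral>\<^sup>+x. indicator E (sub (shift n y x) y) * indicator S (shift n y x) \<partial>lborel_n n)
        = (\<integral>\<^sup>+x. indicator E (sub x y) * indicator S x \<partial>lborel_n n)"
      by (intro nn_integral_shift_invariant[where f = "\<lambda>x. indicator E (sub x y) * indicator S x"]
          distr_shift_lborel_n refl) measurable
    moreover have "sub (shift n y x) y = x" if "x \<in> space (lborel_n n)" for x
      using that by (intro Rn_eqI[of _ n]) (auto simp: sub_def shift_def)
    moreover have "shift n y x = add x y" for x by (simp add: shift_def add_def)
    ultimately show "(\<integral>\<^sup>+x. indicator E x * indicator S (add x y) \<partial>lborel_n n)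
        = (\<integral>\<^sup>+x. indicator E (sub x y) * indicator S x \<partial>lborel_n n)"
      by (simp cong: nn_integral_cong_simp)
  qed
  also have "\<dots> = (\<integral>\<^sup>+x. (\<integral>\<^sup>+y. indicator E (sub x y) * indicator S x \<partial>M) \<partial>lborel_n n)"
    by (intro P.Fubini'[where f = "\<lambda>x y. indicator E (sub x y) * indicator S x"])
      (simp add: split_beta')
  \<comment> \<open>A third substitution, the shift of \<open>y\<close> by \<open>x\<close>, turns
    \<open>sub x y\<close> into \<open>reflect n y\<close>. The inner integral no longer depends on
    \<open>x\<close>, and the double integral factors.\<close>
  also have "\<dots> = (\<integral>\<^sup>+x. indicator S x * emeasure M (reflect n -` E \<inter> Rn n) \<partial>lborel_n n)"
  proof (rule nn_integral_cong)
    fix x :: "nat \<Rightarrow> real"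
    have "(\<integral>\<^sup>+y. indicator E (sub x (shift n x y)) \<partial>M) = (\<integral>\<^sup>+y. indicator E (sub x y) \<partial>M)"
      by (intro nn_integral_shift_invariant[where f = "\<lambda>y. indicator E (sub x y)"] sets_M inv) measurable
    moreover have "sub x (shift n x y) = reflect n y" for y
      by (auto simp: sub_def shift_def reflect_def)
    moreover have "(\<integral>\<^sup>+y. indicator E (reflect n y) \<partial>M) = emeasure M (reflect n -` E \<inter> Rn n)"
    proof -
      have "(\<integral>\<^sup>+y. indicator E (reflect n y) \<partial>M) = (\<integral>\<^sup>+y. indicator (reflect n -` E \<inter> space M) y \<partial>M)"
        by (intro nn_integral_cong) (auto simp: indicator_def)
      then show ?thesis by (simp add: sp[symmetric])
    qed
    ultimately show "(\<integral>\<^sup>+y. indicator E (sub x y) * indicator S x \<partial>M)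
        = indicator S x * emeasure M (reflect n -` E \<inter> Rn n)"
      by (subst nn_integral_multc) (simp_all add: mult.commute)
  qed
  also have "\<dots> = emeasure (lborel_n n) S * emeasure M (reflect n -` E \<inter> Rn n)"
    by (subst nn_integral_multc) simp_all
  finally show ?thesis .
qed

subsection \<open>Affine maps and their Jacobians\<close>

definition affine_n :: "nat \<Rightarrow> ((nat \<Rightarrow> real) \<Rightarrow> nat \<Rightarrow> real) \<Rightarrow> bool" where
  "affine_n n T \<longleftrightarrow>
     (\<exists>A b. \<forall>x\<in>Rn n. T x = (\<lambda>i\<in>{..<n}. (\<Sum>j<n. A i j * x j) + b i))"

lemma affine_nI:
  "(\<And>x. x \<in> Rn n \<Longrightarrow> T x = (\<lambda>i\<in>{..<n}. (\<Sum>j<n. A i j * x j) + b i)) \<Longrightarrow> affine_n n T"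
  unfolding affine_n_def by (intro exI ballI)

lemma invertible_affine_iff:
  "invertible_affine n T \<longleftrightarrow> bij_betw T (Rn n) (Rn n) \<and> affine_n n T"
  by (simp add: invertible_affine_def affine_n_def)

lemma affine_n_into: assumes "affine_n n T" "x \<in> Rn n" shows "T x \<in> Rn n"
proof -
  obtain A b where "\<And>x. x \<in> Rn n \<Longrightarrow> T x = (\<lambda>i\<in>{..<n}. (\<Sum>j<n. A i j * x j) + b i)"
    using assms(1) unfolding affine_n_def by blast
  from this[OF assms(2)] show ?thesis by simp
qed

lemma invertible_affineI:
  assumes "affine_n n T" "affine_n n S"
    and "\<And>x. x \<in> Rn n \<Longrightarrow> S (T x) = x" "\<And>x. x \<in> Rn n \<Longrightarrow> T (S x) = x"
  shows "invertible_affine n T"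
proof -
  have "bij_betw T (Rn n) (Rn n)"
  proof (rule bij_betw_byWitness[where f' = S])
    show "T ` Rn n \<subseteq> Rn n" "S ` Rn n \<subseteq> Rn n"
      using affine_n_into assms(1,2) by (auto simp del: PiE_iff)
  qed (use assms(3,4) in blast)+
  then show ?thesis using assms(1) by (simp add: invertible_affine_iff)
qed

lemma affine_n_comp:
  assumes "affine_n n S" "affine_n n T" shows "affine_n n (S \<circ> T)"
proof -
  obtain A b where S: "\<And>x. x \<in> Rn n \<Longrightarrow> S x = (\<lambda>i\<in>{..<n}. (\<Sum>j<n. A i j * x j) + b i)"
    using assms(1) unfolding affine_n_def by blast
  obtain C d where T: "\<And>x. x \<in> Rn n \<Longrightarrow> T x = (\<lambda>i\<in>{..<n}. (\<Sum>j<n. C i j * x j) + d i)"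
    using assms(2) unfolding affine_n_def by blast
  have "(S \<circ> T) x = (\<lambda>i\<in>{..<n}. (\<Sum>j<n. (\<Sum>k<n. A i k * C k j) * x j)
      + ((\<Sum>k<n. A i k * d k) + b i))" if "x \<in> Rn n" for x
  proof -
    have "(\<Sum>k<n. A i k * ((\<Sum>j<n. C k j * x j) + d k)) =
      (\<Sum>j<n. (\<Sum>k<n. A i k * C k j) * x j) + (\<Sum>k<n. A i k * d k)" for i
      unfolding distrib_left sum.distrib sum_distrib_left sum_distrib_right
      by (subst sum.swap) (simp add: mult.assoc)
    then show ?thesis by (auto simp: T[OF that] S fun_eq_iff)
  qed
  then show ?thesis by (rule affine_nI)
qed

lemma invertible_affine_comp:
  "invertible_affine n S \<Longrightarrow> invertible_affine n T \<Longrightarrow> invertible_affine n (S \<circ> T)"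
  unfolding invertible_affine_iff using affine_n_comp bij_betw_trans by blast

definition inv_n :: "nat \<Rightarrow> ((nat \<Rightarrow> real) \<Rightarrow> nat \<Rightarrow> real) \<Rightarrow> (nat \<Rightarrow> real) \<Rightarrow> nat \<Rightarrow> real" where
  "inv_n n T = inv_into (Rn n) T"

lemma inv_n_simps:
  assumes "invertible_affine n T" "x \<in> Rn n"
  shows "T (inv_n n T x) = x" "inv_n n T (T x) = x" "inv_n n T x \<in> Rn n" "T x \<in> Rn n"
proof -
  have bij: "bij_betw T (Rn n) (Rn n)" using assms by (simp add: invertible_affine_iff)
  show "T (inv_n n T x) = x" unfolding inv_n_def
    using bij assms(2) by (rule bij_betw_inv_into_right)
  show "inv_n n T (T x) = x" unfolding inv_n_def
    using bij assms(2) by (rule bij_betw_inv_into_left)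
  show "inv_n n T x \<in> Rn n" unfolding inv_n_def
    using bij assms(2) by (metis bij_betw_def inv_into_into)
  show "T x \<in> Rn n" using bij assms(2) by (metis bij_betwE)
qed

text \<open>Preimages of the unit vectors are the columns of the inverse.\<close>

lemma affine_n_inv:
  assumes T: "invertible_affine n T" shows "affine_n n (inv_n n T)"
proof -
  obtain A b where A: "\<And>x. x \<in> Rn n \<Longrightarrow> T x = (\<lambda>i\<in>{..<n}. (\<Sum>j<n. A i j * x j) + b i)"
    using T unfolding invertible_affine_def by blast
  \<comment> \<open>\<open>z\<close> is the preimage of the origin. Subtracting it removes the
    translation, so the differences \<open>u k - z\<close> are the actual columns.\<close>
  define z where "z = inv_n n T (\<lambda>i\<in>{..<n}. 0)"
  define u where "u k = inv_n n T (\<lambda>i\<in>{..<n}. if i = k then 1 else 0)" for k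
  have z: "z \<in> Rn n" "T z = (\<lambda>i\<in>{..<n}. 0)" and u: "u k \<in> Rn n"
    "T (u k) = (\<lambda>i\<in>{..<n}. if i = k then 1 else 0)" for k
    unfolding z_def u_def using inv_n_simps(1,3)[OF T restrict_in_Rn] by auto
  have z': "(\<Sum>j<n. A i j * z j) + b i = 0" if "i < n" for i
    using fun_cong[OF z(2), of i] A[OF z(1)] that by simp
  have u': "(\<Sum>j<n. A i j * u k j) = (if i = k then 1 else 0) + (\<Sum>j<n. A i j * z j)" if "i < n" for i k
    using fun_cong[OF u(2), of k i] A[OF u(1)] z'[OF that] that by (simp split: if_splits)
  have "inv_n n T y = (\<lambda>j\<in>{..<n}. (\<Sum>k<n. (u k j - z j) * y k) + z j)" if y: "y \<in> Rn n" for y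
  proof -
    define x where "x = (\<lambda>j\<in>{..<n}. (\<Sum>k<n. (u k j - z j) * y k) + z j)"
    have x: "x \<in> Rn n" by (simp add: x_def)
    have "T x = y"
    proof (rule Rn_eqI[of _ n])
      fix i assume i: "i < n"
      have "(\<Sum>j<n. A i j * x j) = (\<Sum>j<n. (\<Sum>k<n. (A i j * u k j - A i j * z j) * y k) + A i j * z j)"
        by (intro sum.cong) (auto simp: x_def distrib_left sum_distrib_left algebra_simps)
      also have "\<dots> = (\<Sum>k<n. ((\<Sum>j<n. A i j * u k j) - (\<Sum>j<n. A i j * z j)) * y k) + (\<Sum>j<n. A i j * z j)"
        unfolding sum.distrib sum_subtractf[symmetric] sum_distrib_right
        by (subst sum.swap) simp
      also have "\<dots> = (\<Sum>k<n. if i = k then y k else 0) + (\<Sum>j<n. A i j * z j)"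
        using i by (simp add: u' if_distrib[of "\<lambda>t. t * _"] cong: if_cong)
      also have "\<dots> = y i + (\<Sum>j<n. A i j * z j)" using i by simp
      finally show "T x i = y i" using z'[OF i] A[OF x] i by simp
    qed (use x y inv_n_simps[OF T] in auto)
    then show ?thesis using inv_n_simps(2)[OF T x] x_def by simp
  qed
  then show ?thesis by (rule affine_nI)
qed

lemma invertible_affine_inv: "invertible_affine n T \<Longrightarrow> invertible_affine n (inv_n n T)"
  by (rule invertible_affineI[of n "inv_n n T" T])
    (simp_all add: inv_n_simps affine_n_inv, simp add: invertible_affine_iff)

lemma affine_n_measurable:
  assumes "affine_n n T" shows "T \<in> measurable (lborel_n n) (lborel_n n)"
proof -
  obtain A b where T: "\<And>x. x \<in> Rn n \<Longrightarrow> T x = (\<lambda>i\<in>{..<n}. (\<Sum>j<n. A i j * x j) + b i)"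
    using assms unfolding affine_n_def by blast
  have "(\<lambda>x. \<lambda>i\<in>{..<n}. (\<Sum>j<n. A i j * x j) + b i) \<in> measurable (lborel_n n) (lborel_n n)"
    by (intro measurable_into_lborel_n borel_measurable_add borel_measurable_sum
        borel_measurable_times coord_measurable) auto
  then show ?thesis by (rule measurable_cong[THEN iffD1, rotated]) (simp add: T)
qed

lemma image_eq_vimage_inv:
  assumes "invertible_affine n T" "E \<subseteq> Rn n" shows "T ` E = inv_n n T -` E \<inter> Rn n"
proof (intro set_eqI iffI)
  fix y assume "y \<in> T ` E"
  then obtain x where "x \<in> E" "x \<in> Rn n" "y = T x" using assms(2) by blast
  then show "y \<in> inv_n n T -` E \<inter> Rn n"
    using inv_n_simps(2,4)[OF assms(1)] by (simp del: PiE_iff)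
next
  fix y assume "y \<in> inv_n n T -` E \<inter> Rn n"
  then show "y \<in> T ` E" using inv_n_simps(1)[OF assms(1), of y] by (metis IntD1 IntD2 imageI vimageD)
qed

lemma sets_affine_image:
  assumes "invertible_affine n T" "E \<in> sets (lborel_n n)" shows "T ` E \<in> sets (lborel_n n)"
proof -
  have "E \<subseteq> Rn n" using sets.sets_into_space[OF assms(2)] by simp
  then show ?thesis
    using measurable_sets[OF affine_n_measurable[OF affine_n_inv[OF assms(1)]] assms(2)]
      image_eq_vimage_inv[OF assms(1)] by simp
qed

section \<open>Volume factor of an invertible affine map\<close>

abbreviation unit_cube :: "nat \<Rightarrow> (nat \<Rightarrow> real) set" where
  "unit_cube n \<equiv> PiE {..<n} (\<lambda>_. {0..1})"

text \<open>The absolute determinant of the linear part, read off from volume. In this form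
  multiplicativity under composition is immediate from the scaling law.\<close>

definition jacobian :: "nat \<Rightarrow> ((nat \<Rightarrow> real) \<Rightarrow> nat \<Rightarrow> real) \<Rightarrow> real" where
  "jacobian n T = vol n (T ` unit_cube n)"

lemma emeasure_unit_cube: "emeasure (lborel_n n) (unit_cube n) = 1"
  by (subst emeasure_box) auto

lemma affine_image_bounded:
  assumes "affine_n n T" "\<And>x i. x \<in> E \<Longrightarrow> i < n \<Longrightarrow> \<bar>x i\<bar> \<le> R" "E \<subseteq> Rn n"
  shows "\<exists>R'>0. \<forall>x\<in>E. \<forall>i<n. \<bar>T x i\<bar> \<le> R'"
proof -
  obtain A b where T: "\<And>x. x \<in> Rn n \<Longrightarrow> T x = (\<lambda>i\<in>{..<n}. (\<Sum>j<n. A i j * x j) + b i)"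
    using assms(1) unfolding affine_n_def by blast
  define R' where "R' = 1 + (\<Sum>i<n. (\<Sum>j<n. \<bar>A i j\<bar> * \<bar>R\<bar>) + \<bar>b i\<bar>)"
  have "\<bar>T x i\<bar> \<le> R'" if "x \<in> E" "i < n" for x i
  proof -
    have "\<bar>T x i\<bar> \<le> \<bar>\<Sum>j<n. A i j * x j\<bar> + \<bar>b i\<bar>"
      using T[of x] that assms(3) by auto
    also have "\<bar>\<Sum>j<n. A i j * x j\<bar> \<le> (\<Sum>j<n. \<bar>A i j * x j\<bar>)" by (rule sum_abs)
    also have "\<dots> \<le> (\<Sum>j<n. \<bar>A i j\<bar> * \<bar>R\<bar>)"
      using assms(2)[OF that(1)] by (intro sum_mono) (auto simp: abs_mult intro!: mult_left_mono, force)
    also have "(\<Sum>j<n. \<bar>A i j\<bar> * \<bar>R\<bar>) + \<bar>b i\<bar> \<le> (\<Sum>i<n. (\<Sum>j<n. \<bar>A i j\<bar> * \<bar>R\<bar>) + \<bar>b i\<bar>)"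
      using that by (intro member_le_sum) (auto intro!: add_nonneg_nonneg sum_nonneg)
    finally show ?thesis by (simp add: R'_def)
  qed
  moreover have "R' > 0" unfolding R'_def
    by (intro add_pos_nonneg sum_nonneg) (auto intro!: add_nonneg_nonneg sum_nonneg)
  ultimately show ?thesis by blast
qed

lemma emeasure_bounded_finite:
  assumes "\<And>x i. x \<in> E \<Longrightarrow> i < n \<Longrightarrow> \<bar>x i\<bar> \<le> R" "E \<subseteq> Rn n"
  shows "emeasure (lborel_n n) E < \<infinity>"
proof -
  have "E \<subseteq> PiE {..<n} (\<lambda>_. {-R..R})"
  proof
    fix x assume x: "x \<in> E"
    then have "x \<in> Rn n" using assms(2) by blast
    then show "x \<in> PiE {..<n} (\<lambda>_. {-R..R})" using assms(1)[OF x] by (simp add: PiE_iff abs_le_iff minus_le_iff)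
  qed
  then have "emeasure (lborel_n n) E \<le> emeasure (lborel_n n) (PiE {..<n} (\<lambda>_. {-R..R}))"
    by (rule emeasure_mono) (rule sets_box, simp)
  also have "\<dots> = ennreal ((2 * max R 0) ^ n)"
    by (subst emeasure_box) (auto simp: prod_constant ennreal_power emeasure_lborel_Icc_eq max_def)
  finally show ?thesis by (simp add: le_less_trans)
qed

text \<open>The measure that assigns to a set the volume of its image is the push-forward of
  Lebesgue measure under the inverse map. It is invariant under translations because an affine map
  carries translations to translations, hence it is a multiple of Lebesgue measure; the unit cube
  identifies the factor.\<close>

lemma affine_image_jacobian:
  assumes T: "invertible_affine n T"
  shows "jacobian n T > 0"
    and "E \<in> sets (lborel_n n) \<Longrightarrow>
      emeasure (lborel_n n) (T ` E) = ennreal (jacobian n T) * emeasure (lborel_n n) E"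
proof -
  let ?L = "lborel_n n"
  define S where "S = inv_n n T"
  define M where "M = distr ?L ?L S"
  have T_m [measurable]: "T \<in> measurable ?L ?L" and S_m [measurable]: "S \<in> measurable ?L ?L"
    using T invertible_affine_inv[OF T]
    by (auto simp: S_def invertible_affine_iff intro: affine_n_measurable)
  have sets_M [measurable_cong]: "sets M = sets ?L" by (simp add: M_def)
  have emM: "emeasure M E = emeasure ?L (T ` E)" if "E \<in> sets ?L" for E
    using that sets.sets_into_space[OF that]
    by (simp add: M_def emeasure_distr image_eq_vimage_inv[OF T] S_def[symmetric])
  have "distr M ?L T = distr ?L ?L (T \<circ> S)"
    unfolding M_def by (rule distr_distr) measurable
  also have "\<dots> = distr ?L ?L (\<lambda>x. x)"
    using inv_n_simps(1)[OF T] by (intro distr_cong) (auto simp: S_def)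
  also have "\<dots> = ?L" by (simp add: distr_id2)
  finally have dMT: "distr M ?L T = ?L" .
  \<comment> \<open>Pushing \<open>M\<close> forward by \<open>T\<close> returns Lebesgue measure,
    and sigma-finiteness passes from a push-forward to its source.\<close>
  have sf: "sigma_finite_measure M"
    using sigma_finite_lborel_n by (intro sigma_finite_measure_distr[of M ?L T]) (simp_all add: dMT)
  have inv: "distr M ?L (shift n h) = M" for h
  proof -
    obtain A b where A: "\<And>x. x \<in> Rn n \<Longrightarrow> T x = (\<lambda>i\<in>{..<n}. (\<Sum>j<n. A i j * x j) + b i)"
      using T unfolding invertible_affine_def by blast
    define k where "k = (\<lambda>i\<in>{..<n}. \<Sum>j<n. A i j * h j)"
    have Tsh: "T (shift n h x) = shift n k (T x)" if "x \<in> Rn n" for x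
    proof -
      have "shift n h x \<in> Rn n" by (simp add: shift_def)
      then show ?thesis
        by (auto simp: A that shift_def k_def fun_eq_iff distrib_left sum.distrib)
    qed
    have Ssh: "shift n h (S x) = S (shift n k x)" if x: "x \<in> Rn n" for x
    proof -
      have "T (shift n h (S x)) = shift n k x"
        using Tsh[of "S x"] inv_n_simps[OF T x] by (simp add: S_def)
      then have "S (T (shift n h (S x))) = S (shift n k x)" by simp
      then show ?thesis using inv_n_simps(2)[OF T, of "shift n h (S x)"] by (simp add: S_def shift_def)
    qed
    have "distr M ?L (shift n h) = distr ?L ?L (shift n h \<circ> S)"
      unfolding M_def by (rule distr_distr) measurable
    also have "\<dots> = distr ?L ?L (S \<circ> shift n k)"
      by (intro distr_cong) (auto simp: Ssh)
    also have "\<dots> = distr (distr ?L ?L (shift n k)) ?L S"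
      by (rule distr_distr[symmetric]) measurable
    finally show ?thesis by (simp add: distr_shift_lborel_n M_def)
  qed
  have cube: "unit_cube n \<in> sets ?L" by (rule sets_box) simp
  have refl_m [measurable]: "reflect n \<in> measurable ?L ?L"
    unfolding reflect_def by (intro measurable_into_lborel_n) measurable
  \<comment> \<open>The uniqueness lemma, tested on the unit cube, delivers the factor as the
    measure of the reflected cube. Evaluating the resulting proportionality on the cube itself shows
    that it is the intended volume.\<close>
  define c where "c = emeasure M (reflect n -` unit_cube n \<inter> Rn n)"
  have M_c: "emeasure M E = emeasure ?L E * c" if "E \<in> sets ?L" for E
    using shift_invariant_measure_proportional[OF sets_M sf inv cube that]
    by (simp add: emeasure_unit_cube c_def)
  have affT: "affine_n n T" using T by (simp add: invertible_affine_iff)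
  have c1: "c = emeasure ?L (T ` unit_cube n)"
    using M_c[OF cube] emM[OF cube] by (simp add: emeasure_unit_cube)
  obtain R' where "\<forall>x\<in>unit_cube n. \<forall>i<n. \<bar>T x i\<bar> \<le> R'"
    using affine_image_bounded[OF affT, of "unit_cube n" 1] by (force simp: PiE_iff)
  then have c_fin: "c < \<infinity>" unfolding c1
    using image_mono[of "unit_cube n" "Rn n" T] T
    by (intro emeasure_bounded_finite[of _ _ R']) (auto simp: invertible_affine_iff bij_betw_def intro!: PiE_mono)
  then have c_eq: "c = ennreal (jacobian n T)"
    unfolding c1 jacobian_def by (simp add: emeasure_eq_ennreal_measure less_top)
  show "emeasure ?L (T ` E) = ennreal (jacobian n T) * emeasure ?L E" if "E \<in> sets ?L"
    using M_c[OF that] emM[OF that] by (simp add: c_eq mult.commute)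
  \<comment> \<open>A factor 0 would annihilate the whole space, but \<open>T\<close> maps the space
    onto itself and its measure is not 0.\<close>
  have "emeasure M (Rn n) = emeasure ?L (Rn n)"
    using emM[OF sets.top[of ?L]] T by (simp add: invertible_affine_iff bij_betw_def)
  moreover have "emeasure ?L (Rn n) \<noteq> 0"
  proof -
    have "emeasure ?L (unit_cube n) \<le> emeasure ?L (Rn n)"
      by (intro emeasure_mono) (use sets.top[of ?L] in auto)
    then show ?thesis using emeasure_unit_cube[of n] by auto
  qed
  ultimately have "c \<noteq> 0" using M_c[OF sets.top[of ?L]] by auto
  then show "jacobian n T > 0" using c_eq by (auto simp: jacobian_def less_le)
qed

lemma vol_affine_image:
  assumes "invertible_affine n T" "E \<in> sets (lborel_n n)"
  shows "vol n (T ` E) = jacobian n T * vol n E"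
  using affine_image_jacobian(1)[OF assms(1)] affine_image_jacobian(2)[OF assms]
  by (simp add: measure_def enn2real_mult)

lemma jacobian_comp:
  assumes "invertible_affine n S" "invertible_affine n T"
  shows "jacobian n (S \<circ> T) = jacobian n S * jacobian n T"
proof -
  have "unit_cube n \<in> sets (lborel_n n)" by (rule sets_box) simp
  then show ?thesis
    using vol_affine_image[OF assms(1) sets_affine_image[OF assms(2)], of "unit_cube n"]
    unfolding jacobian_def image_comp by simp
qed

section \<open>Elementary row maps and homotheties\<close>

definition row_map :: "nat \<Rightarrow> nat \<Rightarrow> real \<Rightarrow> (nat \<Rightarrow> real) \<Rightarrow> real \<Rightarrow> (nat \<Rightarrow> real) \<Rightarrow> nat \<Rightarrow> real" where
  "row_map n k d a b x =
     (\<lambda>i\<in>{..<n}. if i = k then d * x k + (\<Sum>j\<in>{..<n} - {k}. a j * x j) + b else x i)"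

lemma affine_n_row_map: assumes k: "k < n" shows "affine_n n (row_map n k d a b)"
proof -
  have "row_map n k d a b x = (\<lambda>i\<in>{..<n}.
     (\<Sum>j<n. (if i = k then (if j = k then d else a j) else if i = j then 1 else 0) * x j)
     + (if i = k then b else 0))" for x
  proof -
    have "(\<Sum>j<n. (if j = k then d else a j) * x j) = d * x k + (\<Sum>j\<in>{..<n} - {k}. a j * x j)"
      using k by (subst sum.remove[of _ k]) (auto intro!: sum.cong)
    moreover have "(\<Sum>j<n. (if i = j then 1 else 0) * x j) = x i" if "i < n" for i
      using that by (simp add: if_distrib[of "\<lambda>t. t * _"] cong: if_cong)
    ultimately show ?thesis by (auto simp: row_map_def fun_eq_iff)
  qed
  then show ?thesis by (rule affine_nI)
qed

lemma invertible_row_map: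
  assumes k: "k < n" and d: "d \<noteq> 0" shows "invertible_affine n (row_map n k d a b)"
proof (rule invertible_affineI[where S = "row_map n k (1/d) (\<lambda>j. - a j / d) (- b / d)"])
  have s: "(\<Sum>j\<in>{..<n} - {k}. c j * (if j < n then if j = k then v else x j else undefined))
      = (\<Sum>j\<in>{..<n} - {k}. c j * x j)" for c x v by (intro sum.cong) auto
  have s': "(\<Sum>j\<in>{..<n} - {k}. a j * x j / d) = (\<Sum>j\<in>{..<n} - {k}. a j * x j) / d" for x
    by (simp add: sum_divide_distrib)
  show "row_map n k (1/d) (\<lambda>j. - a j / d) (- b / d) (row_map n k d a b x) = x" if "x \<in> Rn n" for x
    using that k d by (intro Rn_eqI[of _ n])
      (auto simp: row_map_def restrict_def s sum_negf s' field_simps)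
  show "row_map n k d a b (row_map n k (1/d) (\<lambda>j. - a j / d) (- b / d) x) = x" if "x \<in> Rn n" for x
    using that k d by (intro Rn_eqI[of _ n])
      (auto simp: row_map_def restrict_def s sum_negf s' field_simps)
qed (rule affine_n_row_map[OF k])+

text \<open>With the other coordinates frozen, the map acts on coordinate \<open>k\<close> as the
  real affine map with slope \<open>d\<close> and intercept \<open>c x\<close>. Integrating over
  that coordinate innermost reduces the claim to the one-dimensional substitution.\<close>

lemma nn_integral_row_map:
  assumes k: "k < n" and d: "d \<noteq> 0" and f: "f \<in> borel_measurable (lborel_n n)"
  shows "(\<integral>\<^sup>+x. f x \<partial>lborel_n n) = ennreal \<bar>d\<bar> * (\<integral>\<^sup>+x. f (row_map n k d a b x) \<partial>lborel_n n)"
proof -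
  let ?I = "{..<n} - {k}"
  let ?L = "\<lambda>_::nat. lborel :: real measure"
  have ins: "lborel_n n = PiM (insert k ?I) ?L"
    using k by (simp add: lborel_n_def insert_absorb)
  have R: "row_map n k d a b \<in> measurable (lborel_n n) (lborel_n n)"
    using affine_n_measurable[OF affine_n_row_map[OF k]] .
  define c where "c x = (\<Sum>j\<in>?I. a j * x j) + b" for x :: "nat \<Rightarrow> real"
  have row: "row_map n k d a b (x(k := y)) = x(k := c x + d * y)"
    if "x \<in> space (PiM ?I ?L)" for x y
  proof -
    have "(\<Sum>j\<in>?I. a j * (if j = k then y else x j)) = (\<Sum>j\<in>?I. a j * x j)"
      by (intro sum.cong) auto
    then show ?thesis
      using that k by (auto simp: row_map_def c_def space_PiM PiE_iff extensional_def fun_eq_iff)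
  qed
  have fk: "(\<lambda>y. f (x(k := y))) \<in> borel_measurable borel" if x: "x \<in> space (PiM ?I ?L)" for x
  proof -
    have "(\<lambda>y. x(k := y)) \<in> measurable borel (PiM (insert k ?I) ?L)"
      by (rule measurable_PiM_single')
        (use x in \<open>auto simp: space_PiM PiE_iff extensional_def\<close>)
    then show ?thesis using f measurable_compose unfolding ins by blast
  qed
  have "(\<integral>\<^sup>+x. f x \<partial>lborel_n n) = (\<integral>\<^sup>+x. (\<integral>\<^sup>+y. f (x(k := y)) \<partial>lborel) \<partial>PiM ?I ?L)"
    unfolding ins using f by (intro lborel_prod.product_nn_integral_insert) (auto simp: ins)
  also have "\<dots> = (\<integral>\<^sup>+x. ennreal \<bar>d\<bar> * (\<integral>\<^sup>+y. f (row_map n k d a b (x(k := y))) \<partial>lborel) \<partial>PiM ?I ?L)"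
  proof (rule nn_integral_cong)
    fix x assume x: "x \<in> space (PiM ?I ?L)"
    show "(\<integral>\<^sup>+y. f (x(k := y)) \<partial>lborel)
      = ennreal \<bar>d\<bar> * (\<integral>\<^sup>+y. f (row_map n k d a b (x(k := y))) \<partial>lborel)"
      unfolding row[OF x] using nn_integral_real_affine[OF fk[OF x] d, of "c x"] .
  qed
  also have "\<dots> = ennreal \<bar>d\<bar> * (\<integral>\<^sup>+x. (\<integral>\<^sup>+y. f (row_map n k d a b (x(k := y))) \<partial>lborel) \<partial>PiM ?I ?L)"
  proof (rule nn_integral_cmult)
    have m: "(\<lambda>z. (fst z)(k := snd z)) \<in> measurable (PiM ?I ?L \<Otimes>\<^sub>M lborel) (lborel_n n)"
      unfolding ins by measurable
    have "(\<lambda>z. f (row_map n k d a b ((fst z)(k := snd z)))) \<in> borel_measurable (PiM ?I ?L \<Otimes>\<^sub>M lborel)"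
      by (rule measurable_compose[OF measurable_compose[OF m R] f])
    then show "(\<lambda>x. \<integral>\<^sup>+y. f (row_map n k d a b (x(k := y))) \<partial>lborel) \<in> borel_measurable (PiM ?I ?L)"
      by (intro lborel.borel_measurable_nn_integral) (simp add: split_beta')
  qed
  also have "(\<integral>\<^sup>+x. (\<integral>\<^sup>+y. f (row_map n k d a b (x(k := y))) \<partial>lborel) \<partial>PiM ?I ?L)
      = (\<integral>\<^sup>+x. f (row_map n k d a b x) \<partial>lborel_n n)"
    unfolding ins using measurable_compose[OF R f]
    by (intro lborel_prod.product_nn_integral_insert[symmetric]) (auto simp: ins)
  finally show ?thesis .
qed

lemma jacobian_row_map:
  assumes k: "k < n" and d: "d \<noteq> 0" shows "jacobian n (row_map n k d a b) = \<bar>d\<bar>"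
proof -
  let ?R = "row_map n k d a b" and ?C = "unit_cube n"
  have inv: "invertible_affine n ?R" by (rule invertible_row_map[OF assms])
  have C: "?C \<in> sets (lborel_n n)" by (rule sets_box) simp
  have RC: "?R ` ?C \<in> sets (lborel_n n)" by (rule sets_affine_image[OF inv C])
  have inj: "inj_on ?R (Rn n)" using inv by (simp add: invertible_affine_iff bij_betw_def)
  have sub: "?C \<subseteq> Rn n" using sets.sets_into_space[OF C] by simp
  have ind: "indicator (?R ` ?C) (?R x) = indicator ?C x" if "x \<in> Rn n" for x
    unfolding indicator_def using inj_on_image_mem_iff[OF inj that sub] by simp
  have "emeasure (lborel_n n) (?R ` ?C) = (\<integral>\<^sup>+x. indicator (?R ` ?C) x \<partial>lborel_n n)"
    using RC by simp
  also have "\<dots> = ennreal \<bar>d\<bar> * (\<integral>\<^sup>+x. indicator (?R ` ?C) (?R x) \<partial>lborel_n n)"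
    using RC by (intro nn_integral_row_map[OF assms]) simp
  also have "(\<integral>\<^sup>+x. indicator (?R ` ?C) (?R x) \<partial>lborel_n n) = (\<integral>\<^sup>+x. indicator ?C x \<partial>lborel_n n)"
    by (rule nn_integral_cong) (simp add: ind)
  also have "\<dots> = 1" using C by (simp add: emeasure_unit_cube)
  finally show ?thesis by (simp add: jacobian_def measure_def)
qed

definition scale :: "nat \<Rightarrow> real \<Rightarrow> (nat \<Rightarrow> real) \<Rightarrow> (nat \<Rightarrow> real) \<Rightarrow> nat \<Rightarrow> real" where
  "scale n s b x = (\<lambda>i\<in>{..<n}. s * x i + b i)"

lemma affine_n_scale: "affine_n n (scale n s b)"
proof (rule affine_nI)
  fix x :: "nat \<Rightarrow> real"
  have "(\<Sum>j<n. (if i = j then s else 0) * x j) = s * x i" if "i < n" for i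
    using that by (simp add: if_distrib[of "\<lambda>t. t * _"] cong: if_cong)
  then show "scale n s b x = (\<lambda>i\<in>{..<n}. (\<Sum>j<n. (if i = j then s else 0) * x j) + b i)"
    by (auto simp: scale_def fun_eq_iff)
qed

lemma invertible_scale: assumes "s \<noteq> 0" shows "invertible_affine n (scale n s b)"
proof (rule invertible_affineI[where S = "scale n (1 / s) (\<lambda>i. - b i / s)"])
  fix x assume "x \<in> Rn n"
  then show "scale n (1 / s) (\<lambda>i. - b i / s) (scale n s b x) = x"
    "scale n s b (scale n (1 / s) (\<lambda>i. - b i / s) x) = x"
    using assms by (intro Rn_eqI[of _ n]; simp add: scale_def field_simps)+
qed (rule affine_n_scale)+

lemma jacobian_scale: assumes s: "s > 0" shows "jacobian n (scale n s (\<lambda>_. 0)) = s ^ n"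
proof -
  have "scale n s (\<lambda>_. 0) ` unit_cube n = PiE {..<n} (\<lambda>_. {0..s})"
  proof (intro equalityI subsetI)
    fix y assume y: "y \<in> PiE {..<n} (\<lambda>_. {0..s})"
    define x where "x = (\<lambda>i\<in>{..<n}. y i / s)"
    have "x \<in> unit_cube n" using y s by (auto simp: x_def PiE_iff field_simps)
    moreover have "scale n s (\<lambda>_. 0) x = y"
      using y s by (intro Rn_eqI[of _ n]) (auto simp: scale_def x_def PiE_iff)
    ultimately show "y \<in> scale n s (\<lambda>_. 0) ` unit_cube n" by blast
  next
    fix y assume "y \<in> scale n s (\<lambda>_. 0) ` unit_cube n"
    then obtain x where x: "x \<in> unit_cube n" "y = scale n s (\<lambda>_. 0) x" by blast
    then have "y i \<in> {0..s}" if "i < n" for i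
      using that s by (simp add: scale_def PiE_iff mult_le_cancel_left1)
    then show "y \<in> PiE {..<n} (\<lambda>_. {0..s})" using x(2) by (simp add: scale_def PiE_iff)
  qed
  then show ?thesis using s
    by (simp add: jacobian_def measure_def emeasure_box ennreal_power)
qed

subsection \<open>Convex bodies\<close>

lemma continuous_map_coord [continuous_intros]:
  "i < n \<Longrightarrow> continuous_map (powertop_real {..<n}) euclideanreal (\<lambda>x. x i)"
  by (rule continuous_map_product_projection) simp

lemma continuous_map_affine_n:
  assumes "affine_n n T" shows "continuous_map (powertop_real {..<n}) (powertop_real {..<n}) T"
proof -
  obtain A b where T: "\<And>x. x \<in> Rn n \<Longrightarrow> T x = (\<lambda>i\<in>{..<n}. (\<Sum>j<n. A i j * x j) + b i)"
    using assms unfolding affine_n_def by blast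
  have "continuous_map (powertop_real {..<n}) euclideanreal (\<lambda>x. T x i)" if i: "i < n" for i
  proof (rule continuous_map_eq)
    show "continuous_map (powertop_real {..<n}) euclideanreal (\<lambda>x. (\<Sum>j<n. A i j * x j) + b i)"
      by (intro continuous_intros) auto
  qed (use T i in auto)
  then show ?thesis unfolding continuous_map_componentwise
    using affine_n_into[OF assms] by (auto simp: PiE_iff)
qed

lemma homeomorphic_affine:
  assumes "invertible_affine n T"
  shows "homeomorphic_map (powertop_real {..<n}) (powertop_real {..<n}) T"
proof -
  have "homeomorphic_maps (powertop_real {..<n}) (powertop_real {..<n}) T (inv_n n T)"
    unfolding homeomorphic_maps_def
  proof (intro conjI ballI)
    show "continuous_map (powertop_real {..<n}) (powertop_real {..<n}) T"
      using assms by (intro continuous_map_affine_n) (simp add: invertible_affine_iff)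
    show "continuous_map (powertop_real {..<n}) (powertop_real {..<n}) (inv_n n T)"
      by (rule continuous_map_affine_n[OF affine_n_inv[OF assms]])
    fix x assume "x \<in> topspace (powertop_real {..<n})"
    then have x: "x \<in> Rn n" by simp
    show "inv_n n T (T x) = x" "T (inv_n n T x) = x" by (rule inv_n_simps[OF assms x])+
  qed
  then show ?thesis using homeomorphic_maps_map by blast
qed

text \<open>The question is moved to functions defined on all indices, where measurability into the
  Borel sets can be checked coordinatewise. Restriction \<phi> is continuous, so it pulls
  \<open>U\<close> back to an open set; extension by zero \<psi> is measurable; and \<phi> undoes
  \<psi>, so the preimage under \<psi> is \<open>U\<close> again.\<close>

lemma openin_sets_lborel_n:
  assumes "openin (powertop_real {..<n}) U" shows "U \<in> sets (lborel_n n)"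
proof -
  define \<phi> where "\<phi> x = (\<lambda>i\<in>{..<n}. x i)" for x :: "nat \<Rightarrow> real"
  define \<psi> where "\<psi> x i = (if i < n then x i else 0)" for x :: "nat \<Rightarrow> real" and i
  have "continuous_map (powertop_real UNIV) (powertop_real {..<n}) \<phi>"
    unfolding continuous_map_componentwise \<phi>_def
    by (auto intro!: continuous_map_product_projection)
  then have "openin (powertop_real UNIV) {x \<in> topspace (powertop_real UNIV). \<phi> x \<in> U}"
    using assms by (rule openin_continuous_map_preimage)
  then have "open (\<phi> -` U)"
    by (simp add: open_fun_def vimage_def)
  moreover have "\<psi> \<in> borel_measurable (lborel_n n)"
  proof (rule measurable_coordinatewise_then_product)
    show "(\<lambda>x. \<psi> x i) \<in> borel_measurable (lborel_n n)" for i
      by (cases "i < n") (simp_all add: \<psi>_def)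
  qed
  ultimately have "\<psi> -` (\<phi> -` U) \<inter> space (lborel_n n) \<in> sets (lborel_n n)"
    by (intro measurable_sets[of \<psi> _ borel]) auto
  moreover have "\<psi> -` (\<phi> -` U) \<inter> space (lborel_n n) = U"
  proof -
    have "\<phi> (\<psi> x) = x" if "x \<in> Rn n" for x
      using that by (intro Rn_eqI[of _ n]) (auto simp: \<phi>_def \<psi>_def)
    moreover have "U \<subseteq> Rn n" using openin_subset[OF assms] by simp
    ultimately show ?thesis unfolding space_lborel_n vimage_def
      by (intro set_eqI) (metis (mono_tags) IntD1 IntD2 IntI mem_Collect_eq subsetD)
  qed
  ultimately show ?thesis by simp
qed

text \<open>Cubes are the neighbourhoods natural to the product topology, and their volume is an
  explicit product.\<close>

lemma openin_contains_cube:
  assumes "openin (powertop_real {..<n}) U" "x \<in> U"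
  shows "\<exists>e>0. \<forall>y\<in>Rn n. (\<forall>i<n. \<bar>y i - x i\<bar> \<le> e) \<longrightarrow> y \<in> U"
proof -
  obtain V where V: "\<And>i. i < n \<Longrightarrow> open (V i)" "x \<in> PiE {..<n} V" "PiE {..<n} V \<subseteq> U"
  proof -
    obtain V where V: "\<forall>i\<in>{..<n}. openin euclideanreal (V i)" "x \<in> PiE {..<n} V" "PiE {..<n} V \<subseteq> U"
      using assms unfolding openin_product_topology_alt by meson
    show thesis by (rule that[of V]) (use V in simp_all)
  qed
  have "\<exists>e>0. \<forall>t. \<bar>t - x i\<bar> \<le> e \<longrightarrow> t \<in> V i" if i: "i < n" for i
  proof -
    have "x i \<in> V i" using V(2) i by (auto simp: PiE_iff)
    then obtain e where "e > 0" "cball (x i) e \<subseteq> V i"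
      using V(1)[OF i] unfolding open_contains_cball by blast
    then show ?thesis by (intro exI[of _ e]) (auto simp: subset_eq dist_real_def abs_minus_commute)
  qed
  then obtain e where e: "\<And>i. i < n \<Longrightarrow> e i > 0" "\<And>i t. i < n \<Longrightarrow> \<bar>t - x i\<bar> \<le> e i \<Longrightarrow> t \<in> V i"
    by metis
  \<comment> \<open>Inserting 1 keeps the set nonempty when \<open>n = 0\<close>.\<close>
  define d where "d = Min (insert 1 (e ` {..<n}))"
  have "d > 0" unfolding d_def using e(1) by (subst Min_gr_iff) auto
  moreover have "y \<in> U" if "y \<in> Rn n" "\<forall>i<n. \<bar>y i - x i\<bar> \<le> d" for y
  proof -
    have "d \<le> e i" if "i < n" for i unfolding d_def using that by (intro Min_le) auto
    then have "y i \<in> V i" if "i < n" for i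
      using that \<open>\<forall>i<n. _\<close> by (intro e(2)) force+
    then show ?thesis using V(3) \<open>y \<in> Rn n\<close> by (auto simp: PiE_iff subset_eq)
  qed
  ultimately show ?thesis by blast
qed

lemma convex_body_subset: "convex_body n K \<Longrightarrow> K \<subseteq> Rn n"
  unfolding convex_body_def using compactin_subset_topspace by fastforce

lemma convex_body_sets: assumes "convex_body n K" shows "K \<in> sets (lborel_n n)"
proof -
  have "Hausdorff_space (powertop_real {..<n})" by (simp add: Hausdorff_space_product_topology)
  then have "closedin (powertop_real {..<n}) K"
    using assms compactin_imp_closedin unfolding convex_body_def by blast
  then have "Rn n - K \<in> sets (lborel_n n)"
    by (intro openin_sets_lborel_n) (auto simp: closedin_def)
  then have "space (lborel_n n) - (Rn n - K) \<in> sets (lborel_n n)" by (rule sets.compl_sets)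
  then show ?thesis using convex_body_subset[OF assms] by (simp add: double_diff)
qed

lemma convex_body_bounded:
  assumes "convex_body n K" shows "\<exists>R>0. \<forall>x\<in>K. \<forall>i<n. \<bar>x i\<bar> \<le> R"
proof -
  have "\<exists>r. \<forall>x\<in>K. \<bar>x i\<bar> \<le> r" if "i < n" for i
  proof -
    have "compactin euclideanreal ((\<lambda>x. x i) ` K)"
      using assms continuous_map_coord[OF that] image_compactin unfolding convex_body_def by blast
    then have "bounded ((\<lambda>x. x i) ` K)" by (simp add: compact_imp_bounded)
    then show ?thesis by (auto simp: bounded_iff)
  qed
  then obtain r where r: "\<And>i x. i < n \<Longrightarrow> x \<in> K \<Longrightarrow> \<bar>x i\<bar> \<le> r i" by metis
  define R where "R = Max (insert 1 (r ` {..<n}))"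
  have "r i \<le> R" if "i < n" for i unfolding R_def using that by (intro Max_ge) auto
  then have "\<forall>x\<in>K. \<forall>i<n. \<bar>x i\<bar> \<le> R" using r by force
  moreover have "1 \<le> R" unfolding R_def by (intro Max_ge) auto
  ultimately show ?thesis by (intro exI[of _ R]) auto
qed

lemma convex_body_contains_cube:
  assumes "convex_body n K"
  shows "\<exists>b e. e > 0 \<and> (\<forall>y\<in>Rn n. (\<forall>i<n. \<bar>y i - b i\<bar> \<le> e) \<longrightarrow> y \<in> K)"
proof -
  obtain b where b: "b \<in> powertop_real {..<n} interior_of K"
    using assms unfolding convex_body_def by blast
  show ?thesis
    using openin_contains_cube[OF openin_interior_of b] interior_of_subset by (metis subsetD)
qed

lemma convex_body_emeasure:
  assumes "convex_body n K"
  shows "emeasure (lborel_n n) K < \<infinity>" "emeasure (lborel_n n) K > 0" "vol n K > 0"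
proof -
  obtain R where "\<forall>x\<in>K. \<forall>i<n. \<bar>x i\<bar> \<le> R" using convex_body_bounded[OF assms] by blast
  then show fin: "emeasure (lborel_n n) K < \<infinity>"
    using convex_body_subset[OF assms] by (intro emeasure_bounded_finite) auto
  obtain x e where e: "e > 0" "\<And>y. y \<in> Rn n \<Longrightarrow> (\<forall>i<n. \<bar>y i - x i\<bar> \<le> e) \<Longrightarrow> y \<in> K"
    using convex_body_contains_cube[OF assms] by blast
  have "PiE {..<n} (\<lambda>i. {x i - e..x i + e}) \<subseteq> K"
  proof
    fix y assume y: "y \<in> PiE {..<n} (\<lambda>i. {x i - e..x i + e})"
    then have "\<bar>y i - x i\<bar> \<le> e" if "i < n" for i
      using PiE_mem[OF y, of i] that by (simp add: abs_le_iff)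
    moreover have "y \<in> Rn n" using y by (simp add: PiE_iff)
    ultimately show "y \<in> K" using e(2) by blast
  qed
  then have "emeasure (lborel_n n) (PiE {..<n} (\<lambda>i. {x i - e..x i + e})) \<le> emeasure (lborel_n n) K"
    by (rule emeasure_mono) (rule convex_body_sets[OF assms])
  moreover have "emeasure (lborel_n n) (PiE {..<n} (\<lambda>i. {x i - e..x i + e})) = ennreal ((2 * e) ^ n)"
    using e(1) by (subst emeasure_box) (auto simp: ennreal_power)
  ultimately show pos: "emeasure (lborel_n n) K > 0"
    using e(1) by (metis ennreal_less_zero_iff less_le_trans mult_pos_pos zero_less_numeral zero_less_power)
  show "vol n K > 0" using fin pos by (simp add: measure_def enn2real_positive_iff less_top)
qed

lemma affine_n_convex_comb:
  assumes "affine_n n T" "x \<in> Rn n" "y \<in> Rn n" "u + v = 1"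
  shows "T (\<lambda>i\<in>{..<n}. u * x i + v * y i) = (\<lambda>i\<in>{..<n}. u * T x i + v * T y i)"
proof -
  obtain A b where T: "\<And>x. x \<in> Rn n \<Longrightarrow> T x = (\<lambda>i\<in>{..<n}. (\<Sum>j<n. A i j * x j) + b i)"
    using assms(1) unfolding affine_n_def by blast
  have "(\<Sum>j<n. A i j * (u * x j + v * y j)) = u * (\<Sum>j<n. A i j * x j) + v * (\<Sum>j<n. A i j * y j)" for i
    by (simp add: sum_distrib_left sum.distrib algebra_simps)
  moreover have "b i = u * b i + v * b i" for i using assms(4) by (metis distrib_right mult_1)
  ultimately show ?thesis by (auto simp: T assms(2,3) fun_eq_iff algebra_simps)
qed

lemma convex_body_affine_image:
  assumes K: "convex_body n K" and T: "invertible_affine n T" shows "convex_body n (T ` K)"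
proof -
  have aff: "affine_n n T" using T by (simp add: invertible_affine_iff)
  have sub: "K \<subseteq> Rn n" by (rule convex_body_subset[OF K])
  have "compactin (powertop_real {..<n}) (T ` K)"
    using K image_compactin continuous_map_affine_n[OF aff] unfolding convex_body_def by blast
  moreover have "convex_n n (T ` K)"
    unfolding convex_n_def
  proof (intro ballI allI impI)
    fix y z u v assume "y \<in> T ` K" "z \<in> T ` K" and uv: "u \<ge> 0" "v \<ge> 0" "u + v = (1::real)"
    then obtain p q where pq: "p \<in> K" "q \<in> K" "y = T p" "z = T q" by blast
    then have "(\<lambda>i\<in>{..<n}. u * p i + v * q i) \<in> K"
      using K uv unfolding convex_body_def convex_n_def by blast
    moreover have "T (\<lambda>i\<in>{..<n}. u * p i + v * q i) = (\<lambda>i\<in>{..<n}. u * y i + v * z i)"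
      unfolding pq(3,4) by (rule affine_n_convex_comb[OF aff subsetD[OF sub pq(1)] subsetD[OF sub pq(2)] uv(3)])
    ultimately show "(\<lambda>i\<in>{..<n}. u * y i + v * z i) \<in> T ` K"
      by (intro image_eqI[where x = "\<lambda>i\<in>{..<n}. u * p i + v * q i"]) (rule sym)
  qed
  moreover have "powertop_real {..<n} interior_of (T ` K) \<noteq> {}"
    using homeomorphic_map_interior_of[OF homeomorphic_affine[OF T]] sub K
    unfolding convex_body_def by simp
  ultimately show ?thesis unfolding convex_body_def by blast
qed

subsection \<open>Isotropic position\<close>

abbreviation unif :: "nat \<Rightarrow> (nat \<Rightarrow> real) set \<Rightarrow> (nat \<Rightarrow> real) measure" where
  "unif n K \<equiv> uniform_measure (lborel_n n) K"

lemma prob_space_unif: "convex_body n K \<Longrightarrow> prob_space (unif n K)"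
  using convex_body_emeasure[of n K] by (intro prob_space_uniform_measure) auto

lemma AE_unif_mem: "convex_body n K \<Longrightarrow> AE x in unif n K. x \<in> K"
  by (rule AE_uniform_measureI) (auto intro: convex_body_sets)

text \<open>The volume factor occurs in numerator and denominator of the conditional probability and
  cancels. Expectations over an affine image thus become expectations over the original
  body.\<close>

lemma distr_unif:
  assumes K: "convex_body n K" and T: "invertible_affine n T"
  shows "distr (unif n K) (lborel_n n) T = unif n (T ` K)"
proof (rule measure_eqI)
  have aff: "affine_n n T" using T by (simp add: invertible_affine_iff)
  have T_m: "T \<in> measurable (lborel_n n) (lborel_n n)" by (rule affine_n_measurable[OF aff])
  note TK = convex_body_affine_image[OF K T]
  fix E assume "E \<in> sets (distr (unif n K) (lborel_n n) T)"
  then have E: "E \<in> sets (lborel_n n)" by simp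
  define F where "F = K \<inter> (T -` E \<inter> Rn n)"
  have F: "F \<in> sets (lborel_n n)"
    using convex_body_sets[OF K] measurable_sets[OF T_m E] by (auto simp: F_def)
  have eq: "T ` K \<inter> E = T ` F" using convex_body_subset[OF K] by (auto simp: F_def)
  have "emeasure (distr (unif n K) (lborel_n n) T) E = emeasure (lborel_n n) F / emeasure (lborel_n n) K"
    using T_m E convex_body_sets[OF K] measurable_sets[OF T_m E]
    by (subst emeasure_distr) (simp_all add: F_def)
  also have "\<dots> = emeasure (lborel_n n) (T ` F) / emeasure (lborel_n n) (T ` K)"
    unfolding affine_image_jacobian(2)[OF T F] affine_image_jacobian(2)[OF T convex_body_sets[OF K]]
    using affine_image_jacobian(1)[OF T]
    by (subst (1 2) mult.commute) (simp add: divide_mult_eq)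
  also have "\<dots> = emeasure (unif n (T ` K)) E"
    using E convex_body_sets[OF TK] by (simp add: eq)
  finally show "emeasure (distr (unif n K) (lborel_n n) T) E = emeasure (unif n (T ` K)) E" .
qed simp

lemma integral_unif:
  fixes f :: "_ \<Rightarrow> real"
  assumes K: "convex_body n K" and [measurable]: "f \<in> borel_measurable (lborel_n n)"
  shows "(\<integral>x. f x \<partial>unif n K) = (LINT x:K|lborel_n n. f x) / vol n K"
proof -
  have [measurable]: "K \<in> sets (lborel_n n)" by (rule convex_body_sets[OF K])
  have V: "emeasure (lborel_n n) K = ennreal (vol n K)"
    using convex_body_emeasure(1)[OF K] by (simp add: emeasure_eq_ennreal_measure less_top)
  have "unif n K = density (lborel_n n) (\<lambda>x. ennreal (indicator K x / vol n K))"
    unfolding uniform_measure_def V using convex_body_emeasure(3)[OF K]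
    by (intro density_cong) (auto simp: indicator_def divide_ennreal ennreal_1[symmetric] simp del: ennreal_1)
  then have "(\<integral>x. f x \<partial>unif n K) = (\<integral>x. (indicator K x / vol n K) *\<^sub>R f x \<partial>lborel_n n)"
    by (simp add: integral_density)
  also have "\<dots> = (\<integral>x. (indicator K x *\<^sub>R f x) / vol n K \<partial>lborel_n n)"
    by (intro Bochner_Integration.integral_cong) auto
  finally show ?thesis by (simp add: set_lebesgue_integral_def)
qed

text \<open>The functions to be integrated are built from coordinates, hence bounded on a body but
  not on the whole space. This class is closed under the algebraic operations and is integrable for
  the uniform measure, which settles most integrability side conditions.\<close>

definition bounded_meas :: "nat \<Rightarrow> (nat \<Rightarrow> real) set \<Rightarrow> ((nat \<Rightarrow> real) \<Rightarrow> real) \<Rightarrow> bool" where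
  "bounded_meas n K f \<longleftrightarrow> f \<in> borel_measurable (lborel_n n) \<and> (\<exists>C. \<forall>x\<in>K. \<bar>f x\<bar> \<le> C)"

lemma bounded_meas_const: "bounded_meas n K (\<lambda>_. c)"
  by (auto simp: bounded_meas_def)

lemma bounded_meas_add:
  assumes "bounded_meas n K f" "bounded_meas n K g" shows "bounded_meas n K (\<lambda>x. f x + g x)"
proof -
  obtain C D where "\<forall>x\<in>K. \<bar>f x\<bar> \<le> C" "\<forall>x\<in>K. \<bar>g x\<bar> \<le> D" using assms by (auto simp: bounded_meas_def)
  then have "\<forall>x\<in>K. \<bar>f x + g x\<bar> \<le> C + D" by (meson abs_triangle_ineq add_mono order_trans)
  then show ?thesis using assms by (auto simp: bounded_meas_def)
qed

lemma bounded_meas_mult: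
  assumes "bounded_meas n K f" "bounded_meas n K g" shows "bounded_meas n K (\<lambda>x. f x * g x)"
proof -
  obtain C D where "\<forall>x\<in>K. \<bar>f x\<bar> \<le> C" "\<forall>x\<in>K. \<bar>g x\<bar> \<le> D" using assms by (auto simp: bounded_meas_def)
  then have "\<forall>x\<in>K. \<bar>f x * g x\<bar> \<le> C * D"
    by (auto simp: abs_mult intro!: mult_mono intro: order_trans[OF abs_ge_zero])
  then show ?thesis using assms by (auto simp: bounded_meas_def)
qed

lemma bounded_meas_diff:
  "bounded_meas n K f \<Longrightarrow> bounded_meas n K g \<Longrightarrow> bounded_meas n K (\<lambda>x. f x - g x)"
  using bounded_meas_add[of n K f "\<lambda>x. - 1 * g x"] bounded_meas_mult[OF bounded_meas_const, of n K g "-1"]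
  by simp

lemma bounded_meas_power: "bounded_meas n K f \<Longrightarrow> bounded_meas n K (\<lambda>x. f x ^ k)"
  by (induction k) (auto intro: bounded_meas_const bounded_meas_mult)

lemma bounded_meas_sum:
  "(\<And>i. i \<in> I \<Longrightarrow> bounded_meas n K (f i)) \<Longrightarrow> bounded_meas n K (\<lambda>x. \<Sum>i\<in>I. f i x)"
  by (induction I rule: infinite_finite_induct) (auto intro: bounded_meas_const bounded_meas_add)

lemma bounded_meas_coord:
  assumes "convex_body n K" "i < n" shows "bounded_meas n K (\<lambda>x. x i)"
  using convex_body_bounded[OF assms(1)] assms(2) by (auto simp: bounded_meas_def)

lemma bounded_meas_affine:
  assumes K: "convex_body n K" and T: "affine_n n T" and i: "i < n"
  shows "bounded_meas n K (\<lambda>x. T x i)"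
proof -
  obtain R where R: "\<forall>x\<in>K. \<forall>i<n. \<bar>x i\<bar> \<le> R" using convex_body_bounded[OF K] by blast
  obtain R' where "\<forall>x\<in>K. \<forall>i<n. \<bar>T x i\<bar> \<le> R'"
    using affine_image_bounded[OF T _ convex_body_subset[OF K], of R] R by auto
  moreover have "(\<lambda>x. T x i) \<in> borel_measurable (lborel_n n)"
    by (rule measurable_compose[OF affine_n_measurable[OF T] coord_measurable[OF i]])
  ultimately show ?thesis using i by (auto simp: bounded_meas_def)
qed

lemma integrable_unif:
  assumes "convex_body n K" "bounded_meas n K f" shows "integrable (unif n K) f"
proof -
  interpret prob_space "unif n K" by (rule prob_space_unif[OF assms(1)])
  obtain C where "\<forall>x\<in>K. \<bar>f x\<bar> \<le> C" and [measurable]: "f \<in> borel_measurable (lborel_n n)"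
    using assms(2) by (auto simp: bounded_meas_def)
  then have "AE x in unif n K. norm (f x) \<le> C" using AE_unif_mem[OF assms(1)] by auto
  then show ?thesis by (rule integrable_const_bound) simp
qed

lemma AE_coord_nonzero:
  assumes k: "k < n" shows "AE x in lborel_n n. x k \<noteq> 0"
proof -
  let ?H = "PiE {..<n} (\<lambda>i. if i = k then {0} else UNIV)"
  have "emeasure (lborel_n n) ?H = (\<Prod>i<n. emeasure lborel (if i = k then {0::real} else UNIV))"
    by (rule emeasure_box) auto
  also have "\<dots> = 0" using k by (intro prod_zero) auto
  finally have "?H \<in> null_sets (lborel_n n)" by (intro null_setsI sets_box) auto
  moreover have "x \<in> ?H" if "x \<in> space (lborel_n n)" "x k = 0" for x
    using that by (auto simp: PiE_iff)
  ultimately show ?thesis by (intro AE_I'[of ?H]) auto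
qed

text \<open>A vanishing moment would put almost all of the image body into a coordinate hyperplane,
  which has measure 0. Gram--Schmidt uses this to see that a residual is never zero.\<close>

lemma second_moment_pos:
  assumes K: "convex_body n K" and T: "invertible_affine n T" and k: "k < n"
  shows "(\<integral>x. (T x k)\<^sup>2 \<partial>unif n K) > 0"
proof (rule ccontr)
  have aff: "affine_n n T" using T by (simp add: invertible_affine_iff)
  have TK: "convex_body n (T ` K)" by (rule convex_body_affine_image[OF K T])
  interpret TK: prob_space "unif n (T ` K)" by (rule prob_space_unif[OF TK])
  have int: "integrable (unif n K) (\<lambda>x. (T x k)\<^sup>2)"
    by (intro integrable_unif[OF K] bounded_meas_power bounded_meas_affine[OF K aff k])
  assume "\<not> (\<integral>x. (T x k)\<^sup>2 \<partial>unif n K) > 0"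
  moreover have "(\<integral>x. (T x k)\<^sup>2 \<partial>unif n K) \<ge> 0" by (rule Bochner_Integration.integral_nonneg) simp
  ultimately have "AE x in unif n K. (T x k)\<^sup>2 = 0"
    using integral_nonneg_eq_0_iff_AE[OF int] by simp
  then have "AE x in unif n K. T x k = 0" by simp
  moreover have "T \<in> measurable (unif n K) (lborel_n n)"
    using affine_n_measurable[OF aff] by (simp cong: measurable_cong_sets)
  ultimately have "AE x in distr (unif n K) (lborel_n n) T. x k = 0"
  proof (subst AE_distr_iff)
    show "{x \<in> space (lborel_n n). x k = 0} \<in> sets (lborel_n n)"
      using coord_measurable[OF k] by measurable
  qed auto
  then have "AE x in unif n (T ` K). x k = 0" unfolding distr_unif[OF K T] .
  moreover have "AE x in unif n (T ` K). x k \<noteq> 0"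
    by (rule AE_uniform_measureI[OF convex_body_sets[OF TK]]) (use AE_coord_nonzero[OF k] in auto)
  ultimately have "AE x in unif n (T ` K). False" by eventually_elim simp
  then show False using TK.AE_const[of False] by simp
qed

text \<open>
  Gram--Schmidt in \<open>L\<^sup>2(K)\<close> one coordinate at a time. The scaling factor \<open>s k\<close> of step \<open>k\<close> is the
  distance of the \<open>k\<close>-th coordinate from the span of the earlier ones and the constants.
\<close>

definition whitens_upto ::
  "nat \<Rightarrow> (nat \<Rightarrow> real) set \<Rightarrow> nat \<Rightarrow> ((nat \<Rightarrow> real) \<Rightarrow> nat \<Rightarrow> real) \<Rightarrow> (nat \<Rightarrow> real) \<Rightarrow> bool" where
  "whitens_upto n K k T s \<longleftrightarrow>
     invertible_affine n T \<and> (\<forall>i<k. s i > 0 \<and> (s i)\<^sup>2 \<le> (\<integral>x. (x i)\<^sup>2 \<partial>unif n K)) \<and>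
     jacobian n T * (\<Prod>i<k. s i) = 1 \<and> (\<forall>x\<in>Rn n. \<forall>i<n. k \<le> i \<longrightarrow> T x i = x i) \<and>
     (\<forall>i<k. (\<integral>x. T x i \<partial>unif n K) = 0) \<and>
     (\<forall>i<k. \<forall>j<k. (\<integral>x. T x i * T x j \<partial>unif n K) = of_bool (i = j))"

text \<open>Each step multiplies the Jacobian by the inverse of the new factor, so the product stays
  1. Coordinates not yet treated are left untouched: step \<open>k\<close> projects the original
  coordinate, and since a projection does not increase the norm, its factor is controlled by the
  second moment of that coordinate.\<close>

lemma gram_schmidt_body:
  assumes K: "convex_body n K" and "k \<le> n"
  shows "\<exists>T s. whitens_upto n K k T s"
  using \<open>k \<le> n\<close>
proof (induction k)
  case 0
  show ?case
    unfolding whitens_upto_def by (rule exI[of _ "scale n 1 (\<lambda>_. 0)"])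
      (simp add: invertible_scale jacobian_scale, simp add: scale_def)
next
  case (Suc k)
  then have k: "k < n" by simp
  let ?E = "\<lambda>f. \<integral>x. f x \<partial>unif n K"
  from Suc obtain T s where "whitens_upto n K k T s" by auto
  then have T: "invertible_affine n T"
    and s: "\<And>i. i < k \<Longrightarrow> s i > 0" "\<And>i. i < k \<Longrightarrow> (s i)\<^sup>2 \<le> ?E (\<lambda>x. (x i)\<^sup>2)"
    and jac: "jacobian n T * (\<Prod>i<k. s i) = 1"
    and Tx: "\<And>x i. x \<in> Rn n \<Longrightarrow> i < n \<Longrightarrow> k \<le> i \<Longrightarrow> T x i = x i"
    and mean: "\<And>i. i < k \<Longrightarrow> ?E (\<lambda>x. T x i) = 0"
    and cov: "\<And>i j. i < k \<Longrightarrow> j < k \<Longrightarrow> ?E (\<lambda>x. T x i * T x j) = of_bool (i = j)"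
    unfolding whitens_upto_def by blast+
  interpret prob_space "unif n K" by (rule prob_space_unif[OF K])
  have aff: "affine_n n T" using T by (simp add: invertible_affine_iff)
  have bm_T: "bounded_meas n K (\<lambda>x. T x i)" if "i < n" for i by (rule bounded_meas_affine[OF K aff that])
  have bm_k: "bounded_meas n K (\<lambda>x. x k)" by (rule bounded_meas_coord[OF K k])
  note bm = bounded_meas_const bounded_meas_add bounded_meas_diff bounded_meas_mult bounded_meas_power
    bounded_meas_sum bm_T bm_k
  note int = integrable_unif[OF K]
  define c where "c = ?E (\<lambda>x. x k)"
  define a where "a j = ?E (\<lambda>x. x k * T x j)" for j
  \<comment> \<open>The residual of coordinate \<open>k\<close> after orthogonal projection onto the
    constants and the coordinates already orthonormalised.\<close>
  define w where "w x = x k - c - (\<Sum>j<k. a j * T x j)" for x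
  have bm_w: "bounded_meas n K w" unfolding w_def by (intro bm) (use k in auto)
  \<comment> \<open>Bilinearity for an arbitrary test function. The choices of 1, an earlier
    coordinate, coordinate \<open>k\<close> and \<open>w\<close> itself give the orthogonality
    relations and Pythagoras.\<close>
  have Ew: "?E (\<lambda>x. w x * g x) = ?E (\<lambda>x. x k * g x) - c * ?E g - (\<Sum>j<k. a j * ?E (\<lambda>x. T x j * g x))"
    if g: "bounded_meas n K g" for g
  proof -
    have i1: "integrable (unif n K) (\<lambda>x. x k * g x)" by (intro int bm g)
    have i2: "integrable (unif n K) (\<lambda>x. c * g x)" by (intro int bm g)
    have i3: "integrable (unif n K) (\<lambda>x. a j * (T x j * g x))" if "j \<in> {..<k}" for j
      using that k by (intro int bm g) auto
    have "?E (\<lambda>x. w x * g x) = ?E (\<lambda>x. x k * g x - c * g x - (\<Sum>j<k. a j * (T x j * g x)))"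
      by (intro Bochner_Integration.integral_cong)
        (auto simp: w_def left_diff_distrib sum_distrib_right mult.assoc)
    also have "\<dots> = ?E (\<lambda>x. x k * g x - c * g x) - ?E (\<lambda>x. \<Sum>j<k. a j * (T x j * g x))"
      by (intro Bochner_Integration.integral_diff Bochner_Integration.integrable_diff
          Bochner_Integration.integrable_sum i1 i2 i3)
    also have "?E (\<lambda>x. x k * g x - c * g x) = ?E (\<lambda>x. x k * g x) - ?E (\<lambda>x. c * g x)"
      by (intro Bochner_Integration.integral_diff i1 i2)
    also have "?E (\<lambda>x. \<Sum>j<k. a j * (T x j * g x)) = (\<Sum>j<k. ?E (\<lambda>x. a j * (T x j * g x)))"
      by (intro Bochner_Integration.integral_sum i3)
    finally show ?thesis by simp
  qed
  have w_mean: "?E w = 0"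
    using Ew[OF bounded_meas_const[of n K 1]] mean prob_space by (simp add: c_def)
  have w_T: "?E (\<lambda>x. w x * T x i) = 0" if "i < k" for i
  proof -
    have "(\<Sum>j<k. a j * ?E (\<lambda>x. T x j * T x i)) = (\<Sum>j<k. if j = i then a j else 0)"
      using that cov by (intro sum.cong) auto
    also have "\<dots> = a i" using that by simp
    finally show ?thesis using Ew[OF bm_T[of i]] mean[OF that] that k by (simp add: a_def)
  qed
  have w_k: "?E (\<lambda>x. w x * x k) = ?E (\<lambda>x. (x k)\<^sup>2) - c\<^sup>2 - (\<Sum>j<k. (a j)\<^sup>2)"
    using Ew[OF bm_k] by (simp add: c_def[symmetric] a_def[symmetric] power2_eq_square mult.commute[of "T _ _"])
  have "?E (\<lambda>x. w x * w x) = ?E (\<lambda>x. x k * w x) - c * ?E w - (\<Sum>j<k. a j * ?E (\<lambda>x. T x j * w x))"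
    by (rule Ew[OF bm_w])
  also have "\<dots> = ?E (\<lambda>x. (x k)\<^sup>2) - c\<^sup>2 - (\<Sum>j<k. (a j)\<^sup>2)"
    using w_mean w_T w_k by (simp add: mult.commute[of _ "w _"])
  finally have "?E (\<lambda>x. (w x)\<^sup>2) = ?E (\<lambda>x. (x k)\<^sup>2) - c\<^sup>2 - (\<Sum>j<k. (a j)\<^sup>2)"
    by (simp only: power2_eq_square[of "w _"])
  moreover have "(\<Sum>j<k. (a j)\<^sup>2) \<ge> 0" by (intro sum_nonneg) simp
  ultimately have ww: "?E (\<lambda>x. (w x)\<^sup>2) \<le> ?E (\<lambda>x. (x k)\<^sup>2)"
    using zero_le_power2[of c] by linarith
  \<comment> \<open>Instantiated with \<open>d = 1\<close> to exhibit the residual as a coordinate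
    of an invertible affine map, so that its second moment is positive, and with
    \<open>d = 1 / \<sigma>\<close> for the normalised step.\<close>
  have row: "row_map n k d (\<lambda>j. if j < k then - a j * d else 0) (- c * d) (T x) =
      (\<lambda>i\<in>{..<n}. if i = k then d * w x else T x i)" if x: "x \<in> Rn n" for x d
  proof -
    have "(\<Sum>j\<in>{..<n} - {k}. (if j < k then - a j * d else 0) * T x j) = (\<Sum>j<k. - a j * d * T x j)"
      using k by (intro sum.mono_neutral_cong_right) auto
    also have "\<dots> = - d * (\<Sum>j<k. a j * T x j)" by (simp add: sum_distrib_left algebra_simps)
    finally show ?thesis
      using Tx[OF x k order_refl] by (auto simp: row_map_def w_def fun_eq_iff algebra_simps)
  qed
  define \<sigma> where "\<sigma> = sqrt (?E (\<lambda>x. (w x)\<^sup>2))"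
  have "?E (\<lambda>x. (w x)\<^sup>2) > 0"
  proof -
    let ?R = "row_map n k 1 (\<lambda>j. if j < k then - a j * 1 else 0) (- c * 1)"
    have "?E (\<lambda>x. ((?R \<circ> T) x k)\<^sup>2) > 0"
      by (intro second_moment_pos[OF K _ k] invertible_affine_comp invertible_row_map T k) simp
    also have "?E (\<lambda>x. ((?R \<circ> T) x k)\<^sup>2) = ?E (\<lambda>x. (w x)\<^sup>2)"
      using row[of _ 1] k by (intro Bochner_Integration.integral_cong) auto
    finally show ?thesis .
  qed
  then have \<sigma>: "\<sigma> > 0" "\<sigma>\<^sup>2 = ?E (\<lambda>x. (w x)\<^sup>2)" by (auto simp: \<sigma>_def)
  define R where "R = row_map n k (1/\<sigma>) (\<lambda>j. if j < k then - a j * (1/\<sigma>) else 0) (- c * (1/\<sigma>))"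
  have R: "invertible_affine n R" unfolding R_def by (rule invertible_row_map[OF k]) (use \<sigma> in simp)
  have jR: "jacobian n R = 1 / \<sigma>" unfolding R_def using \<sigma> by (subst jacobian_row_map[OF k]) auto
  have RT: "(R \<circ> T) x i = (if i = k then w x / \<sigma> else T x i)" if "x \<in> Rn n" "i < n" for x i
    using row[OF that(1), of "1/\<sigma>"] that(2) by (simp add: R_def)
  have E_cong: "?E f = ?E g" if "\<And>x. x \<in> Rn n \<Longrightarrow> f x = g x" for f g :: "_ \<Rightarrow> real"
    using that by (intro Bochner_Integration.integral_cong) auto
  show ?case unfolding whitens_upto_def
  proof (intro exI[of _ "R \<circ> T"] exI[of _ "s(k := \<sigma>)"] conjI allI ballI impI)
    show "invertible_affine n (R \<circ> T)" by (rule invertible_affine_comp[OF R T])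
    show "(s(k := \<sigma>)) i > 0" "((s(k := \<sigma>)) i)\<^sup>2 \<le> ?E (\<lambda>x. (x i)\<^sup>2)" if "i < Suc k" for i
      using that s ww \<sigma> by (auto simp: less_Suc_eq)
    have "(\<Prod>i<Suc k. (s(k := \<sigma>)) i) = (\<Prod>i<k. s i) * \<sigma>" by simp
    then show "jacobian n (R \<circ> T) * (\<Prod>i<Suc k. (s(k := \<sigma>)) i) = 1"
      using jac \<sigma>(1) by (simp add: jacobian_comp[OF R T] jR)
    show "(R \<circ> T) x i = x i" if "x \<in> Rn n" "i < n" "Suc k \<le> i" for x i
      using that Tx RT by simp
    show "?E (\<lambda>x. (R \<circ> T) x i) = 0" if "i < Suc k" for i
    proof -
      have "?E (\<lambda>x. (R \<circ> T) x i) = ?E (\<lambda>x. if i = k then w x / \<sigma> else T x i)"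
        using that k by (intro E_cong RT) auto
      then show ?thesis using that w_mean mean by (auto simp: less_Suc_eq)
    qed
    show "?E (\<lambda>x. (R \<circ> T) x i * (R \<circ> T) x j) = of_bool (i = j)" if "i < Suc k" "j < Suc k" for i j
    proof -
      have "?E (\<lambda>x. (R \<circ> T) x i * (R \<circ> T) x j)
          = ?E (\<lambda>x. (if i = k then w x / \<sigma> else T x i) * (if j = k then w x / \<sigma> else T x j))"
        using that k by (intro E_cong arg_cong2[where f = "(*)"] RT) auto
      moreover have "?E (\<lambda>x. w x / \<sigma> * (w x / \<sigma>)) = 1"
        using \<open>?E (\<lambda>x. (w x)\<^sup>2) > 0\<close> by (simp add: power2_eq_square[symmetric] power_divide \<sigma>(2))
      moreover have "?E (\<lambda>x. w x / \<sigma> * T x l) = 0" "?E (\<lambda>x. T x l * (w x / \<sigma>)) = 0" if "l < k" for l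
        using w_T[OF that] by (simp_all add: mult.commute[of _ "w _"])
      ultimately show ?thesis using that cov by (auto simp: less_Suc_eq)
    qed
  qed
qed

section \<open>From whitened coordinates to isotropic position\<close>

lemma integral_quadratic:
  assumes K: "convex_body n K" and f: "\<And>i. i < n \<Longrightarrow> bounded_meas n K (f i)"
  shows "(\<integral>x. (\<Sum>i<n. f i x * y i)\<^sup>2 \<partial>unif n K)
       = (\<Sum>i<n. \<Sum>j<n. y i * y j * (\<integral>x. f i x * f j x \<partial>unif n K))"
proof -
  have i: "integrable (unif n K) (\<lambda>x. y i * y j * (f i x * f j x))" if "i < n" "j < n" for i j
    by (intro integrable_unif[OF K] bounded_meas_mult bounded_meas_const f that)
  have "(\<integral>x. (\<Sum>i<n. f i x * y i)\<^sup>2 \<partial>unif n K)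
      = (\<integral>x. (\<Sum>i<n. \<Sum>j<n. y i * y j * (f i x * f j x)) \<partial>unif n K)"
    by (intro Bochner_Integration.integral_cong)
      (auto simp: power2_eq_square sum_product algebra_simps)
  also have "\<dots> = (\<Sum>i<n. \<integral>x. (\<Sum>j<n. y i * y j * (f i x * f j x)) \<partial>unif n K)"
    by (intro Bochner_Integration.integral_sum Bochner_Integration.integrable_sum i) auto
  also have "\<dots> = (\<Sum>i<n. \<Sum>j<n. \<integral>x. y i * y j * (f i x * f j x) \<partial>unif n K)"
    by (intro sum.cong refl Bochner_Integration.integral_sum i) auto
  finally show ?thesis by simp
qed

definition second_moment :: "nat \<Rightarrow> (nat \<Rightarrow> real) set \<Rightarrow> real" where
  "second_moment n K = (\<integral>x. (norm_n n x)\<^sup>2 \<partial>unif n K)"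

lemma norm_n_power2: "(norm_n n x)\<^sup>2 = (\<Sum>i<n. (x i)\<^sup>2)"
  by (simp add: norm_n_def inner_n_def sum_nonneg power2_eq_square)

lemma norm_n_nonneg: "norm_n n x \<ge> 0"
  by (simp add: norm_n_def inner_n_def sum_nonneg)

lemma second_moment_eq_sum:
  assumes K: "convex_body n K"
  shows "second_moment n K = (\<Sum>i<n. \<integral>x. (x i)\<^sup>2 \<partial>unif n K)"
  unfolding second_moment_def norm_n_power2
  by (intro Bochner_Integration.integral_sum integrable_unif[OF K] bounded_meas_power
      bounded_meas_coord[OF K]) auto

lemma prod_le_mean_power:
  fixes x :: "nat \<Rightarrow> real"
  assumes "n \<ge> 1" "\<And>i. i < n \<Longrightarrow> x i \<ge> 0"
  shows "(\<Prod>i<n. x i) \<le> ((\<Sum>i<n. x i) / n) ^ n"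
proof -
  have nonneg: "(\<Prod>i<n. x i) \<ge> 0" using assms(2) by (intro prod_nonneg) auto
  have "(\<Prod>i<n. x i) powr (1 / n) \<le> (\<Sum>i<n. x i) / n"
    using arith_geom_mean[of "{..<n}" x] assms by (simp add: sum_divide_distrib lessThan_empty_iff)
  then have "((\<Prod>i<n. x i) powr (1 / n)) ^ n \<le> ((\<Sum>i<n. x i) / n) ^ n"
    by (intro power_mono) auto
  also have "((\<Prod>i<n. x i) powr (1 / n)) ^ n = (\<Prod>i<n. x i)"
  proof (cases "(\<Prod>i<n. x i) = 0")
    case False
    then show ?thesis using nonneg assms(1)
      by (simp add: powr_realpow[symmetric] powr_powr)
  next
    case True
    then show ?thesis using assms(1) unfolding True by (simp add: zero_power)
  qed
  finally show ?thesis .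
qed

text \<open>In matrix terms the product of the \<open>(s i)^2\<close> is the determinant of the
  covariance matrix. It is bounded, as in Hadamard's inequality, by the product of the coordinate
  second moments, and then by a power of their mean. The bound is left in \<open>n\<close>-th
  powers, since the volume of \<open>K\<close> is a power as well in the application.\<close>

lemma isotropic_position:
  assumes K: "convex_body n K" and n: "n \<ge> 1"
  shows "\<exists>T L. invertible_affine n T \<and> isotropic_with n (T ` K) L \<and>
           L ^ n * vol n K \<le> sqrt (second_moment n K / n) ^ n"
proof -
  let ?E = "\<lambda>f. \<integral>x. f x \<partial>unif n K"
  obtain T s where "whitens_upto n K n T s" using gram_schmidt_body[OF K order_refl] by blast
  then have T: "invertible_affine n T"
    and s: "\<And>i. i < n \<Longrightarrow> s i > 0" "\<And>i. i < n \<Longrightarrow> (s i)\<^sup>2 \<le> ?E (\<lambda>x. (x i)\<^sup>2)"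
    and jac: "jacobian n T * (\<Prod>i<n. s i) = 1"
    and mean: "\<And>i. i < n \<Longrightarrow> ?E (\<lambda>x. T x i) = 0"
    and cov: "\<And>i j. i < n \<Longrightarrow> j < n \<Longrightarrow> ?E (\<lambda>x. T x i * T x j) = of_bool (i = j)"
    unfolding whitens_upto_def by blast+
  have volK: "vol n K > 0" by (rule convex_body_emeasure[OF K])
  define V where "V = jacobian n T * vol n K"
  have V: "V > 0" using affine_image_jacobian(1)[OF T] volK by (simp add: V_def)
  \<comment> \<open>The homothety by \<open>r\<close> brings the volume to 1. The whitened
    covariance is the identity, so afterwards it is \<open>r^2\<close> times the identity and
    \<open>r\<close> is the isotropic constant.\<close>
  define r where "r = 1 / root n V"
  have r: "r > 0" using V n by (simp add: r_def)
  have r_pow: "r ^ n * V = 1" using V n by (simp add: r_def power_divide real_root_pow_pos)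
  define S where "S = scale n r (\<lambda>_. 0) \<circ> T"
  have S: "invertible_affine n S" unfolding S_def
    using r by (intro invertible_affine_comp invertible_scale T) simp
  have affS: "affine_n n S" using S by (simp add: invertible_affine_iff)
  have SK: "convex_body n (S ` K)" by (rule convex_body_affine_image[OF K S])
  have jS: "jacobian n S = r ^ n * jacobian n T" unfolding S_def
    using r by (subst jacobian_comp) (auto intro: invertible_scale T simp: jacobian_scale)
  have volSK: "vol n (S ` K) = 1"
    using vol_affine_image[OF S convex_body_sets[OF K]] r_pow by (simp add: jS V_def mult.assoc)
  have Sx: "S x i = r * T x i" if "i < n" for x i using that by (simp add: S_def scale_def)
  have int_SK: "(LINT x:S ` K|lborel_n n. f x) = ?E (\<lambda>x. f (S x))"
    if f: "f \<in> borel_measurable (lborel_n n)" for f :: "(nat \<Rightarrow> real) \<Rightarrow> real"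
  proof -
    have "(LINT x:S ` K|lborel_n n. f x) = (\<integral>x. f x \<partial>distr (unif n K) (lborel_n n) S)"
      using integral_unif[OF SK f] by (simp add: volSK distr_unif[OF K S])
    also have "\<dots> = ?E (\<lambda>x. f (S x))"
      using affine_n_measurable[OF affS] f by (intro integral_distr) (auto cong: measurable_cong_sets)
    finally show ?thesis .
  qed
  have "isotropic_with n (S ` K) r"
    unfolding isotropic_with_def
  proof (intro conjI ballI SK volSK r)
    show "centroid n (S ` K) = (\<lambda>i\<in>{..<n}. 0)"
      using mean by (auto simp: centroid_def volSK int_SK Sx fun_eq_iff)
    fix y assume "y \<in> Rn n"
    have "(LINT x:S ` K|lborel_n n. (inner_n n x y)\<^sup>2) = ?E (\<lambda>x. (inner_n n (S x) y)\<^sup>2)"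
      unfolding inner_n_def
      by (intro int_SK borel_measurable_power borel_measurable_sum borel_measurable_times) auto
    also have "\<dots> = (\<Sum>i<n. \<Sum>j<n. y i * y j * ?E (\<lambda>x. S x i * S x j))"
      unfolding inner_n_def by (intro integral_quadratic[OF K] bounded_meas_affine[OF K affS])
    also have "\<dots> = (\<Sum>i<n. \<Sum>j<n. if i = j then r\<^sup>2 * (y i)\<^sup>2 else 0)"
    proof (intro sum.cong refl)
      fix i j assume ij: "i \<in> {..<n}" "j \<in> {..<n}"
      have "?E (\<lambda>x. S x i * S x j) = ?E (\<lambda>x. r\<^sup>2 * (T x i * T x j))"
        using ij by (intro Bochner_Integration.integral_cong) (auto simp: Sx power2_eq_square)
      then show "y i * y j * ?E (\<lambda>x. S x i * S x j) = (if i = j then r\<^sup>2 * (y i)\<^sup>2 else 0)"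
        using cov[of i j] ij by (auto simp: power2_eq_square)
    qed
    also have "\<dots> = r\<^sup>2 * (norm_n n y)\<^sup>2"
      by (simp add: norm_n_power2 sum_distrib_left)
    finally show "(LINT x:S ` K|lborel_n n. (inner_n n x y)\<^sup>2) = r\<^sup>2 * (norm_n n y)\<^sup>2" .
  qed
  moreover have "r ^ n * vol n K \<le> sqrt (second_moment n K / n) ^ n"
  proof -
    have "r ^ n * vol n K = (\<Prod>i<n. s i)"
    proof -
      have "(\<Prod>i<n. s i) = (\<Prod>i<n. s i) * (r ^ n * V)" by (simp add: r_pow)
      also have "\<dots> = (jacobian n T * (\<Prod>i<n. s i)) * (r ^ n * vol n K)" by (simp add: V_def)
      finally show ?thesis by (simp add: jac)
    qed
    moreover have "(\<Prod>i<n. s i) \<le> sqrt (second_moment n K / n) ^ n"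
    proof (rule power2_le_imp_le)
      have "(\<Prod>i<n. s i)\<^sup>2 = (\<Prod>i<n. (s i)\<^sup>2)" by (simp add: prod_power_distrib)
      also have "\<dots> \<le> (\<Prod>i<n. ?E (\<lambda>x. (x i)\<^sup>2))" using s by (intro prod_mono) auto
      also have "\<dots> \<le> ((\<Sum>i<n. ?E (\<lambda>x. (x i)\<^sup>2)) / n) ^ n"
        by (intro prod_le_mean_power n Bochner_Integration.integral_nonneg) simp
      also have "\<dots> = (second_moment n K / n) ^ n" by (simp add: second_moment_eq_sum[OF K])
      also have "\<dots> = (sqrt (second_moment n K / n) ^ n)\<^sup>2"
        by (simp add: power_even_eq[symmetric] power_mult[symmetric] mult.commute[of n] power_mult
            second_moment_def)
      finally show "(\<Prod>i<n. s i)\<^sup>2 \<le> (sqrt (second_moment n K / n) ^ n)\<^sup>2" .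
    qed (simp add: second_moment_def)
    ultimately show ?thesis by simp
  qed
  ultimately show ?thesis using S by blast
qed

subsection \<open>Uniqueness of the isotropic constant\<close>

lemma inner_n_Cauchy_Schwarz: "inner_n n x y \<le> norm_n n x * norm_n n y"
proof -
  have "\<bar>\<Sum>i<n. x i * y i\<bar> \<le> (\<Sum>i<n. \<bar>x i\<bar> * \<bar>y i\<bar>)" by (simp add: order_trans[OF sum_abs] abs_mult)
  also have "\<dots> \<le> L2_set x {..<n} * L2_set y {..<n}" by (rule L2_set_mult_ineq)
  finally show ?thesis by (simp add: inner_n_def norm_n_def L2_set_def power2_eq_square)
qed

lemma norm_n_measurable [measurable]: "norm_n n \<in> borel_measurable (lborel_n n)"
proof -
  have "(\<lambda>x. \<Sum>i<n. x i * x i) \<in> borel_measurable (lborel_n n)"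
    by (intro borel_measurable_sum borel_measurable_times coord_measurable) auto
  then show ?thesis unfolding norm_n_def[abs_def] inner_n_def by measurable
qed

lemma abs_coord_le_norm_n: "i < n \<Longrightarrow> \<bar>x i\<bar> \<le> norm_n n x"
proof -
  assume "i < n"
  then have "(x i)\<^sup>2 \<le> (norm_n n x)\<^sup>2" unfolding norm_n_power2
    by (intro member_le_sum) auto
  then show ?thesis by (rule abs_le_square_iff[THEN iffD2, THEN order_trans]) (simp add: norm_n_nonneg)
qed

definition ball_n :: "nat \<Rightarrow> real \<Rightarrow> (nat \<Rightarrow> real) set" where
  "ball_n n r = {x \<in> Rn n. norm_n n x \<le> r}"

lemma sets_ball_n: "ball_n n r \<in> sets (lborel_n n)"
proof -
  have "{x \<in> space (lborel_n n). norm_n n x \<le> r} \<in> sets (lborel_n n)" by measurable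
  then show ?thesis by (simp add: ball_n_def)
qed

lemma vol_ball_n_1_pos: "vol n (ball_n n 1) > 0"
proof -
  have fin: "emeasure (lborel_n n) (ball_n n 1) < \<infinity>"
    by (rule emeasure_bounded_finite[of _ _ 1])
      (auto simp: ball_n_def intro: order_trans[OF abs_coord_le_norm_n])
  \<comment> \<open>Coordinates in \<open>{0..1}\<close> satisfy \<open>t^2 \<le> t\<close>, so
    sides of length \<open>1 / (n + 1)\<close> keep the sum of squares at most
    \<open>n / (n + 1)\<close>.\<close>
  let ?C = "PiE {..<n} (\<lambda>_. {0..1 / (n + 1)}) :: (nat \<Rightarrow> real) set"
  have "?C \<subseteq> ball_n n 1"
  proof
    fix x assume x: "x \<in> ?C"
    have x': "0 \<le> x i" "x i \<le> 1 / (n + 1)" if "i < n" for i using PiE_mem[OF x] that by auto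
    have "(norm_n n x)\<^sup>2 \<le> (\<Sum>i<n. 1 / (n + 1))"
      unfolding norm_n_power2
    proof (rule sum_mono)
      fix i assume "i \<in> {..<n}"
      then have "(x i)\<^sup>2 \<le> x i * 1" unfolding power2_eq_square using x'[of i]
        by (intro mult_left_mono) (auto intro: order_trans)
      then show "(x i)\<^sup>2 \<le> 1 / (n + 1)" using x'[of i] \<open>i \<in> _\<close> by simp
    qed
    also have "\<dots> \<le> 1" by simp
    finally have "(norm_n n x)\<^sup>2 \<le> 1\<^sup>2" by simp
    then have "norm_n n x \<le> 1" by (rule power2_le_imp_le) simp
    then show "x \<in> ball_n n 1" using x by (simp add: ball_n_def PiE_iff)
  qed
  then have "emeasure (lborel_n n) ?C \<le> emeasure (lborel_n n) (ball_n n 1)"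
    by (rule emeasure_mono) (rule sets_ball_n)
  moreover have "emeasure (lborel_n n) ?C = ennreal ((1 / (n + 1)) ^ n)"
    by (subst emeasure_box) (auto simp: ennreal_power)
  moreover have "ennreal ((1 / (n + 1)) ^ n) > 0" by simp
  ultimately have "emeasure (lborel_n n) (ball_n n 1) > 0" by (metis less_le_trans)
  then show ?thesis using fin by (simp add: measure_def enn2real_positive_iff less_top)
qed

lemma isotropic_withD:
  assumes "isotropic_with n K L"
  shows "convex_body n K" "vol n K = 1" "L > 0"
    "i < n \<Longrightarrow> (\<integral>x. x i \<partial>unif n K) = 0"
    "y \<in> Rn n \<Longrightarrow> (\<integral>x. (inner_n n x y)\<^sup>2 \<partial>unif n K) = L\<^sup>2 * (norm_n n y)\<^sup>2"
    "i < n \<Longrightarrow> (\<integral>x. (x i)\<^sup>2 \<partial>unif n K) = L\<^sup>2"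
proof -
  show K: "convex_body n K" and V: "vol n K = 1" and "L > 0"
    using assms by (simp_all add: isotropic_with_def)
  show "(\<integral>x. x i \<partial>unif n K) = 0" if "i < n"
  proof -
    have "centroid n K i = 0" using assms that by (simp add: isotropic_with_def)
    then show ?thesis using that V by (simp add: centroid_def integral_unif[OF K])
  qed
  have *: "(\<integral>x. (inner_n n x y)\<^sup>2 \<partial>unif n K) = L\<^sup>2 * (norm_n n y)\<^sup>2" if "y \<in> Rn n" for y
  proof -
    have "(\<lambda>x. (inner_n n x y)\<^sup>2) \<in> borel_measurable (lborel_n n)" unfolding inner_n_def
      by (intro borel_measurable_power borel_measurable_sum borel_measurable_times) auto
    then show ?thesis using assms that by (simp add: isotropic_with_def integral_unif[OF K])
  qed
  show "(\<integral>x. (inner_n n x y)\<^sup>2 \<partial>unif n K) = L\<^sup>2 * (norm_n n y)\<^sup>2" if "y \<in> Rn n" by (rule *[OF that])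
  show "(\<integral>x. (x i)\<^sup>2 \<partial>unif n K) = L\<^sup>2" if i: "i < n"
  proof -
    let ?e = "\<lambda>j\<in>{..<n}. if j = i then 1 else (0::real)"
    have "inner_n n x ?e = x i" for x
      using i by (simp add: inner_n_def if_distrib[of "\<lambda>t. _ * t"] cong: if_cong)
    moreover have "(norm_n n ?e)\<^sup>2 = 1"
      using i by (simp add: norm_n_power2 if_distrib[of "\<lambda>t. t ^ 2"] cong: if_cong)
    ultimately show ?thesis using *[of ?e] by simp
  qed
qed

text \<open>
  The transpose of the linear part \<open>A\<close> of \<open>S\<close> multiplies all norms by \<open>L\<^sub>2 / L\<^sub>1\<close>. By duality
  \<open>A\<close> expands norms by at most this factor, but it preserves volume.
\<close>

lemma isotropic_with_le:
  assumes n: "n \<ge> 1" and K: "isotropic_with n K L1" and SK: "isotropic_with n (S ` K) L2"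
    and S: "invertible_affine n S"
  shows "L1 \<le> L2"
proof -
  note K' = isotropic_withD[OF K] and SK' = isotropic_withD[OF SK]
  interpret prob_space "unif n K" by (rule prob_space_unif[OF K'(1)])
  obtain A b where A: "\<And>x. x \<in> Rn n \<Longrightarrow> S x = (\<lambda>i\<in>{..<n}. (\<Sum>j<n. A i j * x j) + b i)"
    using S unfolding invertible_affine_def by blast
  have affS: "affine_n n S" using S by (simp add: invertible_affine_iff)
  have S_m: "S \<in> measurable (unif n K) (lborel_n n)"
    using affine_n_measurable[OF affS] by (simp cong: measurable_cong_sets)
  have int_S: "(\<integral>x. f x \<partial>unif n (S ` K)) = (\<integral>x. f (S x) \<partial>unif n K)"
    if f: "f \<in> borel_measurable (lborel_n n)" for f :: "_ \<Rightarrow> real"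
    unfolding distr_unif[OF K'(1) S, symmetric] using S_m f by (rule integral_distr)
  \<comment> \<open>Both centroids lie at the origin, so the translation part disappears.\<close>
  have b: "b i = 0" if i: "i < n" for i
  proof -
    have int: "integrable (unif n K) (\<lambda>x. A i j * x j)" if "j < n" for j
      by (intro integrable_unif K' bounded_meas_mult bounded_meas_const bounded_meas_coord that)
    have "0 = (\<integral>x. S x i \<partial>unif n K)"
      using SK'(4)[OF i] int_S[OF coord_measurable[OF i]] by simp
    also have "\<dots> = (\<integral>x. (\<Sum>j<n. A i j * x j) + b i \<partial>unif n K)"
      using i by (intro Bochner_Integration.integral_cong) (auto simp: A)
    also have "\<dots> = (\<integral>x. (\<Sum>j<n. A i j * x j) \<partial>unif n K) + (\<integral>x. b i \<partial>unif n K)"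
      by (intro Bochner_Integration.integral_add Bochner_Integration.integrable_sum int) auto
    also have "(\<integral>x. (\<Sum>j<n. A i j * x j) \<partial>unif n K) = (\<Sum>j<n. \<integral>x. A i j * x j \<partial>unif n K)"
      by (intro Bochner_Integration.integral_sum int) auto
    also have "\<dots> = 0" using K'(4) by simp
    also have "(\<integral>x. b i \<partial>unif n K) = b i" using prob_space by simp
    finally show ?thesis by simp
  qed
  define At where "At y = (\<lambda>j\<in>{..<n}. \<Sum>i<n. A i j * y i)" for y :: "nat \<Rightarrow> real"
  have dual: "inner_n n (S x) y = inner_n n x (At y)" if "x \<in> Rn n" for x y
  proof -
    have "inner_n n (S x) y = (\<Sum>i<n. \<Sum>j<n. A i j * x j * y i)"
      using that b by (simp add: inner_n_def A sum_distrib_right)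
    also have "\<dots> = (\<Sum>j<n. \<Sum>i<n. A i j * x j * y i)" by (rule sum.swap)
    also have "\<dots> = inner_n n x (At y)"
      by (simp add: inner_n_def At_def sum_distrib_left mult.commute mult.left_commute)
    finally show ?thesis .
  qed
  have At_norm: "L1 * norm_n n (At y) = L2 * norm_n n y" if y: "y \<in> Rn n" for y
  proof -
    have m: "(\<lambda>x. (inner_n n x y)\<^sup>2) \<in> borel_measurable (lborel_n n)" unfolding inner_n_def
      by (intro borel_measurable_power borel_measurable_sum borel_measurable_times) auto
    have "L2\<^sup>2 * (norm_n n y)\<^sup>2 = (\<integral>x. (inner_n n (S x) y)\<^sup>2 \<partial>unif n K)"
      using SK'(5)[OF y] int_S[OF m] by simp
    also have "\<dots> = (\<integral>x. (inner_n n x (At y))\<^sup>2 \<partial>unif n K)"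
      by (intro Bochner_Integration.integral_cong) (auto simp: dual)
    also have "\<dots> = L1\<^sup>2 * (norm_n n (At y))\<^sup>2"
      by (rule K'(5)) (simp add: At_def)
    finally have "(L1 * norm_n n (At y))\<^sup>2 = (L2 * norm_n n y)\<^sup>2" by (simp add: power_mult_distrib)
    then show ?thesis
      by (rule power2_eq_imp_eq) (use K'(3) SK'(3) in \<open>auto simp: norm_n_nonneg\<close>)
  qed
  define c where "c = L2 / L1"
  have c: "c > 0" using K'(3) SK'(3) by (simp add: c_def)
  \<comment> \<open>The adjoint relation is tested with \<open>y = S x\<close>: Cauchy--Schwarz
    bounds the square of the norm of \<open>S x\<close> by \<open>c\<close> times the product of the
    norms of \<open>x\<close> and \<open>S x\<close>.\<close>
  have S_norm: "norm_n n (S x) \<le> c * norm_n n x" if x: "x \<in> Rn n" for x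
  proof (cases "norm_n n (S x) = 0")
    case False
    have "norm_n n (S x) * norm_n n (S x) = inner_n n (S x) (S x)"
      by (simp add: norm_n_def inner_n_def sum_nonneg)
    also have "\<dots> \<le> norm_n n x * norm_n n (At (S x))"
      unfolding dual[OF x] by (rule inner_n_Cauchy_Schwarz)
    also have "norm_n n (At (S x)) = c * norm_n n (S x)"
      using At_norm[OF affine_n_into[OF affS x]] K'(3) by (simp add: c_def field_simps)
    finally show ?thesis using False norm_n_nonneg[of n "S x"]
      by (simp add: mult.left_commute mult.commute[of _ c] mult_le_cancel_right mult.assoc[symmetric])
  qed (use c in \<open>simp add: norm_n_nonneg\<close>)
  have jS: "jacobian n S = 1"
    using vol_affine_image[OF S convex_body_sets[OF K'(1)]] K'(2) SK'(2) by simp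
  \<comment> \<open>The unit ball is mapped into the ball of radius \<open>c\<close>. Since
    \<open>S\<close> has Jacobian 1, comparing volumes gives \<open>1 \<le> c ^ n\<close>, and
    \<open>n \<ge> 1\<close> allows the root.\<close>
  let ?D = "scale n c (\<lambda>_. 0)"
  have D: "invertible_affine n ?D" using c by (intro invertible_scale) simp
  have "S ` ball_n n 1 \<subseteq> ?D ` ball_n n 1"
  proof
    fix y assume "y \<in> S ` ball_n n 1"
    then obtain x where x: "x \<in> Rn n" "norm_n n x \<le> 1" "y = S x" by (auto simp: ball_n_def)
    define z where "z = (\<lambda>i\<in>{..<n}. y i / c)"
    have "norm_n n z = norm_n n y / c"
    proof -
      have "(\<Sum>i<n. z i * z i) = (\<Sum>i<n. y i * y i) / (c * c)"
        unfolding sum_divide_distrib by (intro sum.cong) (auto simp: z_def)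
      then show ?thesis using c by (simp add: norm_n_def inner_n_def real_sqrt_divide)
    qed
    also have "\<dots> \<le> 1" using S_norm[OF x(1)] x(2,3) c
      by (simp add: divide_le_eq) (metis mult.commute mult_left_le order_trans less_imp_le)
    finally have "z \<in> ball_n n 1" by (simp add: ball_n_def z_def)
    moreover have "?D z = y" using c x affine_n_into[OF affS x(1)]
      by (intro Rn_eqI[of _ n]) (simp_all add: scale_def z_def)
    ultimately show "y \<in> ?D ` ball_n n 1" by blast
  qed
  then have "vol n (S ` ball_n n 1) \<le> vol n (?D ` ball_n n 1)"
  proof (rule measure_mono_fmeasurable)
    have "emeasure (lborel_n n) (ball_n n 1) < \<infinity>"
      by (rule emeasure_bounded_finite[of _ _ 1])
        (auto simp: ball_n_def intro: order_trans[OF abs_coord_le_norm_n])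
    then show "?D ` ball_n n 1 \<in> fmeasurable (lborel_n n)"
      using sets_affine_image[OF D sets_ball_n] affine_image_jacobian(2)[OF D sets_ball_n]
      by (intro fmeasurableI) (auto simp: ennreal_mult_less_top)
  qed (rule sets_affine_image[OF S sets_ball_n])
  then have "vol n (ball_n n 1) * 1 \<le> vol n (ball_n n 1) * c ^ n"
    unfolding vol_affine_image[OF S sets_ball_n] vol_affine_image[OF D sets_ball_n]
    using c by (simp add: jS jacobian_scale mult.commute)
  then have "1 ^ n \<le> c ^ n"
    using vol_ball_n_1_pos[of n] by (simp only: mult_le_cancel_left_pos power_one)
  then have "1 \<le> c" using n c by (subst (asm) power_mono_iff) auto
  then show ?thesis using K'(3) by (simp add: c_def)
qed

text \<open>The one-sided comparison is applied to the transition map between the two positions and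
  to the transition map in the opposite direction.\<close>

lemma isotropic_with_unique:
  assumes n: "n \<ge> 1" and T1: "invertible_affine n T1" "isotropic_with n (T1 ` K) L1"
    and T2: "invertible_affine n T2" "isotropic_with n (T2 ` K) L2" and K: "K \<subseteq> Rn n"
  shows "L1 = L2"
proof -
  have le: "L1 \<le> L2" if "invertible_affine n T1" "isotropic_with n (T1 ` K) L1"
    "invertible_affine n T2" "isotropic_with n (T2 ` K) L2" for T1 T2 L1 L2
  proof (rule isotropic_with_le[OF n that(2)])
    show "invertible_affine n (T2 \<circ> inv_n n T1)"
      by (intro invertible_affine_comp invertible_affine_inv that)
    have "inv_n n T1 (T1 x) = x" if "x \<in> K" for x
      using inv_n_simps(2)[OF \<open>invertible_affine n T1\<close>] K that by blast
    then have "(T2 \<circ> inv_n n T1) ` T1 ` K = T2 ` K" by (simp add: image_image cong: image_cong)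
    then show "isotropic_with n ((T2 \<circ> inv_n n T1) ` T1 ` K) L2" using that(4) by simp
  qed
  show ?thesis using le[OF T1 T2] le[OF T2 T1] by simp
qed

lemma isotropic_constant_eq:
  assumes "n \<ge> 1" "convex_body n K" "invertible_affine n T" "isotropic_with n (T ` K) L"
  shows "isotropic_constant n K = L"
  unfolding isotropic_constant_def
  using assms isotropic_with_unique[OF assms(1) _ _ assms(3,4) convex_body_subset[OF assms(2)]]
  by (intro the_equality) blast+

text \<open>An isotropic position of an affine image of \<open>K\<close> is also one of
  \<open>K\<close>. Hence the second moment may be taken over whichever image lies inside
  \<open>B\<close>.\<close>

lemma isotropic_constant_le:
  assumes n: "n \<ge> 1" and K: "convex_body n K" and T: "invertible_affine n T"
  shows "isotropic_constant n K > 0"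
    "isotropic_constant n K ^ n * vol n (T ` K) \<le> sqrt (second_moment n (T ` K) / n) ^ n"
proof -
  obtain S L where S: "invertible_affine n S" "isotropic_with n (S ` T ` K) L"
    and L: "L ^ n * vol n (T ` K) \<le> sqrt (second_moment n (T ` K) / n) ^ n"
    using isotropic_position[OF convex_body_affine_image[OF K T] n] by blast
  have "isotropic_constant n K = L"
    using S by (intro isotropic_constant_eq[OF n K invertible_affine_comp[OF S(1) T]])
      (simp add: image_image)
  then show "isotropic_constant n K > 0"
    "isotropic_constant n K ^ n * vol n (T ` K) \<le> sqrt (second_moment n (T ` K) / n) ^ n"
    using L isotropic_withD(3)[OF S(2)] by simp_all
qed

subsection \<open>Consequences of the transport inequality\<close>

lemma (in sigma_finite_measure) entropy_density_density_AE:
  assumes f [measurable]: "f \<in> borel_measurable M" and nn: "\<And>x. 0 \<le> f x"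
  shows "AE x in M. f x * entropy_density (exp 1) M (density M (\<lambda>x. ennreal (f x))) x = f x * ln (f x)"
proof -
  have "density M (RN_deriv M (density M f)) = density M f"
    by (intro density_RN_deriv_density) auto
  then have "AE x in M. RN_deriv M (density M f) x = f x"
    by (intro density_unique) auto
  then show ?thesis
    using nn by (auto simp: entropy_density_def log_def)
qed

lemma (in sigma_finite_measure) integrable_entropy_density_iff:
  assumes f [measurable]: "f \<in> borel_measurable M" and nn: "\<And>x. 0 \<le> f x"
  shows "integrable (density M f) (entropy_density (exp 1) M (density M f))
     \<longleftrightarrow> integrable M (\<lambda>x. f x * ln (f x))"
proof -
  have [measurable]: "entropy_density (exp 1) M (density M (\<lambda>x. ennreal (f x))) \<in> borel_measurable M"
    by (rule measurable_entropy_density)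
  have "integrable (density M f) (entropy_density (exp 1) M (density M f))
    \<longleftrightarrow> integrable M (\<lambda>x. f x * entropy_density (exp 1) M (density M f) x)"
    using nn by (subst integrable_density) auto
  also have "\<dots> \<longleftrightarrow> integrable M (\<lambda>x. f x * ln (f x))"
    by (rule integrable_cong_AE) (use entropy_density_density_AE[OF assms] in auto)
  finally show ?thesis .
qed

text \<open>\<open>rel_entropy\<close> tests integrability of the log-density under the new measure;
  a change of measure turns this into integrability of \<open>f * ln f\<close> under
  \<open>M\<close>. The infinite case is kept, so finiteness of the entropy can be converted back
  into integrability.\<close>

lemma (in sigma_finite_measure) rel_entropy_density:
  assumes f: "f \<in> borel_measurable M" and nn: "\<And>x. 0 \<le> f x"
  shows "rel_entropy (density M f) M =
    (if integrable M (\<lambda>x. f x * ln (f x)) then ereal (\<integral>x. f x * ln (f x) \<partial>M) else \<infinity>)"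
proof -
  have "KL_divergence (exp 1) M (density M f) = (\<integral>x. f x * log (exp 1) (f x) \<partial>M)"
    using assms by (intro KL_density) auto
  then show ?thesis
    unfolding rel_entropy_def integrable_entropy_density_iff[OF assms] by (simp add: log_def)
qed

section \<open>Lipschitz test functions and weighted measures\<close>

lemma dist_n_measurable:
  "(\<lambda>z. dist_n n (fst z) (snd z)) \<in> borel_measurable (lborel_n n \<Otimes>\<^sub>M lborel_n n)"
proof -
  have "(\<lambda>z. \<Sum>i<n. (fst z i - snd z i) * (fst z i - snd z i)) \<in> borel_measurable (lborel_n n \<Otimes>\<^sub>M lborel_n n)"
    by (intro borel_measurable_sum borel_measurable_times borel_measurable_diff
        measurable_compose[OF measurable_fst coord_measurable]
        measurable_compose[OF measurable_snd coord_measurable]) auto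
  then show ?thesis unfolding dist_n_def norm_n_def inner_n_def by measurable
qed

text \<open>The easy half of Kantorovich duality: the Lipschitz inequality is integrated against an
  arbitrary coupling. Finiteness of the first integral makes the subtraction in
  \<open>ennreal\<close> legitimate.\<close>

lemma le_wasserstein1:
  assumes sets: "sets \<mu> = sets (lborel_n n)" "sets \<nu> = sets (lborel_n n)"
    and g [measurable]: "g \<in> borel_measurable (lborel_n n)" and nn: "\<And>x. g x \<ge> 0"
    and lip: "\<And>x y. x \<in> Rn n \<Longrightarrow> y \<in> Rn n \<Longrightarrow> g y \<le> g x + dist_n n x y"
    and fin: "(\<integral>\<^sup>+x. ennreal (g x) \<partial>\<mu>) < \<infinity>"
  shows "(\<integral>\<^sup>+x. ennreal (g x) \<partial>\<nu>) \<le> (\<integral>\<^sup>+x. ennreal (g x) \<partial>\<mu>) + wasserstein1 n \<mu> \<nu>"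
proof -
  have [measurable_cong]: "sets \<mu> = sets (lborel_n n)" "sets \<nu> = sets (lborel_n n)" by fact+
  have "(\<integral>\<^sup>+x. ennreal (g x) \<partial>\<nu>) - (\<integral>\<^sup>+x. ennreal (g x) \<partial>\<mu>) \<le> wasserstein1 n \<mu> \<nu>"
    unfolding wasserstein1_def
  proof (rule INF_greatest)
    fix \<pi> assume "\<pi> \<in> couplings \<mu> \<nu>"
    then have s_pi: "sets \<pi> = sets (\<mu> \<Otimes>\<^sub>M \<nu>)" and fst: "distr \<pi> \<mu> fst = \<mu>" and snd: "distr \<pi> \<nu> snd = \<nu>"
      by (auto simp: couplings_def)
    have [measurable_cong]: "sets \<pi> = sets (lborel_n n \<Otimes>\<^sub>M lborel_n n)"
      using s_pi sets by (simp cong: sets_pair_measure_cong)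
    have sp: "space \<pi> = Rn n \<times> Rn n"
      using sets_eq_imp_space_eq[OF \<open>sets \<pi> = sets (lborel_n n \<Otimes>\<^sub>M lborel_n n)\<close>]
      by (simp add: space_pair_measure)
    note dist_n_measurable [measurable]
    have "(\<integral>\<^sup>+x. ennreal (g x) \<partial>\<nu>) = (\<integral>\<^sup>+x. ennreal (g x) \<partial>distr \<pi> \<nu> snd)" by (simp add: snd)
    also have "\<dots> = (\<integral>\<^sup>+z. ennreal (g (snd z)) \<partial>\<pi>)"
      by (rule nn_integral_distr) measurable
    also have "\<dots> \<le> (\<integral>\<^sup>+z. ennreal (g (fst z)) + ennreal (dist_n n (fst z) (snd z)) \<partial>\<pi>)"
    proof (rule nn_integral_mono)
      fix z assume "z \<in> space \<pi>"
      then have "fst z \<in> Rn n" "snd z \<in> Rn n" unfolding sp by (metis mem_Times_iff)+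
      then have "g (snd z) \<le> g (fst z) + dist_n n (fst z) (snd z)" by (rule lip)
      then have "ennreal (g (snd z)) \<le> ennreal (g (fst z) + dist_n n (fst z) (snd z))" by (rule ennreal_leI)
      also have "\<dots> = ennreal (g (fst z)) + ennreal (dist_n n (fst z) (snd z))"
        by (rule ennreal_plus[OF nn]) (simp add: dist_n_def norm_n_nonneg)
      finally show "ennreal (g (snd z)) \<le> ennreal (g (fst z)) + ennreal (dist_n n (fst z) (snd z))" .
    qed
    also have "\<dots> = (\<integral>\<^sup>+z. ennreal (g (fst z)) \<partial>\<pi>) + (\<integral>\<^sup>+z. ennreal (dist_n n (fst z) (snd z)) \<partial>\<pi>)"
      by (rule nn_integral_add) measurable
    also have "(\<integral>\<^sup>+z. ennreal (g (fst z)) \<partial>\<pi>) = (\<integral>\<^sup>+x. ennreal (g x) \<partial>distr \<pi> \<mu> fst)"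
      by (rule nn_integral_distr[symmetric]) measurable
    finally show "(\<integral>\<^sup>+x. ennreal (g x) \<partial>\<nu>) - (\<integral>\<^sup>+x. ennreal (g x) \<partial>\<mu>)
        \<le> (\<integral>\<^sup>+z. ennreal (dist_n n (fst z) (snd z)) \<partial>\<pi>)"
      using fin by (auto simp: fst ennreal_minus_le_iff)
  qed
  then show ?thesis by (simp add: ennreal_minus_le_iff)
qed

text \<open>Crude bounds (the minimum is \<open>- 1 / e\<close>) which show that
  \<open>f * ln f\<close> is bounded on a body whenever \<open>f\<close> is.\<close>

lemma mult_ln_le_power2:
  assumes "(t::real) \<ge> 0" shows "t * ln t \<le> t\<^sup>2" "- 1 \<le> t * ln t"
proof -
  show "t * ln t \<le> t\<^sup>2"
    using assms ln_bound[of t] by (cases "t = 0") (auto simp: power2_eq_square intro!: mult_left_mono)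
  show "- 1 \<le> t * ln t"
  proof (cases "t = 0")
    case False
    then have "ln (1 / t) \<le> 1 / t" using assms by (intro ln_bound) simp
    then have "t * ln (1 / t) \<le> 1" using assms False by (simp add: field_simps)
    then show ?thesis using assms False by (simp add: ln_div)
  qed simp
qed

text \<open>The normalised weight is the density of a competitor in the transport inequality, and
  duality turns the distance into a change of the mean of \<open>g\<close>. With the entropy bounded
  by the logarithm of \<open>E f^2\<close>, the radical depends on \<open>W\<close> only through its
  first two moments.\<close>

lemma transport_weighted:
  assumes B: "convex_body n B" and \<tau>: "\<tau> > 0" "transport_ineq n (unif n B) \<tau>"
    and W: "bounded_meas n B W" "\<And>x. W x \<ge> 0" and EW: "(\<integral>x. W x \<partial>unif n B) > 0"
    and g: "bounded_meas n B g" "\<And>x. g x \<ge> 0"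
      "\<And>x y. x \<in> Rn n \<Longrightarrow> y \<in> Rn n \<Longrightarrow> g y \<le> g x + dist_n n x y"
  shows "(\<integral>x. g x * W x \<partial>unif n B) / (\<integral>x. W x \<partial>unif n B) \<le> (\<integral>x. g x \<partial>unif n B) +
     sqrt (2 / \<tau> * ln ((\<integral>x. (W x)\<^sup>2 \<partial>unif n B) / (\<integral>x. W x \<partial>unif n B)\<^sup>2))"
proof -
  let ?M = "unif n B"
  let ?E = "\<lambda>f. \<integral>x. f x \<partial>?M"
  interpret prob_space ?M by (rule prob_space_unif[OF B])
  note int = integrable_unif[OF B]
  define p where "p = ?E W"
  have p: "p > 0" using EW by (simp add: p_def)
  define f where "f x = W x / p" for x
  have f_nn: "f x \<ge> 0" for x using W(2) p by (simp add: f_def)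
  have bf: "bounded_meas n B f"
    using bounded_meas_mult[OF bounded_meas_const[of _ _ "1 / p"] W(1)] by (simp add: f_def[abs_def])
  have f_m: "f \<in> borel_measurable ?M" and g_m: "g \<in> borel_measurable (lborel_n n)"
    using bf g(1) by (simp_all add: bounded_meas_def cong: measurable_cong_sets)
  have Ef: "?E f = 1" using p by (simp add: f_def[abs_def] p_def)
  define \<nu> where "\<nu> = density ?M (\<lambda>x. ennreal (f x))"
  have \<nu>_int: "(\<integral>\<^sup>+x. ennreal (h x) \<partial>\<nu>) = ennreal (?E (\<lambda>x. f x * h x))"
    if h: "bounded_meas n B h" "\<And>x. h x \<ge> 0" for h
  proof -
    have "(\<integral>\<^sup>+x. ennreal (h x) \<partial>\<nu>) = (\<integral>\<^sup>+x. ennreal (f x) * ennreal (h x) \<partial>?M)"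
      unfolding \<nu>_def using f_m h(1) by (intro nn_integral_density) (auto simp: bounded_meas_def)
    also have "\<dots> = (\<integral>\<^sup>+x. ennreal (f x * h x) \<partial>?M)"
      using f_nn h(2) by (simp add: ennreal_mult)
    also have "\<dots> = ennreal (?E (\<lambda>x. f x * h x))"
      by (rule nn_integral_eq_integral[OF int[OF bounded_meas_mult[OF bf h(1)]]])
        (simp add: f_nn h(2))
    finally show ?thesis .
  qed
  have prob: "prob_space \<nu>"
    using \<nu>_int[OF bounded_meas_const[of n B 1]] Ef by (intro prob_spaceI) (simp add: nn_integral_const)
  have "bounded_meas n B (\<lambda>x. f x * ln (f x))"
  proof -
    obtain C where C: "\<forall>x\<in>B. \<bar>f x\<bar> \<le> C" using bf by (auto simp: bounded_meas_def)
    have "\<bar>f x * ln (f x)\<bar> \<le> C\<^sup>2 + 1" if "x \<in> B" for x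
    proof -
      have "(f x)\<^sup>2 \<le> C\<^sup>2" using C that f_nn[of x] by (intro power_mono) force+
      then show ?thesis using mult_ln_le_power2[OF f_nn[of x]] zero_le_power2[of C] by linarith
    qed
    then show ?thesis using f_m unfolding bounded_meas_def by auto
  qed
  then have int_ent: "integrable ?M (\<lambda>x. f x * ln (f x))" by (rule int)
  then have ent: "rel_entropy \<nu> ?M = ereal (?E (\<lambda>x. f x * ln (f x)))"
    unfolding \<nu>_def using rel_entropy_density[OF f_m f_nn] by simp
  define a where "a = ?E (\<lambda>x. (f x)\<^sup>2)"
  have int_f: "integrable ?M f" and int_f2: "integrable ?M (\<lambda>x. (f x)\<^sup>2)"
    by (intro int bounded_meas_power bf)+
  \<comment> \<open>The variance of \<open>f\<close> yields \<open>a \<ge> 1\<close>, which makes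
    \<open>ln a\<close> and the radicands below nonnegative.\<close>
  have "0 \<le> ?E (\<lambda>x. (f x - 1)\<^sup>2)" by (rule Bochner_Integration.integral_nonneg) simp
  also have "?E (\<lambda>x. (f x - 1)\<^sup>2) = ?E (\<lambda>x. (f x)\<^sup>2 - 2 * f x + 1)"
    by (simp add: power2_diff algebra_simps)
  also have "\<dots> = a - 2 + 1" using int_f int_f2 Ef prob_space by (simp add: a_def)
  finally have a: "a \<ge> 1" by simp
  \<comment> \<open>Jensen's inequality in explicit form: \<open>ln\<close> lies below its tangent
    at \<open>a\<close>. After weighting by \<open>f\<close>, the terms \<open>E f^2 / a\<close> and
    \<open>- E f\<close> cancel and leave \<open>ln a\<close>.\<close>
  have "?E (\<lambda>x. f x * ln (f x)) \<le> ?E (\<lambda>x. (1 / a) * (f x)\<^sup>2 - f x + ln a * f x)"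
  proof (rule integral_mono[OF int_ent])
    show "integrable ?M (\<lambda>x. (1 / a) * (f x)\<^sup>2 - f x + ln a * f x)" using int_f int_f2 by simp
    fix x
    show "f x * ln (f x) \<le> (1 / a) * (f x)\<^sup>2 - f x + ln a * f x"
    proof (cases "f x = 0")
      case False
      then have fx: "f x > 0" using f_nn[of x] by simp
      then have "ln (f x / a) \<le> f x / a - 1" using a by (intro ln_le_minus_one) simp
      then have "ln (f x) \<le> f x / a - 1 + ln a" using fx a by (simp add: ln_div)
      then have "f x * ln (f x) \<le> f x * (f x / a - 1 + ln a)" using fx by (intro mult_left_mono) auto
      then show ?thesis by (simp add: power2_eq_square algebra_simps)
    qed simp
  qed
  also have "\<dots> = ln a" using int_f int_f2 Ef a by (simp add: a_def[symmetric])
  finally have ent_le: "?E (\<lambda>x. f x * ln (f x)) \<le> ln a" .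
  have "sets \<nu> = sets ?M" "absolutely_continuous ?M \<nu>"
    unfolding \<nu>_def using f_m by (auto intro!: absolutely_continuousI_density)
  then have "wasserstein1 n ?M \<nu> \<le> ennreal (sqrt (2 / \<tau> * real_of_ereal (rel_entropy \<nu> ?M)))"
    using \<tau>(2)[unfolded transport_ineq_def, rule_format, of \<nu>] prob ent by simp
  also have "\<dots> \<le> ennreal (sqrt (2 / \<tau> * ln a))"
    using ent_le \<tau>(1) by (simp add: ent ennreal_leI divide_right_mono)
  finally have W1: "wasserstein1 n ?M \<nu> \<le> ennreal (sqrt (2 / \<tau> * ln a))" .
  have Eg: "(\<integral>\<^sup>+x. ennreal (g x) \<partial>?M) = ennreal (?E g)"
    by (rule nn_integral_eq_integral[OF int[OF g(1)]]) (simp add: g(2))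
  have "ennreal (?E (\<lambda>x. f x * g x)) = (\<integral>\<^sup>+x. ennreal (g x) \<partial>\<nu>)" by (rule \<nu>_int[OF g(1,2), symmetric])
  also have "\<dots> \<le> (\<integral>\<^sup>+x. ennreal (g x) \<partial>?M) + wasserstein1 n ?M \<nu>"
    by (rule le_wasserstein1) (auto simp: \<nu>_def g_m g Eg)
  also have "\<dots> \<le> ennreal (?E g) + ennreal (sqrt (2 / \<tau> * ln a))"
    unfolding Eg by (intro add_left_mono W1)
  also have "\<dots> = ennreal (?E g + sqrt (2 / \<tau> * ln a))"
    using a \<tau>(1) g(2) by (intro ennreal_plus[symmetric] Bochner_Integration.integral_nonneg) auto
  finally have "?E (\<lambda>x. f x * g x) \<le> ?E g + sqrt (2 / \<tau> * ln a)"
    using a \<tau>(1) g(2) by (subst (asm) ennreal_le_iff) (auto intro!: add_nonneg_nonneg)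
  moreover have "?E (\<lambda>x. f x * g x) = ?E (\<lambda>x. g x * W x) / p"
    by (simp add: f_def mult.commute)
  moreover have "a = ?E (\<lambda>x. (W x)\<^sup>2) / p\<^sup>2" by (simp add: a_def f_def power_divide)
  ultimately show ?thesis by (simp add: p_def)
qed

text \<open>The sign \<epsilon> selects a half-space through the centroid. The test function is the
  coordinate shifted by \<open>R\<close>; because the centroid is 0 the shift cancels, which leaves
  \<open>q / p \<le> sqrt (2 / \<tau> * ln t)\<close> with \<open>t = q / p^2\<close>. The square of
  the left side is \<open>q * t\<close>, and \<open>ln t \<le> t\<close> gives
  \<open>q \<le> 2 / \<tau>\<close>.\<close>

lemma second_moment_half_le:
  assumes B: "isotropic_with n B L" and n: "n \<ge> 1"
    and \<tau>: "\<tau> > 0" "transport_ineq n (unif n B) \<tau>" and \<epsilon>: "\<bar>\<epsilon>\<bar> = 1"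
  shows "(\<integral>x. (max 0 (\<epsilon> * x 0))\<^sup>2 \<partial>unif n B) \<le> 2 / \<tau>"
proof -
  let ?E = "\<lambda>f. \<integral>x. f x \<partial>unif n B"
  note B' = isotropic_withD[OF B]
  interpret prob_space "unif n B" by (rule prob_space_unif[OF B'(1)])
  note int = integrable_unif[OF B'(1)]
  obtain R where R: "\<forall>x\<in>B. \<forall>i<n. \<bar>x i\<bar> \<le> R" using convex_body_bounded[OF B'(1)] by blast
  have abs_le: "\<bar>\<epsilon> * x 0\<bar> \<le> R" if "x \<in> B" for x using R n that \<epsilon> by (simp add: abs_mult)
  define W where "W x = max 0 (\<epsilon> * x 0)" for x :: "nat \<Rightarrow> real"
  \<comment> \<open>On \<open>B\<close> this is the affine function
    \<open>\<epsilon> * x 0 + R\<close>, since \<open>R\<close> bounds the coordinates there. The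
    cut-off makes it nonnegative everywhere, as \<open>transport_weighted\<close> demands.\<close>
  define g where "g x = max 0 (\<epsilon> * x 0 + R)" for x :: "nat \<Rightarrow> real"
  have [measurable]: "(\<lambda>x. x 0) \<in> borel_measurable (lborel_n n)" using n by simp
  have bx: "bounded_meas n B (\<lambda>x. x 0)" using n by (intro bounded_meas_coord B') simp
  have bW: "bounded_meas n B W"
  proof -
    have "\<bar>W x\<bar> \<le> R" if "x \<in> B" for x using abs_le[OF that] by (simp add: W_def max_def abs_le_iff)
    then show ?thesis by (auto simp: bounded_meas_def W_def[abs_def])
  qed
  have bg: "bounded_meas n B g"
  proof -
    have "\<bar>g x\<bar> \<le> 2 * R" if "x \<in> B" for x using abs_le[OF that] by (simp add: g_def max_def abs_le_iff)
    moreover have "g \<in> borel_measurable (lborel_n n)" by (simp add: g_def[abs_def])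
    ultimately show ?thesis unfolding bounded_meas_def by blast
  qed
  have AE_eq: "?E h = ?E h'" if "\<And>x. x \<in> B \<Longrightarrow> h x = h' x" "bounded_meas n B h" "bounded_meas n B h'"
    for h h' :: "_ \<Rightarrow> real"
  proof (rule integral_cong_AE)
    show "AE x in unif n B. h x = h' x" using AE_unif_mem[OF B'(1)] by eventually_elim (rule that(1))
  qed (use that(2,3) in \<open>simp_all add: bounded_meas_def cong: measurable_cong_sets\<close>)
  define p q where "p = ?E W" and "q = ?E (\<lambda>x. (W x)\<^sup>2)"
  have pq: "p \<ge> 0" "q \<ge> 0" unfolding p_def q_def by (intro Bochner_Integration.integral_nonneg; simp add: W_def)+
  \<comment> \<open>Excludes \<open>p = 0\<close> once \<open>q > 0\<close>, so that the weight can
    be normalised.\<close>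
  have q_le: "q \<le> R * p"
  proof -
    have "q \<le> ?E (\<lambda>x. R * W x)" unfolding q_def
    proof (rule integral_mono_AE)
      show "AE x in unif n B. (W x)\<^sup>2 \<le> R * W x"
        using AE_unif_mem[OF B'(1)]
      proof eventually_elim
        case (elim x)
        then show ?case using abs_le[OF elim] unfolding power2_eq_square
          by (intro mult_right_mono) (auto simp: W_def abs_le_iff)
      qed
    qed (intro int bounded_meas_power bounded_meas_mult bounded_meas_const bW)+
    then show ?thesis by (simp add: p_def)
  qed
  show ?thesis
  proof (cases "q = 0")
    case True
    then show ?thesis using \<tau>(1) by (simp add: q_def W_def)
  next
    case False
    then have q: "q > 0" using pq by simp
    then have p: "p > 0" using q_le pq by (cases "p = 0") auto
    have lip: "g y \<le> g x + dist_n n x y" for x y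
    proof -
      have "\<bar>\<epsilon> * y 0 - \<epsilon> * x 0\<bar> = \<bar>x 0 - y 0\<bar>"
        using \<epsilon> by (simp add: right_diff_distrib[symmetric] abs_mult abs_minus_commute)
      also have "\<dots> \<le> dist_n n x y" unfolding dist_n_def
        using abs_coord_le_norm_n[of 0 n "\<lambda>i. x i - y i"] n by simp
      finally show ?thesis by (auto simp: g_def max_def)
    qed
    have "?E (\<lambda>x. g x * W x) / p \<le> ?E g + sqrt (2 / \<tau> * ln (q / p\<^sup>2))"
      unfolding p_def q_def
      by (rule transport_weighted[OF B'(1) \<tau> bW _ _ bg])
        (use p lip in \<open>auto simp: W_def g_def p_def\<close>)
    also have "?E g = ?E (\<lambda>x. \<epsilon> * x 0 + R)"
      by (rule AE_eq[OF _ bg]) (use abs_le in \<open>auto simp: g_def max_def abs_le_iff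
          intro!: bounded_meas_add bounded_meas_mult bounded_meas_const bx\<close>, force)
    also have "\<dots> = R"
      using int[OF bx] B'(4)[of 0] n prob_space by simp
    also have "?E (\<lambda>x. g x * W x) = ?E (\<lambda>x. (W x)\<^sup>2 + R * W x)"
    proof (rule AE_eq)
      fix x assume "x \<in> B"
      then show "g x * W x = (W x)\<^sup>2 + R * W x" using abs_le[of x]
        by (auto simp: g_def W_def max_def power2_eq_square algebra_simps abs_le_iff)
    qed (intro bounded_meas_add bounded_meas_mult bounded_meas_const bounded_meas_power bg bW)+
    also have "\<dots> = q + R * p"
      using int[OF bW] int[OF bounded_meas_power[OF bW, of 2]] by (simp add: p_def q_def)
    finally have "q / p \<le> sqrt (2 / \<tau> * ln (q / p\<^sup>2))" using p by (simp add: add_divide_distrib)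
    then have "(q / p)\<^sup>2 \<le> (sqrt (2 / \<tau> * ln (q / p\<^sup>2)))\<^sup>2" using p q by (intro power_mono) auto
    \<comment> \<open>\<open>sqrt\<close> of a negative number is negative, so squaring recovers the
      radicand only if its sign is known; the positive left side \<open>q / p\<close> settles
      it.\<close>
    moreover have "0 \<le> 2 / \<tau> * ln (q / p\<^sup>2)"
    proof (rule ccontr)
      assume "\<not> ?thesis"
      then have "sqrt (2 / \<tau> * ln (q / p\<^sup>2)) < 0" by simp
      moreover have "q / p > 0" using p q by simp
      ultimately show False using \<open>q / p \<le> _\<close> by linarith
    qed
    ultimately have "q * (q / p\<^sup>2) \<le> 2 / \<tau> * ln (q / p\<^sup>2)"
      by (simp add: power_divide power2_eq_square)
    also have "\<dots> \<le> 2 / \<tau> * (q / p\<^sup>2)"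
      using \<tau>(1) p q by (intro mult_left_mono ln_bound) auto
    finally have "q \<le> 2 / \<tau>" using p q by (simp only: mult_le_cancel_right) (auto simp: zero_less_divide_iff)
    then show ?thesis by (simp add: q_def W_def)
  qed
qed

text \<open>The square of a coordinate is the sum of the squares of its positive and negative parts,
  each worth \<open>2 / \<tau>\<close>. A single coordinate suffices, because isotropy gives every
  coordinate the second moment \<open>L^2\<close>.\<close>

lemma isotropic_constant_transport:
  assumes B: "isotropic_with n B L" and n: "n \<ge> 1" and \<tau>: "\<tau> > 0" "transport_ineq n (unif n B) \<tau>"
  shows "L\<^sup>2 \<le> 4 / \<tau>"
proof -
  let ?E = "\<lambda>f. \<integral>x. f x \<partial>unif n B"
  note B' = isotropic_withD[OF B]
  have int: "integrable (unif n B) (\<lambda>x. (max 0 (\<epsilon> * x 0))\<^sup>2)" if "\<bar>\<epsilon>\<bar> = 1" for \<epsilon>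
  proof (rule Bochner_Integration.integrable_bound)
    have "bounded_meas n B (\<lambda>x. (x 0)\<^sup>2)" using n by (intro bounded_meas_power bounded_meas_coord B') simp
    then show "integrable (unif n B) (\<lambda>x. (x 0)\<^sup>2)" by (rule integrable_unif[OF B'(1)])
    have [measurable]: "(\<lambda>x. x 0) \<in> borel_measurable (lborel_n n)" using n by simp
    show "(\<lambda>x. (max 0 (\<epsilon> * x 0))\<^sup>2) \<in> borel_measurable (unif n B)" by measurable
    have "\<epsilon>\<^sup>2 = 1" using that by (simp add: abs_square_eq_1)
    then show "AE x in unif n B. norm ((max 0 (\<epsilon> * x 0))\<^sup>2) \<le> norm ((x 0)\<^sup>2)"
      by (simp add: max_def power_mult_distrib)
  qed
  have "L\<^sup>2 = ?E (\<lambda>x. (x 0)\<^sup>2)" using B'(6)[of 0] n by simp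
  also have "\<dots> = ?E (\<lambda>x. (max 0 (1 * x 0))\<^sup>2 + (max 0 (-1 * x 0))\<^sup>2)"
    by (intro Bochner_Integration.integral_cong) (auto simp: max_def)
  also have "\<dots> = ?E (\<lambda>x. (max 0 (1 * x 0))\<^sup>2) + ?E (\<lambda>x. (max 0 (-1 * x 0))\<^sup>2)"
    by (intro Bochner_Integration.integral_add int) auto
  also have "\<dots> \<le> 2 / \<tau> + 2 / \<tau>" by (intro add_mono second_moment_half_le[OF B n \<tau>]) auto
  finally show ?thesis by simp
qed

text \<open>
  Weighting \<open>K\<close> by \<open>|x|\<close> instead of uniformly gives a bound on the second moment of \<open>K\<close> directly,
  without a reverse Hoelder inequality for log-concave measures.
\<close>

lemma second_moment_transport:
  assumes B: "isotropic_with n B L" and n: "n \<ge> 1" and \<tau>: "\<tau> > 0" "transport_ineq n (unif n B) \<tau>"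
    and K: "convex_body n K" and KB: "K \<subseteq> B"
  shows "sqrt (second_moment n K) \<le> 2 * sqrt (n / \<tau>) + sqrt (2 / \<tau> * (1 + ln (1 / vol n K)))"
proof -
  let ?E = "\<lambda>f. \<integral>x. f x \<partial>unif n B" and ?F = "\<lambda>f. \<integral>x. f x \<partial>unif n K"
  note B' = isotropic_withD[OF B]
  interpret B: prob_space "unif n B" by (rule prob_space_unif[OF B'(1)])
  interpret K: prob_space "unif n K" by (rule prob_space_unif[OF K])
  have K_sets [measurable]: "K \<in> sets (lborel_n n)" by (rule convex_body_sets[OF K])
  define v where "v = vol n K"
  have v: "v > 0" unfolding v_def by (rule convex_body_emeasure[OF K])
  have v1: "v \<le> 1"
    unfolding v_def B'(2)[symmetric] using KB convex_body_emeasure(1)[OF B'(1)] convex_body_sets[OF B'(1)]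
    by (intro measure_mono_fmeasurable) (auto intro: fmeasurableI)
  obtain R where R: "\<forall>x\<in>B. \<forall>i<n. \<bar>x i\<bar> \<le> R" using convex_body_bounded[OF B'(1)] by blast
  have norm_le: "norm_n n x \<le> sqrt (n * R\<^sup>2)" if "x \<in> B" for x
  proof -
    have "(norm_n n x)\<^sup>2 \<le> (\<Sum>i<n. R\<^sup>2)" unfolding norm_n_power2
      using R that by (intro sum_mono) (auto simp: abs_le_square_iff[symmetric] intro: order_trans[OF _ abs_ge_self])
    then show ?thesis by (intro real_le_rsqrt) simp
  qed
  have bN: "bounded_meas n B (norm_n n)" unfolding bounded_meas_def
    using norm_le by (auto simp: norm_n_nonneg)
  have bNK: "bounded_meas n K (norm_n n)" using bN KB by (auto simp: bounded_meas_def)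
  have restr: "?E (\<lambda>x. indicator K x * h x) = v * ?F h"
    if [measurable]: "h \<in> borel_measurable (lborel_n n)" for h
  proof -
    have "?E (\<lambda>x. indicator K x * h x) = (LINT x:B|lborel_n n. indicator K x * h x)"
      by (subst integral_unif[OF B'(1)]) (auto simp: B'(2))
    also have "\<dots> = (LINT x:K|lborel_n n. h x)"
      unfolding set_lebesgue_integral_def
      using KB by (intro Bochner_Integration.integral_cong) (auto simp: indicator_def)
    finally show ?thesis using integral_unif[OF K that] v by (simp add: v_def)
  qed
  define A where "A = ?E (norm_n n)"
  define m M2 where "m = ?F (norm_n n)" and "M2 = ?F (\<lambda>x. (norm_n n x)\<^sup>2)"
  have M2_eq: "second_moment n K = M2" by (simp add: M2_def second_moment_def)
  have int: "integrable (unif n B) (norm_n n)" "integrable (unif n B) (\<lambda>x. (norm_n n x)\<^sup>2)"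
    "integrable (unif n K) (norm_n n)" "integrable (unif n K) (\<lambda>x. (norm_n n x)\<^sup>2)"
    by (intro integrable_unif B'(1) K bounded_meas_power bN bNK)+
  have A_nonneg: "A \<ge> 0" and m_nonneg: "m \<ge> 0" and M2_nonneg: "M2 \<ge> 0"
    unfolding A_def m_def M2_def by (intro Bochner_Integration.integral_nonneg; simp add: norm_n_nonneg)+
  have var: "(\<integral>x. norm_n n x \<partial>P)\<^sup>2 \<le> (\<integral>x. (norm_n n x)\<^sup>2 \<partial>P)"
    if "prob_space P" "integrable P (norm_n n)" "integrable P (\<lambda>x. (norm_n n x)\<^sup>2)" for P
  proof -
    interpret P: prob_space P by fact
    have "P.variance (norm_n n) \<ge> 0" by (rule P.variance_positive)
    then show ?thesis using P.variance_eq[OF that(2,3)] by simp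
  qed
  have A_le: "A \<le> 2 * sqrt (n / \<tau>)"
  proof -
    have "A\<^sup>2 \<le> ?E (\<lambda>x. (norm_n n x)\<^sup>2)" unfolding A_def
      by (rule var[OF B.prob_space_axioms int(1,2)])
    also have "\<dots> = (\<Sum>i<n. ?E (\<lambda>x. (x i)\<^sup>2))"
      using second_moment_eq_sum[OF B'(1)] by (simp add: second_moment_def)
    also have "\<dots> = n * L\<^sup>2" using B'(6) by simp
    also have "\<dots> \<le> n * (4 / \<tau>)"
      by (intro mult_left_mono isotropic_constant_transport[OF B n \<tau>]) simp
    also have "\<dots> = (2 * sqrt (n / \<tau>))\<^sup>2" using \<tau>(1) by (simp add: power_mult_distrib)
    finally show ?thesis by (rule power2_le_imp_le) (use \<tau>(1) in simp)
  qed
  have m2: "m\<^sup>2 \<le> M2" unfolding m_def M2_def by (rule var[OF K.prob_space_axioms int(3,4)])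
  \<comment> \<open>Makes \<open>M2\<close> vanish together with \<open>m\<close>. In that case the
    weight has mean 0 and cannot be normalised, but the left side of the claim is 0.\<close>
  have M2_le: "M2 \<le> sqrt (n * R\<^sup>2) * m"
  proof -
    have "M2 \<le> ?F (\<lambda>x. sqrt (n * R\<^sup>2) * norm_n n x)" unfolding M2_def
    proof (rule integral_mono_AE)
      show "AE x in unif n K. (norm_n n x)\<^sup>2 \<le> sqrt (n * R\<^sup>2) * norm_n n x"
        using AE_unif_mem[OF K]
      proof eventually_elim
        case (elim x)
        then show ?case using norm_le[of x] KB norm_n_nonneg[of n x] unfolding power2_eq_square
          by (intro mult_right_mono) auto
      qed
    qed (use int in auto)
    then show ?thesis by (simp add: m_def)
  qed
  show ?thesis
  proof (cases "m = 0")
    case True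
    then have "M2 = 0" using M2_le M2_nonneg by simp
    then show ?thesis using A_le A_nonneg \<tau>(1) v v1 by (simp add: M2_eq v_def[symmetric] add_nonneg_nonneg)
  next
    case False
    then have m: "m > 0" using m_nonneg by simp
    \<comment> \<open>The defect in the reverse Hoelder direction between the first two moments of
      the norm on \<open>K\<close>. It is carried along until it cancels.\<close>
    define r where "r = M2 / m\<^sup>2"
    have r: "r \<ge> 1" using m m2 by (simp add: r_def)
    have M2_pos: "M2 > 0" using m m2 by (meson less_le_trans zero_less_power)
    define W where "W x = indicator K x * norm_n n x" for x
    have bW: "bounded_meas n B W"
    proof -
      have "\<bar>W x\<bar> \<le> sqrt (n * R\<^sup>2)" if "x \<in> B" for x
        using norm_le[OF that] norm_n_nonneg[of n x] by (auto simp: W_def indicator_def)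
      moreover have "W \<in> borel_measurable (lborel_n n)" by (simp add: W_def[abs_def])
      ultimately show ?thesis unfolding bounded_meas_def by blast
    qed
    have EW: "?E W = v * m" unfolding W_def m_def by (rule restr) simp
    have EW2: "?E (\<lambda>x. (W x)\<^sup>2) = v * M2" "?E (\<lambda>x. norm_n n x * W x) = v * M2"
    proof -
      have "(\<lambda>x. (W x)\<^sup>2) = (\<lambda>x. indicator K x * (norm_n n x)\<^sup>2)"
        "(\<lambda>x. norm_n n x * W x) = (\<lambda>x. indicator K x * (norm_n n x)\<^sup>2)"
        by (auto simp: fun_eq_iff W_def indicator_def power2_eq_square)
      then show "?E (\<lambda>x. (W x)\<^sup>2) = v * M2" "?E (\<lambda>x. norm_n n x * W x) = v * M2"
        using restr[of "\<lambda>x. (norm_n n x)\<^sup>2"] by (simp_all add: M2_def)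
    qed
    have lip: "norm_n n y \<le> norm_n n x + dist_n n x y" for x y
    proof -
      have "L2_set (\<lambda>i. x i + (y i - x i)) {..<n} \<le> L2_set x {..<n} + L2_set (\<lambda>i. y i - x i) {..<n}"
        by (rule L2_set_triangle_ineq)
      moreover have "norm_n n z = L2_set z {..<n}" for z
        by (simp add: norm_n_def inner_n_def L2_set_def power2_eq_square)
      moreover have "L2_set (\<lambda>i. y i - x i) {..<n} = L2_set (\<lambda>i. x i - y i) {..<n}"
        by (simp add: L2_set_def power2_commute)
      ultimately show ?thesis by (simp add: dist_n_def)
    qed
    have "v * M2 / (v * m) \<le> A + sqrt (2 / \<tau> * ln (v * M2 / (v * m)\<^sup>2))"
      using transport_weighted[OF B'(1) \<tau> bW _ _ bN norm_n_nonneg lip] m v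
      by (simp add: EW EW2 A_def) (simp add: W_def norm_n_nonneg)
    also have "v * M2 / (v * m)\<^sup>2 = r * (1 / v)" using v by (simp add: r_def power2_eq_square)
    finally have "M2 / m \<le> A + sqrt (2 / \<tau> * ln (r * (1 / v)))" using v by simp
    also have "ln (r * (1 / v)) = ln r + ln (1 / v)" using r v by (intro ln_mult_pos) auto
    also have "M2 / m = sqrt M2 * sqrt r"
      using m M2_pos by (simp add: r_def real_sqrt_divide power2_eq_square)
    finally have main: "sqrt M2 * sqrt r \<le> A + sqrt (2 / \<tau> * (ln r + ln (1 / v)))" .
    \<comment> \<open>The left side of \<open>main\<close> carries the factor \<open>sqrt r\<close>.
      By \<open>ln r \<le> r\<close>, \<open>r \<ge> 1\<close> and \<open>v \<le> 1\<close>, the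
      right side is at most \<open>sqrt r\<close> times its value with \<open>ln r\<close> replaced
      by 1, and \<open>sqrt r\<close> can be divided out.\<close>
    have "sqrt (2 / \<tau> * (ln r + ln (1 / v))) \<le> sqrt (2 / \<tau> * (1 + ln (1 / v))) * sqrt r"
    proof -
      have "ln r \<le> r" using r by (intro ln_bound) simp
      moreover have "ln (1 / v) \<le> ln (1 / v) * r" using r v v1 by (simp add: mult_le_cancel_left1)
      ultimately have "ln r + ln (1 / v) \<le> (1 + ln (1 / v)) * r" by (simp add: distrib_right)
      then have "2 / \<tau> * (ln r + ln (1 / v)) \<le> 2 / \<tau> * ((1 + ln (1 / v)) * r)"
        using \<tau>(1) by (intro mult_left_mono) auto
      then show ?thesis unfolding real_sqrt_mult[symmetric] mult.assoc by (rule real_sqrt_le_mono)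
    qed
    moreover have "A \<le> A * sqrt r" using A_nonneg r by (simp add: mult_le_cancel_left1)
    ultimately have "sqrt M2 * sqrt r \<le> (A + sqrt (2 / \<tau> * (1 + ln (1 / v)))) * sqrt r"
      using main by (simp add: distrib_right)
    then have "sqrt M2 \<le> A + sqrt (2 / \<tau> * (1 + ln (1 / v)))"
      using r by (simp add: mult_le_cancel_right)
    then show ?thesis using A_le by (simp add: M2_eq v_def)
  qed
qed

subsection \<open>Existence of a transport constant\<close>

text \<open>
  The coupling keeps the common part \<open>min 1 f\<close> on the diagonal and pairs the remainders
  \<open>max 0 (1 - f)\<close> and \<open>max 0 (f - 1)\<close> independently. The boolean coordinate selects the part.
\<close>

lemma (in prob_space) total_variation_coupling:
  fixes f :: "'a \<Rightarrow> real"
  assumes f [measurable]: "f \<in> borel_measurable M" and nn: "\<And>x. 0 \<le> f x"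
    and int_f: "integrable M f" and Ef: "expectation f = 1"
    and d [measurable]: "d \<in> borel_measurable (M \<Otimes>\<^sub>M M)"
    and d0: "\<And>x. x \<in> space M \<Longrightarrow> d (x, x) = 0"
    and dD: "AE x in M. AE y in M. d (x, y) \<le> ennreal D" and D: "D \<ge> 0"
  shows "\<exists>\<pi>\<in>couplings M (density M f). (\<integral>\<^sup>+z. d z \<partial>\<pi>) \<le> ennreal (D * expectation (\<lambda>x. max 0 (1 - f x)))"
proof -
  define a where "a x = max 0 (1 - f x)" for x
  define e where "e x = max 0 (f x - 1)" for x
  define \<delta> where "\<delta> = expectation a"
  have [measurable]: "a \<in> borel_measurable M" "e \<in> borel_measurable M"
    unfolding a_def[abs_def] e_def[abs_def] by measurable
  have ae_nn: "a x \<ge> 0" "e x \<ge> 0" for x by (auto simp: a_def e_def)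
  have int_a: "integrable M a"
    by (rule integrable_const_bound[of _ 1]) (auto simp: a_def nn max_def)
  have e_eq: "e x = a x + f x - 1" for x by (auto simp: a_def e_def max_def)
  have int_e: "integrable M e" unfolding e_eq[abs_def] using int_a int_f by simp
  have Ee: "expectation e = \<delta>"
    unfolding e_eq[abs_def] \<delta>_def using int_a int_f Ef prob_space by simp
  have \<delta>: "\<delta> \<ge> 0" unfolding \<delta>_def by (rule Bochner_Integration.integral_nonneg) (simp add: ae_nn)
  have nn_a: "(\<integral>\<^sup>+x. ennreal (a x) \<partial>M) = ennreal \<delta>"
    unfolding \<delta>_def by (rule nn_integral_eq_integral[OF int_a]) (simp add: ae_nn)
  have nn_e: "(\<integral>\<^sup>+x. ennreal (e x) \<partial>M) = ennreal \<delta>"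
    unfolding Ee[symmetric] by (rule nn_integral_eq_integral[OF int_e]) (simp add: ae_nn)
  \<comment> \<open>The normalisation of the product of the two remainders, each of mass \<delta>.
    For \<open>\<delta> = 0\<close> division by zero gives \<open>c = 0\<close>; both remainders
    then vanish almost everywhere, which is why the cancellation below is only an almost-everywhere
    statement.\<close>
  define c where "c = ennreal (1 / \<delta>)"
  have c_cancel: "AE x in M. ennreal (a x) * (c * ennreal \<delta>) = ennreal (a x)"
    "AE x in M. (ennreal \<delta> * c) * ennreal (e x) = ennreal (e x)"
  proof -
    show "AE x in M. ennreal (a x) * (c * ennreal \<delta>) = ennreal (a x)"
    proof (cases "\<delta> = 0")
      case True
      then have "AE x in M. a x = 0" using integral_nonneg_eq_0_iff_AE[OF int_a] ae_nn by (simp add: \<delta>_def)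
      then show ?thesis by eventually_elim simp
    qed (use \<delta> in \<open>simp add: c_def ennreal_mult[symmetric]\<close>)
    show "AE x in M. (ennreal \<delta> * c) * ennreal (e x) = ennreal (e x)"
    proof (cases "\<delta> = 0")
      case True
      then have "AE x in M. e x = 0" using integral_nonneg_eq_0_iff_AE[OF int_e] ae_nn Ee by simp
      then show ?thesis by eventually_elim simp
    qed (use \<delta> in \<open>simp add: c_def ennreal_mult[symmetric]\<close>)
  qed
  let ?N = "(M \<Otimes>\<^sub>M M) \<Otimes>\<^sub>M count_space (UNIV :: bool set)"
  define k where "k z = (if snd z then ennreal (min 1 (f (fst (fst z))))
    else ennreal (a (fst (fst z))) * c * ennreal (e (snd (fst z))))" for z :: "('a \<times> 'a) \<times> bool"
  define F where "F z = (if snd z then (fst (fst z), fst (fst z)) else fst z)" for z :: "('a \<times> 'a) \<times> bool"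
  define \<pi> where "\<pi> = distr (density ?N k) (M \<Otimes>\<^sub>M M) F"
  have k_m [measurable]: "k \<in> borel_measurable ?N" unfolding k_def[abs_def] by measurable
  have F_m [measurable]: "F \<in> measurable ?N (M \<Otimes>\<^sub>M M)" unfolding F_def[abs_def] by measurable
  interpret bool: finite_measure "count_space (UNIV :: bool set)" by (rule finite_measure_count_space) simp
  interpret MM: pair_prob_space M M ..
  \<comment> \<open>Both marginals and the cost are read off from this formula, with
    \<open>h\<close> an indicator in one coordinate or \<open>h = d\<close>.\<close>
  have nn_\<pi>: "(\<integral>\<^sup>+z. h z \<partial>\<pi>) = (\<integral>\<^sup>+x. ennreal (min 1 (f x)) * h (x, x) \<partial>M) +
      (\<integral>\<^sup>+x. (\<integral>\<^sup>+y. ennreal (a x) * c * ennreal (e y) * h (x, y) \<partial>M) \<partial>M)"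
    if h [measurable]: "h \<in> borel_measurable (M \<Otimes>\<^sub>M M)" for h
  proof -
    have "(\<integral>\<^sup>+z. h z \<partial>\<pi>) = (\<integral>\<^sup>+z. k z * h (F z) \<partial>?N)"
      unfolding \<pi>_def by (subst nn_integral_distr, measurable, subst nn_integral_density) measurable
    also have "\<dots> = (\<integral>\<^sup>+p. (\<integral>\<^sup>+b. k (p, b) * h (F (p, b)) \<partial>count_space UNIV) \<partial>(M \<Otimes>\<^sub>M M))"
      by (rule bool.nn_integral_fst[symmetric]) measurable
    also have "\<dots> = (\<integral>\<^sup>+p. ennreal (min 1 (f (fst p))) * h (fst p, fst p)
        + ennreal (a (fst p)) * c * ennreal (e (snd p)) * h p \<partial>(M \<Otimes>\<^sub>M M))"
      by (rule nn_integral_cong) (simp add: nn_integral_count_space_finite UNIV_bool k_def F_def add.commute)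
    also have "\<dots> = (\<integral>\<^sup>+x. (\<integral>\<^sup>+y. ennreal (min 1 (f x)) * h (x, x)
        + ennreal (a x) * c * ennreal (e y) * h (x, y) \<partial>M) \<partial>M)"
      by (subst nn_integral_fst[symmetric]) simp_all
    also have "\<dots> = (\<integral>\<^sup>+x. ennreal (min 1 (f x)) * h (x, x)
        + (\<integral>\<^sup>+y. ennreal (a x) * c * ennreal (e y) * h (x, y) \<partial>M) \<partial>M)"
      by (rule nn_integral_cong) (subst nn_integral_add, simp_all add: emeasure_space_1)
    also have "\<dots> = (\<integral>\<^sup>+x. ennreal (min 1 (f x)) * h (x, x) \<partial>M) +
      (\<integral>\<^sup>+x. (\<integral>\<^sup>+y. ennreal (a x) * c * ennreal (e y) * h (x, y) \<partial>M) \<partial>M)"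
      by (rule nn_integral_add) measurable
    finally show ?thesis .
  qed
  have sets_\<pi>: "sets \<pi> = sets (M \<Otimes>\<^sub>M M)" by (simp add: \<pi>_def)
  have [measurable_cong]: "sets \<pi> = sets (M \<Otimes>\<^sub>M M)" by (rule sets_\<pi>)
  have fst_\<pi>: "distr \<pi> M fst = M"
  proof (rule measure_eqI)
    fix E assume "E \<in> sets (distr \<pi> M fst)"
    then have [measurable]: "E \<in> sets M" by simp
    have "emeasure (distr \<pi> M fst) E = (\<integral>\<^sup>+x. indicator E x \<partial>distr \<pi> M fst)" by simp
    also have "\<dots> = (\<integral>\<^sup>+z. indicator E (fst z) \<partial>\<pi>)" by (rule nn_integral_distr) measurable
    also have "\<dots> = (\<integral>\<^sup>+x. ennreal (min 1 (f x)) * indicator E x \<partial>M) +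
      (\<integral>\<^sup>+x. (\<integral>\<^sup>+y. ennreal (a x) * c * ennreal (e y) * indicator E x \<partial>M) \<partial>M)"
      by (subst nn_\<pi>) simp_all
    also have "(\<integral>\<^sup>+x. (\<integral>\<^sup>+y. ennreal (a x) * c * ennreal (e y) * indicator E x \<partial>M) \<partial>M)
      = (\<integral>\<^sup>+x. ennreal (a x) * (c * ennreal \<delta>) * indicator E x \<partial>M)"
      by (rule nn_integral_cong) (simp add: nn_integral_multc nn_integral_cmult nn_e mult.assoc)
    also have "\<dots> = (\<integral>\<^sup>+x. ennreal (a x) * indicator E x \<partial>M)"
      by (rule nn_integral_cong_AE) (use c_cancel(1) in eventually_elim, simp)
    also have "(\<integral>\<^sup>+x. ennreal (min 1 (f x)) * indicator E x \<partial>M) + \<dots>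
      = (\<integral>\<^sup>+x. ennreal (min 1 (f x)) * indicator E x + ennreal (a x) * indicator E x \<partial>M)"
      by (rule nn_integral_add[symmetric]) measurable
    also have "\<dots> = (\<integral>\<^sup>+x. indicator E x \<partial>M)"
    proof (rule nn_integral_cong)
      fix x
      have "ennreal (min 1 (f x)) + ennreal (a x) = ennreal (min 1 (f x) + a x)"
        using nn ae_nn by (intro ennreal_plus[symmetric]) auto
      also have "min 1 (f x) + a x = 1" by (auto simp: a_def min_def max_def)
      finally show "ennreal (min 1 (f x)) * indicator E x + ennreal (a x) * indicator E x = indicator E x"
        by (simp add: distrib_right[symmetric])
    qed
    finally show "emeasure (distr \<pi> M fst) E = emeasure M E" by simp
  qed simp
  have snd_\<pi>: "distr \<pi> (density M f) snd = density M f"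
  proof (rule measure_eqI)
    fix E assume "E \<in> sets (distr \<pi> (density M f) snd)"
    then have [measurable]: "E \<in> sets M" by simp
    have "emeasure (distr \<pi> (density M f) snd) E = (\<integral>\<^sup>+x. indicator E x \<partial>distr \<pi> (density M f) snd)" by simp
    also have "\<dots> = (\<integral>\<^sup>+z. indicator E (snd z) \<partial>\<pi>)" by (rule nn_integral_distr) measurable
    also have "\<dots> = (\<integral>\<^sup>+x. ennreal (min 1 (f x)) * indicator E x \<partial>M) +
      (\<integral>\<^sup>+x. (\<integral>\<^sup>+y. ennreal (a x) * c * ennreal (e y) * indicator E y \<partial>M) \<partial>M)"
      by (subst nn_\<pi>) simp_all
    also have "(\<integral>\<^sup>+x. (\<integral>\<^sup>+y. ennreal (a x) * c * ennreal (e y) * indicator E y \<partial>M) \<partial>M)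
      = (\<integral>\<^sup>+x. ennreal (a x) * (c * (\<integral>\<^sup>+y. ennreal (e y) * indicator E y \<partial>M)) \<partial>M)"
      by (rule nn_integral_cong) (simp add: nn_integral_cmult mult.assoc)
    also have "\<dots> = ennreal \<delta> * c * (\<integral>\<^sup>+y. ennreal (e y) * indicator E y \<partial>M)"
      by (simp add: nn_integral_multc nn_a mult.assoc)
    also have "\<dots> = (\<integral>\<^sup>+y. ennreal \<delta> * c * (ennreal (e y) * indicator E y) \<partial>M)"
      by (rule nn_integral_cmult[symmetric]) measurable
    also have "\<dots> = (\<integral>\<^sup>+y. ennreal (e y) * indicator E y \<partial>M)"
      by (rule nn_integral_cong_AE)
        (use c_cancel(2) in eventually_elim, simp add: mult.assoc[symmetric])
    also have "(\<integral>\<^sup>+x. ennreal (min 1 (f x)) * indicator E x \<partial>M) + \<dots>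
      = (\<integral>\<^sup>+x. ennreal (min 1 (f x)) * indicator E x + ennreal (e x) * indicator E x \<partial>M)"
      by (rule nn_integral_add[symmetric]) measurable
    also have "\<dots> = (\<integral>\<^sup>+x. ennreal (f x) * indicator E x \<partial>M)"
    proof (rule nn_integral_cong)
      fix x
      have "ennreal (min 1 (f x)) + ennreal (e x) = ennreal (min 1 (f x) + e x)"
        using nn ae_nn by (intro ennreal_plus[symmetric]) auto
      also have "min 1 (f x) + e x = f x" by (auto simp: e_def min_def max_def)
      finally show "ennreal (min 1 (f x)) * indicator E x + ennreal (e x) * indicator E x
          = ennreal (f x) * indicator E x"
        by (simp add: distrib_right[symmetric])
    qed
    finally show "emeasure (distr \<pi> (density M f) snd) E = emeasure (density M f) E"
      by (simp add: emeasure_density)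
  qed simp
  have "prob_space \<pi>"
  proof (rule prob_spaceI)
    have "emeasure M (space M) = emeasure (distr \<pi> M fst) (space M)" by (simp add: fst_\<pi>)
    also have "\<dots> = emeasure \<pi> (fst -` space M \<inter> space \<pi>)" by (rule emeasure_distr) measurable
    also have "fst -` space M \<inter> space \<pi> = space \<pi>"
      using sets_eq_imp_space_eq[OF sets_\<pi>] by (auto simp: space_pair_measure)
    finally show "emeasure \<pi> (space \<pi>) = 1" by (simp add: emeasure_space_1)
  qed
  then have "\<pi> \<in> couplings M (density M f)"
    unfolding couplings_def using fst_\<pi> snd_\<pi> sets_\<pi> by (auto cong: sets_pair_measure_cong)
  \<comment> \<open>The diagonal part costs nothing, and the independent part has mass \<delta> and
    cost at most \<open>D\<close> almost everywhere.\<close>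
  moreover have "(\<integral>\<^sup>+z. d z \<partial>\<pi>) \<le> ennreal (D * \<delta>)"
  proof -
    have "(\<integral>\<^sup>+z. d z \<partial>\<pi>) = (\<integral>\<^sup>+x. ennreal (min 1 (f x)) * d (x, x) \<partial>M) +
      (\<integral>\<^sup>+x. (\<integral>\<^sup>+y. ennreal (a x) * c * ennreal (e y) * d (x, y) \<partial>M) \<partial>M)"
      by (rule nn_\<pi>[OF d])
    also have "(\<integral>\<^sup>+x. ennreal (min 1 (f x)) * d (x, x) \<partial>M) = 0"
      using d0 by (simp cong: nn_integral_cong)
    also have "(\<integral>\<^sup>+x. (\<integral>\<^sup>+y. ennreal (a x) * c * ennreal (e y) * d (x, y) \<partial>M) \<partial>M)
      \<le> (\<integral>\<^sup>+x. (\<integral>\<^sup>+y. ennreal (a x) * c * ennreal (e y) * ennreal D \<partial>M) \<partial>M)"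
    proof (rule nn_integral_mono_AE)
      show "AE x in M. (\<integral>\<^sup>+y. ennreal (a x) * c * ennreal (e y) * d (x, y) \<partial>M)
          \<le> (\<integral>\<^sup>+y. ennreal (a x) * c * ennreal (e y) * ennreal D \<partial>M)"
        using dD
      proof eventually_elim
        case (elim x)
        show ?case
          by (rule nn_integral_mono_AE) (use elim in \<open>eventually_elim, intro mult_left_mono, simp_all\<close>)
      qed
    qed
    also have "\<dots> = (\<integral>\<^sup>+x. ennreal (a x) * (c * ennreal \<delta>) * ennreal D \<partial>M)"
      by (rule nn_integral_cong) (simp add: nn_integral_multc nn_integral_cmult nn_e mult.assoc)
    also have "\<dots> = (\<integral>\<^sup>+x. ennreal (a x) * ennreal D \<partial>M)"
      by (rule nn_integral_cong_AE) (use c_cancel(1) in eventually_elim, simp)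
    also have "\<dots> = ennreal (D * \<delta>)"
      using D \<delta> by (subst nn_integral_multc) (simp_all add: nn_a ennreal_mult mult.commute)
    finally show ?thesis by simp
  qed
  ultimately show ?thesis unfolding \<delta>_def a_def[abs_def] by blast
qed

text \<open>This is \<open>ln u \<le> u - 1\<close> at \<open>u = 1 / sqrt t\<close>. Integrated
  with a probability density in place of \<open>t\<close>, it bounds the squared Hellinger distance
  by the relative entropy.\<close>

lemma mult_ln_ge_sqrt:
  assumes "(t::real) \<ge> 0" shows "(sqrt t - 1)\<^sup>2 \<le> t * ln t - t + 1"
proof (cases "t = 0")
  case False
  then have t: "t > 0" using assms by simp
  have "ln (1 / sqrt t) \<le> 1 / sqrt t - 1" using t by (intro ln_le_minus_one) simp
  then have "1 - 1 / sqrt t \<le> ln t / 2" using t by (simp add: ln_div ln_sqrt)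
  then have "(2 * t) * (1 - 1 / sqrt t) \<le> (2 * t) * (ln t / 2)" using t by (intro mult_left_mono) auto
  moreover have "t * 2 / sqrt t = 2 * sqrt t" using real_div_sqrt[of t] t by (simp add: mult.commute[of t] times_divide_eq_right[symmetric] del: times_divide_eq_right)
  ultimately have "2 * t - 2 * sqrt t \<le> t * ln t" by (simp add: algebra_simps)
  then show ?thesis using t by (simp add: power2_diff)
qed simp

text \<open>The left side factors as \<open>|sqrt t - 1| * (sqrt t + 1)\<close>; then weighted AM-GM
  and \<open>(sqrt t + 1)^2 \<le> 2 * (t + 1)\<close> apply. The free parameter \<open>s\<close>
  plays the part of the Cauchy--Schwarz inequality: it is optimised after integration.\<close>

lemma abs_diff_le_entropy:
  assumes t: "(t::real) \<ge> 0" and s: "s > 0"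
  shows "\<bar>t - 1\<bar> \<le> s / 2 * (t * ln t - t + 1) + (t + 1) / s"
proof -
  define u w where "u = \<bar>sqrt t - 1\<bar>" and "w = sqrt t + 1"
  have "t - 1 = (sqrt t - 1) * (sqrt t + 1)" using t by (simp add: algebra_simps)
  then have "\<bar>t - 1\<bar> = u * w" using t by (simp add: u_def w_def abs_mult)
  also have "\<dots> \<le> s / 2 * u\<^sup>2 + w\<^sup>2 / (2 * s)"
  proof -
    have "0 \<le> (s * u - w)\<^sup>2 / (2 * s)" using s by simp
    also have "\<dots> = s / 2 * u\<^sup>2 + w\<^sup>2 / (2 * s) - u * w"
      using s by (simp add: power2_eq_square field_simps)
    finally show ?thesis by simp
  qed
  also have "\<dots> \<le> s / 2 * (t * ln t - t + 1) + (t + 1) / s"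
  proof (rule add_mono)
    show "s / 2 * u\<^sup>2 \<le> s / 2 * (t * ln t - t + 1)"
      using mult_ln_ge_sqrt[OF t] s by (intro mult_left_mono) (auto simp: u_def)
    have "0 \<le> (sqrt t - 1)\<^sup>2" by simp
    then have "2 * sqrt t \<le> t + 1" using t by (simp add: power2_diff)
    then have "w\<^sup>2 \<le> 2 * (t + 1)" using t by (simp add: w_def power2_sum)
    then show "w\<^sup>2 / (2 * s) \<le> (t + 1) / s" using s by (simp add: field_simps)
  qed
  finally show ?thesis .
qed

text \<open>Since \<open>E f = 1\<close>, the integral of \<open>|f - 1|\<close> is twice the total
  variation \<delta>. Integrating the pointwise bound gives
  \<open>2 * \<delta> \<le> s / 2 * H + 2 / s\<close>, whose right side is least at
  \<open>s = 2 / sqrt H\<close>.\<close>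

lemma (in prob_space) total_variation_le_entropy:
  fixes f :: "'a \<Rightarrow> real"
  assumes f [measurable]: "f \<in> borel_measurable M" and nn: "\<And>x. 0 \<le> f x"
    and int_f: "integrable M f" and Ef: "expectation f = 1"
    and int_ent: "integrable M (\<lambda>x. f x * ln (f x))"
  shows "expectation (\<lambda>x. max 0 (1 - f x)) \<le> sqrt (expectation (\<lambda>x. f x * ln (f x)))"
proof -
  define H where "H = expectation (\<lambda>x. f x * ln (f x))"
  define \<delta> where "\<delta> = expectation (\<lambda>x. max 0 (1 - f x))"
  have int_a: "integrable M (\<lambda>x. max 0 (1 - f x))"
    by (rule integrable_const_bound[of _ 1]) (auto simp: nn max_def)
  have "0 \<le> expectation (\<lambda>x. f x * ln (f x) - f x + 1)"
    by (intro Bochner_Integration.integral_nonneg order_trans[OF zero_le_power2 mult_ln_ge_sqrt] nn)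
  also have "\<dots> = H" using int_f int_ent Ef prob_space by (simp add: H_def)
  finally have H: "H \<ge> 0" .
  have le: "2 * \<delta> \<le> s / 2 * H + 2 / s" if s: "s > 0" for s
  proof -
    have "2 * \<delta> = expectation (\<lambda>x. 2 * max 0 (1 - f x) + f x - 1)"
      using int_a int_f Ef prob_space by (simp add: \<delta>_def)
    also have "\<dots> \<le> expectation (\<lambda>x. s / 2 * (f x * ln (f x) - f x + 1) + (f x + 1) / s)"
    proof (rule integral_mono)
      show "2 * max 0 (1 - f x) + f x - 1 \<le> s / 2 * (f x * ln (f x) - f x + 1) + (f x + 1) / s" for x
        using abs_diff_le_entropy[OF nn[of x] s] by (auto simp: max_def abs_if split: if_splits)
    qed (use int_a int_f int_ent in auto)
    also have "\<dots> = s / 2 * H + 2 / s"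
      using int_f int_ent Ef prob_space by (simp add: H_def add_divide_distrib)
    finally show ?thesis .
  qed
  have "\<delta> \<le> sqrt H"
  proof (cases "H = 0")
    case True
    show ?thesis
    proof (rule ccontr)
      assume "\<not> \<delta> \<le> sqrt H"
      then have \<delta>: "\<delta> > 0" using True by simp
      \<comment> \<open>When \<open>H = 0\<close> arbitrarily large \<open>s\<close> are useful;
        \<open>2 / \<delta>\<close> already gives
        \<open>2 * \<delta> \<le> \<delta>\<close>.\<close>
      then show False using le[of "2 / \<delta>"] True by simp
    qed
  next
    case False
    then have "H > 0" using H by simp
    then have "2 / sqrt H / 2 * H + 2 / (2 / sqrt H) = 2 * sqrt H"
      by (simp add: real_div_sqrt)
    then show ?thesis using le[of "2 / sqrt H"] \<open>H > 0\<close> by simp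
  qed
  then show ?thesis by (simp add: H_def \<delta>_def)
qed

text \<open>Without an admissible constant the supremum in \<open>tau1\<close> would range over the
  empty set. The constant found here also supplies a positive lower bound for that supremum.\<close>

lemma transport_ineq_exists:
  assumes B: "convex_body n B" shows "\<exists>\<tau>>0. transport_ineq n (unif n B) \<tau>"
proof -
  let ?M = "unif n B"
  interpret prob_space ?M by (rule prob_space_unif[OF B])
  obtain R where R: "\<forall>x\<in>B. \<forall>i<n. \<bar>x i\<bar> \<le> R" using convex_body_bounded[OF B] by blast
  \<comment> \<open>The coordinates of a difference of two points of \<open>B\<close> are at most
    \<open>2 * R\<close> in absolute value; the added 1 makes \<open>D\<close> positive in every
    case.\<close>
  define D where "D = sqrt (n * (2 * R)\<^sup>2) + 1"
  have D: "D > 0" by (simp add: D_def add_nonneg_pos)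
  have dist_le: "dist_n n x y \<le> D" if "x \<in> B" "y \<in> B" for x y
  proof -
    have "(norm_n n (\<lambda>i. x i - y i))\<^sup>2 \<le> (\<Sum>i<n. (2 * R)\<^sup>2)" unfolding norm_n_power2
    proof (rule sum_mono)
      fix i assume "i \<in> {..<n}"
      then have "\<bar>x i\<bar> \<le> R" "\<bar>y i\<bar> \<le> R" using R that by auto
      then have "\<bar>x i - y i\<bar> \<le> \<bar>2 * R\<bar>" by linarith
      then show "(x i - y i)\<^sup>2 \<le> (2 * R)\<^sup>2" by (simp only: abs_le_square_iff)
    qed
    then have "dist_n n x y \<le> sqrt (n * (2 * R)\<^sup>2)" unfolding dist_n_def by (intro real_le_rsqrt) simp
    then show ?thesis by (simp add: D_def)
  qed
  \<comment> \<open>For this constant the right side of the transport inequality is exactly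
    \<open>D\<close> times the square root of the entropy.\<close>
  have "transport_ineq n ?M (2 / D\<^sup>2)"
    unfolding transport_ineq_def
  proof (intro allI impI, elim conjE)
    fix \<nu> assume \<nu>: "prob_space \<nu>" "sets \<nu> = sets ?M" "absolutely_continuous ?M \<nu>"
      and ent: "rel_entropy \<nu> ?M \<noteq> \<infinity>"
    interpret \<nu>: prob_space \<nu> by fact
    obtain f where f: "f \<in> borel_measurable ?M" "AE x in ?M. RN_deriv ?M \<nu> x = ennreal (f x)" "\<And>x. 0 \<le> f x"
      using real_RN_deriv[OF \<nu>.finite_measure_axioms \<nu>(3,2)] by metis
    have \<nu>_eq: "\<nu> = density ?M f"
    proof -
      have "\<nu> = density ?M (RN_deriv ?M \<nu>)" by (rule density_RN_deriv[OF \<nu>(3,2), symmetric])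
      also have "\<dots> = density ?M f" using f by (intro density_cong) auto
      finally show ?thesis .
    qed
    have nn_f: "(\<integral>\<^sup>+x. ennreal (f x) \<partial>?M) = 1"
    proof -
      have "(\<integral>\<^sup>+x. ennreal (f x) \<partial>?M) = emeasure \<nu> (space ?M)"
        unfolding \<nu>_eq using f(1) sets.top[of ?M]
        by (subst emeasure_density) (auto intro!: nn_integral_cong)
      also have "\<dots> = 1" using \<nu>.emeasure_space_1 sets_eq_imp_space_eq[OF \<nu>(2)] by simp
      finally show ?thesis .
    qed
    have int_f: "integrable ?M f"
      using f(1,3) nn_f by (intro integrableI_nonneg) auto
    have Ef: "expectation f = 1"
      using nn_f nn_integral_eq_integral[OF int_f] f(3) by simp
    have int_ent: "integrable ?M (\<lambda>x. f x * ln (f x))"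
      and ent_eq: "rel_entropy \<nu> ?M = ereal (expectation (\<lambda>x. f x * ln (f x)))"
      using rel_entropy_density[OF f(1,3)] ent by (auto simp: \<nu>_eq split: if_splits)
    let ?d = "\<lambda>z. ennreal (dist_n n (fst z) (snd z))"
    have d_m: "?d \<in> borel_measurable (?M \<Otimes>\<^sub>M ?M)"
      using dist_n_measurable[of n] by (simp cong: measurable_cong_sets sets_pair_measure_cong)
    have dD: "AE x in ?M. AE y in ?M. ?d (x, y) \<le> ennreal D"
      using AE_unif_mem[OF B]
    proof eventually_elim
      case (elim x)
      show ?case using AE_unif_mem[OF B] by eventually_elim (simp add: dist_le elim ennreal_leI)
    qed
    have d0: "?d (x, x) = 0" for x by (simp add: dist_n_def norm_n_def inner_n_def)
    obtain \<pi> where \<pi>: "\<pi> \<in> couplings ?M \<nu>"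
      "(\<integral>\<^sup>+z. ?d z \<partial>\<pi>) \<le> ennreal (D * expectation (\<lambda>x. max 0 (1 - f x)))"
      using total_variation_coupling[OF f(1,3) int_f Ef d_m d0 dD less_imp_le[OF D]]
      unfolding \<nu>_eq by blast
    have "wasserstein1 n ?M \<nu> \<le> (\<integral>\<^sup>+z. ?d z \<partial>\<pi>)"
      unfolding wasserstein1_def by (rule INF_lower[OF \<pi>(1)])
    also note \<pi>(2)
    also have "ennreal (D * expectation (\<lambda>x. max 0 (1 - f x)))
        \<le> ennreal (D * sqrt (expectation (\<lambda>x. f x * ln (f x))))"
      using total_variation_le_entropy[OF f(1,3) int_f Ef int_ent] D
      by (intro ennreal_leI mult_left_mono) auto
    also have "D * sqrt (expectation (\<lambda>x. f x * ln (f x)))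
        = sqrt (2 / (2 / D\<^sup>2) * real_of_ereal (rel_entropy \<nu> ?M))"
      using D by (simp add: ent_eq real_sqrt_mult)
    finally show "wasserstein1 n ?M \<nu> \<le> ennreal (sqrt (2 / (2 / D\<^sup>2) * real_of_ereal (rel_entropy \<nu> ?M)))" .
  qed
  then show ?thesis using D by (intro exI[of _ "2 / D\<^sup>2"]) simp
qed

subsection \<open>The bound\<close>

text \<open>A homothety carries a cube containing \<open>K\<close> onto a cube inside
  \<open>B\<close>. This makes the set in the definition of \<open>volume_ratio\<close>
  nonempty.\<close>

lemma affine_image_into_body:
  assumes K: "convex_body n K" and B: "convex_body n B"
  shows "\<exists>T. invertible_affine n T \<and> T ` K \<subseteq> B"
proof -
  obtain R where R: "R > 0" "\<forall>x\<in>K. \<forall>i<n. \<bar>x i\<bar> \<le> R" using convex_body_bounded[OF K] by blast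
  obtain b e where e: "e > 0" "\<And>y. y \<in> Rn n \<Longrightarrow> (\<forall>i<n. \<bar>y i - b i\<bar> \<le> e) \<Longrightarrow> y \<in> B"
    using convex_body_contains_cube[OF B] by blast
  define T where "T = scale n (e / R) b"
  have "invertible_affine n T" unfolding T_def by (rule invertible_scale) (use e R in simp)
  moreover have "T x \<in> B" if "x \<in> K" for x
  proof (rule e(2))
    have "e / R * \<bar>x i\<bar> \<le> e / R * R" if "i < n" for i
      using R e(1) \<open>x \<in> K\<close> that by (intro mult_left_mono) auto
    then show "\<forall>i<n. \<bar>T x i - b i\<bar> \<le> e"
      using R e(1) by (simp add: T_def scale_def abs_mult)
  qed (simp add: T_def scale_def)
  ultimately show ?thesis by blast
qed

text \<open>The estimate for one map and one constant. Keeping \<open>sqrt \<tau>\<close> on the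
  left leaves a right side free of \<tau>, which therefore bounds all admissible constants at
  once.\<close>

lemma isotropic_constant_le_admissible:
  assumes n: "n \<ge> 1" and K: "convex_body n K" and B: "isotropic_with n B L"
    and \<tau>: "\<tau> > 0" "transport_ineq n (unif n B) \<tau>"
    and T: "invertible_affine n T" "T ` K \<subseteq> B" and s: "s = root n (vol n B / vol n (T ` K))"
  shows "s \<ge> 1" "isotropic_constant n K * sqrt \<tau> \<le> 4 * (1 + sqrt (ln s)) * s"
proof -
  note B' = isotropic_withD[OF B]
  have TK: "convex_body n (T ` K)" by (rule convex_body_affine_image[OF K T(1)])
  define w where "w = vol n (T ` K)"
  have w: "w > 0" unfolding w_def by (rule convex_body_emeasure[OF TK])
  have w1: "w \<le> 1"
    unfolding w_def B'(2)[symmetric]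
    using T(2) convex_body_emeasure(1)[OF B'(1)] convex_body_sets[OF B'(1)] convex_body_sets[OF TK]
    by (intro measure_mono_fmeasurable) (auto intro: fmeasurableI)
  have s_eq: "s = root n (1 / w)" by (simp add: s w_def B'(2))
  have s_pow: "s ^ n = 1 / w" using n w by (simp add: s_eq)
  show s1: "s \<ge> 1" using n w w1 by (simp add: s_eq)
  define l where "l = ln s"
  have l: "l \<ge> 0" using s1 by (simp add: l_def)
  \<comment> \<open>The entropy cost grows linearly in \<open>n\<close>; the factor
    \<open>sqrt n\<close> that it produces is compensated by the \<open>sqrt (M / n)\<close> in
    \<open>I_le\<close>.\<close>
  have ln_w: "ln (1 / w) = n * l" unfolding s_pow[symmetric] l_def using s1 by (simp add: ln_realpow)
  define I where "I = isotropic_constant n K"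
  define M where "M = second_moment n (T ` K)"
  have M: "M \<ge> 0" by (simp add: M_def second_moment_def)
  have I: "I > 0" "I ^ n * w \<le> sqrt (M / n) ^ n"
    using isotropic_constant_le[OF n K T(1)] by (simp_all add: I_def M_def w_def)
  have "I ^ n = (I ^ n * w) * s ^ n" using w by (simp add: s_pow)
  also have "\<dots> \<le> sqrt (M / n) ^ n * s ^ n" using I s1 by (intro mult_right_mono) auto
  also have "\<dots> = (sqrt (M / n) * s) ^ n" by (simp add: power_mult_distrib)
  finally have "I ^ n \<le> (sqrt (M / n) * s) ^ n" .
  then have I_le: "I \<le> sqrt (M / n) * s"
    using n I(1) M s1 by (subst (asm) power_mono_iff) auto
  have "sqrt M \<le> 2 * sqrt (n / \<tau>) + sqrt (2 / \<tau> * (1 + n * l))"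
    using second_moment_transport[OF B n \<tau> TK T(2)] by (simp add: M_def w_def[symmetric] ln_w)
  \<comment> \<open>Uses \<open>1 + n * l \<le> n * (1 + l)\<close>, valid for
    \<open>n \<ge> 1\<close>, and \<open>1 + l \<le> 2 * (1 + sqrt l)^2\<close>. This summand and
    the next each contribute 2 to the final constant 4.\<close>
  also have "sqrt (2 / \<tau> * (1 + n * l)) \<le> sqrt (n / \<tau>) * (2 * (1 + sqrt l))"
  proof (rule real_le_lsqrt)
    have "1 + n * l \<le> n * (1 + l)" using n by (simp add: distrib_left)
    also have "\<dots> \<le> n * (2 * (1 + sqrt l)\<^sup>2)"
    proof (rule mult_left_mono)
      show "1 + l \<le> 2 * (1 + sqrt l)\<^sup>2" using l by (simp add: power2_sum)
    qed simp
    finally have "2 / \<tau> * (1 + n * l) \<le> 2 / \<tau> * (n * (2 * (1 + sqrt l)\<^sup>2))"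
      using \<tau>(1) by (intro mult_left_mono) auto
    also have "\<dots> = (sqrt (n / \<tau>) * (2 * (1 + sqrt l)))\<^sup>2"
      using \<tau>(1) by (simp add: power_mult_distrib) (simp add: power2_eq_square algebra_simps)
    finally show "2 / \<tau> * (1 + n * l) \<le> (sqrt (n / \<tau>) * (2 * (1 + sqrt l)))\<^sup>2" .
  qed (use \<tau>(1) l in auto)
  also have "2 * sqrt (n / \<tau>) \<le> sqrt (n / \<tau>) * (2 * (1 + sqrt l))"
    using \<tau>(1) l by (simp add: distrib_left)
  finally have M_le: "sqrt M \<le> sqrt (n / \<tau>) * (4 * (1 + sqrt l))" by (simp add: algebra_simps)
  have "I * sqrt \<tau> \<le> sqrt (M / n) * s * sqrt \<tau>" using I_le \<tau>(1) by (intro mult_right_mono) auto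
  also have "\<dots> = sqrt M * (s * sqrt \<tau> / sqrt n)" by (simp add: real_sqrt_divide)
  also have "\<dots> \<le> sqrt (n / \<tau>) * (4 * (1 + sqrt l)) * (s * sqrt \<tau> / sqrt n)"
    using s1 \<tau>(1) by (intro mult_right_mono M_le) auto
  also have "\<dots> = 4 * (1 + sqrt l) * s" using n \<tau>(1) by (simp add: real_sqrt_divide)
  finally show "isotropic_constant n K * sqrt \<tau> \<le> 4 * (1 + sqrt (ln s)) * s" by (simp add: I_def l_def)
qed

theorem lemma1:
  shows "\<exists>c::real. c > 0 \<and>
    (\<forall>n\<ge>1. \<forall>K B. convex_body n K \<longrightarrow> convex_body n B \<longrightarrow> isotropic n B \<longrightarrow>
       isotropic_constant n K \<le>
         c * (1 + sqrt (ln (volume_ratio n B K))) * volume_ratio n B K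
           * tau1_body n B powr (-1/2))"
proof (intro exI[of _ 4] conjI allI impI)
  fix n K B assume n: "(1::nat) \<le> n" and K: "convex_body n K" and B: "convex_body n B" and "isotropic n B"
  then obtain L where L: "isotropic_with n B L" by (auto simp: isotropic_def)
  define I where "I = isotropic_constant n K"
  define S where "S = {root n (vol n B / vol n (T ` K)) |T. invertible_affine n T \<and> T ` K \<subseteq> B}"
  define \<T> where "\<T> = {\<tau>. \<tau> > 0 \<and> transport_ineq n (unif n B) \<tau>}"
  define v where "v = volume_ratio n B K"
  define b where "b = 4 * (1 + sqrt (ln v)) * v"
  have v_eq: "v = Inf S" by (simp add: v_def volume_ratio_def S_def)
  have tau_eq: "tau1_body n B = Sup \<T>" by (simp add: tau1_body_def tau1_def \<T>_def)
  have S_ne: "S \<noteq> {}" using affine_image_into_body[OF K B] by (auto simp: S_def)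
  obtain \<tau>0 where \<tau>0: "\<tau>0 > 0" "\<tau>0 \<in> \<T>" using transport_ineq_exists[OF B] by (auto simp: \<T>_def)
  have S1: "s \<ge> 1" if "s \<in> S" for s
    using that isotropic_constant_le_admissible(1)[OF n K L] \<tau>0 by (auto simp: S_def \<T>_def)
  have I: "I > 0"
    using isotropic_constant_le(1)[OF n K] affine_image_into_body[OF K B] by (auto simp: I_def)
  have v1: "v \<ge> 1" unfolding v_eq by (rule cInf_greatest[OF S_ne S1])
  \<comment> \<open>The infimum is a limit of admissible values, and the right side of the estimate
    is continuous at \<open>v \<ge> 1\<close>. Hence the estimate holds at \<open>v\<close> whether
    or not the infimum is attained.\<close>
  have "v \<in> closure S" unfolding v_eq using S1 by (intro closure_contains_Inf S_ne bdd_belowI[of S 1])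
  then obtain x where x: "\<And>k. x k \<in> S" "x \<longlonglongrightarrow> v" by (auto simp: closure_sequential)
  have I_le: "I * sqrt \<tau> \<le> b" if "\<tau> \<in> \<T>" for \<tau>
  proof (rule LIMSEQ_le_const)
    show "(\<lambda>k. 4 * (1 + sqrt (ln (x k))) * x k) \<longlonglongrightarrow> b"
      unfolding b_def using v1 by (intro tendsto_intros x(2)) auto
    have "I * sqrt \<tau> \<le> 4 * (1 + sqrt (ln (x k))) * x k" for k
      using x(1)[of k] isotropic_constant_le_admissible(2)[OF n K L] that
      by (auto simp: S_def \<T>_def I_def)
    then show "\<exists>N. \<forall>k\<ge>N. I * sqrt \<tau> \<le> 4 * (1 + sqrt (ln (x k))) * x k" by blast
  qed
  have b: "b \<ge> 0" using v1 by (simp add: b_def)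
  \<comment> \<open>Solved for \<tau>, the estimate bounds the admissible constants from above. The
    same bound then holds for their supremum, and solving it for \<open>I\<close> gives the
    theorem.\<close>
  have "\<tau> \<le> (b / I)\<^sup>2" if "\<tau> \<in> \<T>" for \<tau>
  proof -
    have "sqrt \<tau> \<le> b / I" using I_le[OF that] I by (simp add: field_simps)
    then have "(sqrt \<tau>)\<^sup>2 \<le> (b / I)\<^sup>2" using that by (intro power_mono) (auto simp: \<T>_def)
    then show ?thesis using that by (simp add: \<T>_def)
  qed
  then have Sup_le: "Sup \<T> \<le> (b / I)\<^sup>2" and "\<tau>0 \<le> Sup \<T>"
    using \<tau>0(2) by (auto intro!: cSup_least cSup_upper bdd_aboveI)
  then have Sup_pos: "Sup \<T> > 0" using \<tau>0(1) by simp
  have "sqrt (Sup \<T>) \<le> b / I" using real_sqrt_le_mono[OF Sup_le] b I by simp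
  then have "I \<le> b / sqrt (Sup \<T>)" using I Sup_pos by (simp add: field_simps)
  also have "\<dots> = b * Sup \<T> powr (-1/2)"
  proof -
    have half: "(-1/2 :: real) = - (1/2)" by simp
    show ?thesis unfolding half powr_minus powr_half_sqrt[OF less_imp_le[OF Sup_pos]]
      by (rule divide_inverse)
  qed
  finally show "isotropic_constant n K \<le> 4 * (1 + sqrt (ln (volume_ratio n B K))) * volume_ratio n B K
      * tau1_body n B powr (-1/2)"
    by (simp add: I_def b_def v_def tau_eq)
qed simp

end
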